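(* Let $G$ be a finite group, let $K/L$ be an abelian chief factor of $G$, let $F\subseteq\mathbb{C}$ be a field, and suppose that $\theta\in\operatorname{Irr}(K)$ is $F$-semi-invariant in $G$. Then one of the following holds: (a) $\theta=\phi^K$ with $\phi\in\operatorname{Irr}(L)$, and either (i) $F(\phi)=F(\theta)$, or (ii) $K/L\cong\operatorname{Gal}(F(\phi)/F(\theta))$ and $\phi$ is $F$-semi-invariant in $G$. (b) $\theta_L=\phi\in\operatorname{Irr}(L)$. (c) $\theta_L=e\phi$ with $\phi\in\operatorname{Irr}(L)$ and $e^2=|K/L|$, and $F(\theta)=F(\phi)$.
   Context: Characters are complex. For $X\trianglelefteq G$ and $\phi\in\operatorname{Irr}(X)$, let $e_\phi=\frac{\phi(1)}{|X|}\sum_{x\in X}\phi(x^{-1})x$ and $e_{(\phi,F)}=\sum_{\alpha\in\operatorname{Gal}(F(\phi)/F)}(e_\phi)^\alpha$, with $\alpha$ acting on coefficients. The character $\phi$ is $F$-semi-invariant in $G$ (semi-invariant over $F$) if $e_{(\phi,F)}$ is invariant under conjugation by $G$; equivalently, for every $g\in G$ there is $\alpha\in\operatorname{Gal}(F(\phi)/F)$ with $\phi^g=\phi^\alpha$. $F(\phi)$ is the field generated over $F$ by the values of $\phi$; $\phi^K$ is the induced character. *)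

theory Defs
  imports
    "Jordan_Normal_Form.VS_Connect"
    "HOL-Algebra.Bij"
    "HOL-Algebra.Generated_Fields"
    "HOL.Complex"
begin

text \<open>
  Class functions and elements of the group algebra (identified with their coefficient functions)
  on a subgroup \<open>X\<close> of \<open>G\<close> are functions from the element type of \<open>G\<close> to \<^typ>\<open>complex\<close> that vanish
  outside \<open>X\<close>, so that HOL equality is equality of functions on \<open>X\<close>. A subgroup \<open>X\<close>, regarded as a
  group, is \<open>G\<lparr>carrier := X\<rparr>\<close>.
\<close>


subsection \<open>Irreducible complex characters\<close>

abbreviation GL :: "nat \<Rightarrow> complex mat monoid" where
  "GL n \<equiv> units_of (ring_mat TYPE(complex) n ())"

definition mat_trace :: "complex mat \<Rightarrow> complex" where
  "mat_trace A = (\<Sum>i<dim_row A. A $$ (i, i))"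

definition irreducible_rep :: "('a, 'b) monoid_scheme \<Rightarrow> nat \<Rightarrow> ('a \<Rightarrow> complex mat) \<Rightarrow> bool" where
  "irreducible_rep H n \<rho> \<longleftrightarrow>
     \<rho> \<in> hom H (GL n) \<and> n > 0 \<and>
     (\<forall>W. VectorSpace.subspace class_ring W (module_vec TYPE(complex) n) \<longrightarrow>
          (\<forall>h\<in>carrier H. \<forall>w\<in>W. \<rho> h *\<^sub>v w \<in> W) \<longrightarrow>
          W = {0\<^sub>v n} \<or> W = carrier_vec n)"

definition rep_character :: "('a, 'b) monoid_scheme \<Rightarrow> ('a \<Rightarrow> complex mat) \<Rightarrow> 'a \<Rightarrow> complex" where
  "rep_character H \<rho> = (\<lambda>h. if h \<in> carrier H then mat_trace (\<rho> h) else 0)"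

definition Irr :: "('a, 'b) monoid_scheme \<Rightarrow> ('a \<Rightarrow> complex) set" where
  "Irr H = {rep_character H \<rho> | n \<rho>. irreducible_rep H n \<rho>}"

definition restrict_char :: "'a set \<Rightarrow> ('a \<Rightarrow> complex) \<Rightarrow> 'a \<Rightarrow> complex" where
  "restrict_char L \<theta> = (\<lambda>x. if x \<in> L then \<theta> x else 0)"

definition induced_char ::
  "('a, 'b) monoid_scheme \<Rightarrow> 'a set \<Rightarrow> 'a set \<Rightarrow> ('a \<Rightarrow> complex) \<Rightarrow> 'a \<Rightarrow> complex" where
  "induced_char G L K \<phi> =
     (\<lambda>x. if x \<in> K
          then 1 / of_nat (card L) *
               (\<Sum>k\<in>K. restrict_char L \<phi> (k \<otimes>\<^bsub>G\<^esub> x \<otimes>\<^bsub>G\<^esub> inv\<^bsub>G\<^esub> k))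
          else 0)"


subsection \<open>Fields of values and Galois groups inside the complex numbers\<close>

abbreviation complex_field :: "complex ring" where
  "complex_field \<equiv> class_ring"

definition value_field :: "complex set \<Rightarrow> 'a set \<Rightarrow> ('a \<Rightarrow> complex) \<Rightarrow> complex set" where
  "value_field F X \<phi> = generate_field complex_field (F \<union> \<phi> ` X)"

text \<open>
  \<open>galois_group E F\<close> is \<open>Gal(E/F)\<close>. As in \<^const>\<open>BijGroup\<close>, automorphisms of \<open>E\<close> are extensional
  functions (undefined outside \<open>E\<close>), so each automorphism is represented exactly once.
\<close>
definition galois_group :: "complex set \<Rightarrow> complex set \<Rightarrow> (complex \<Rightarrow> complex) monoid" where
  "galois_group E F =
     BijGroup E \<lparr>carrier :=
       {\<alpha> \<in> Bij E. \<alpha> \<in> Ring.ring_hom (complex_field\<lparr>carrier := E\<rparr>) (complex_field\<lparr>carrier := E\<rparr>) \<and>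
                  (\<forall>x\<in>F. \<alpha> x = x)}\<rparr>"


subsection \<open>Semi-invariant characters\<close>

definition central_idem ::
  "('a, 'b) monoid_scheme \<Rightarrow> 'a set \<Rightarrow> ('a \<Rightarrow> complex) \<Rightarrow> 'a \<Rightarrow> complex" where
  "central_idem G X \<phi> =
     (\<lambda>x. if x \<in> X then \<phi> \<one>\<^bsub>G\<^esub> / of_nat (card X) * \<phi> (inv\<^bsub>G\<^esub> x) else 0)"

definition central_idem_over ::
  "('a, 'b) monoid_scheme \<Rightarrow> 'a set \<Rightarrow> complex set \<Rightarrow> ('a \<Rightarrow> complex) \<Rightarrow> 'a \<Rightarrow> complex" where
  "central_idem_over G X F \<phi> =
     (\<lambda>x. \<Sum>\<alpha>\<in>carrier (galois_group (value_field F X \<phi>) F). \<alpha> (central_idem G X \<phi> x))"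

text \<open>
  The conjugate \<open>g a g\<^sup>-\<^sup>1\<close> in the group algebra: its coefficient at \<open>y\<close> is the coefficient of \<open>a\<close> at
  \<open>g\<^sup>-\<^sup>1 y g\<close>.
\<close>
definition conj_group_algebra ::
  "('a, 'b) monoid_scheme \<Rightarrow> 'a \<Rightarrow> ('a \<Rightarrow> complex) \<Rightarrow> 'a \<Rightarrow> complex" where
  "conj_group_algebra G g a =
     (\<lambda>y. if y \<in> carrier G then a (inv\<^bsub>G\<^esub> g \<otimes>\<^bsub>G\<^esub> y \<otimes>\<^bsub>G\<^esub> g) else 0)"

definition semi_invariant ::
  "('a, 'b) monoid_scheme \<Rightarrow> 'a set \<Rightarrow> complex set \<Rightarrow> ('a \<Rightarrow> complex) \<Rightarrow> bool" where
  "semi_invariant G X F \<phi> \<longleftrightarrow>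
     (\<forall>g\<in>carrier G.
        conj_group_algebra G g (central_idem_over G X F \<phi>) = central_idem_over G X F \<phi>)"


subsection \<open>Chief factors\<close>

definition chief_factor :: "('a, 'b) monoid_scheme \<Rightarrow> 'a set \<Rightarrow> 'a set \<Rightarrow> bool" where
  "chief_factor G K L \<longleftrightarrow>
     K \<lhd> G \<and> L \<lhd> G \<and> L \<subset> K \<and>
     (\<forall>M. M \<lhd> G \<longrightarrow> L \<subseteq> M \<longrightarrow> M \<subseteq> K \<longrightarrow> M = L \<or> M = K)"

abbreviation factor_group :: "('a, 'b) monoid_scheme \<Rightarrow> 'a set \<Rightarrow> 'a set \<Rightarrow> 'a set monoid" where
  "factor_group G K L \<equiv> G\<lparr>carrier := K\<rparr> Mod L"

end

theory Submission
  imports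
    Defs
    "Jordan_Normal_Form.DL_Rank"
    "Jordan_Normal_Form.Spectral_Radius"
    "HOL-Computational_Algebra.Fundamental_Theorem_Algebra"
begin

text \<open>
  By Schur's lemma an irreducible character \<open>\<chi>\<close> satisfies
  \<open>|G| \<chi>(x) \<chi>(y) = \<chi>(1) \<Sum>\<^sub>h \<chi>(x h y h\<^sup>-\<^sup>1)\<close> and \<open>\<Sum>\<^sub>x \<chi>(x) \<chi>(x\<^sup>-\<^sup>1) = |G|\<close>, and conversely these equations
  characterise the irreducible characters (predicate \<open>spherical\<close>). As they are polynomial with
  rational coefficients, conjugates of irreducible characters under the group, under field
  embeddings, and products with linear characters are irreducible, and Clifford's theorem follows by
  a direct summation.

  The subgroup generated by \<open>L\<close> and the support of \<open>\<theta>\<close> is normal in \<open>G\<close> by semi-invariance, so it is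
  \<open>K\<close> or \<open>L\<close>. In the first case \<open>\<lambda>\<theta> \<noteq> \<theta>\<close> for every nontrivial linear character \<open>\<lambda>\<close> of \<open>K/L\<close>, which
  forces the restriction of \<open>\<theta>\<close> to have norm 1. In the second case \<open>\<theta>\<close> vanishes off \<open>L\<close>. Let \<open>\<phi>\<close> be a
  constituent of the restriction. Modulo conjugation by \<open>K\<close>, every \<open>g\<close> in \<open>G\<close> acts on \<open>\<phi>\<close> as an
  automorphism of a cyclotomic extension of \<open>F\<close>; since those automorphisms commute, the stabiliser \<open>T\<close>
  of \<open>\<phi>\<close> in \<open>K\<close> is normal in \<open>G\<close>, and so is the subgroup \<open>A\<close> of all \<open>k\<close> in \<open>K\<close> that act on \<open>\<phi>\<close> as an
  automorphism over \<open>F(\<theta>)\<close>. If \<open>T = K\<close> then (c) holds; if \<open>T = L\<close> then (a)(i) or (a)(ii) holds according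
  to whether \<open>A = L\<close> or \<open>A = K\<close>.
\<close>

subsection \<open>Splitting off invariant subspaces\<close>

text \<open>The functional equation is what lets Galois theory in: an automorphism of a field of
  values cannot be applied to matrices with entries outside that field, whereas
  \<open>spherical\<close> and \<open>char_prod\<close> involve values only. Automorphisms of
  different fields of values are compared by extending them to the extension of F by the |G|-th
  roots of unity, which contains all these fields. The number e in (c) is the multiplicity m of
  \<phi> in the restriction of \<theta>. If \<theta> vanishes off L, comparing norms gives |T:L| =
  m^2; hence T = L means m = 1, which is the induced case, and T = K means m^2 = |K:L|. In the
  induced case Clifford's theorem provides, for each automorphism over F(\<theta>), a coset of T = L
  in K that acts on \<phi> in the same way. This identifies Gal(F(\<phi>)/F(\<theta>)) with A/L, and
  (i) and (ii) are its two extremes.\<close>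

lemma (in vec_space) subspace_coordinates:
  assumes W: "VectorSpace.subspace class_ring W V"
  obtains k P Q where "k \<le> n" "P \<in> carrier_mat n n" "Q \<in> carrier_mat n n"
    "P * Q = 1\<^sub>m n" "Q * P = 1\<^sub>m n"
    "W = {v \<in> carrier_vec n. \<forall>i. k \<le> i \<longrightarrow> i < n \<longrightarrow> (Q *\<^sub>v v) $ i = 0}"
proof -
  have sub: "submodule class_ring W V" using W by (simp add: subspace_def)
  have Wc: "W \<subseteq> carrier_vec n" using sub submodule.subset by fastforce
  have bound: "finite S \<and> card S \<le> n" if "S \<subseteq> carrier_vec n" "lin_indpt S" for S
    using li_le_dim[OF fin_dim, of S] that by (simp add: dim_is_n)
  have "lin_indpt {}" by (simp add: lin_dep_def)
  \<comment> \<open>Independent sets have at most n elements, so maximal ones exist; a maximal one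
    inside W spans W.\<close>
  then have "\<exists>A. finite A \<and> maximal A (\<lambda>S. S \<subseteq> W \<and> lin_indpt S)"
    by (intro maximal_exists[where N = n and B = "{}"]) (use bound Wc in auto)
  then obtain A where A: "maximal A (\<lambda>S. S \<subseteq> W \<and> lin_indpt S)" by blast
  have AW: "A \<subseteq> W" "lin_indpt A" using A by (auto simp: maximal_def)
  have spanA: "span A = W"
  proof
    show "span A \<subseteq> W" using span_is_subset[OF AW(1) sub] .
    show "W \<subseteq> span A"
    proof
      fix v assume v: "v \<in> W"
      show "v \<in> span A"
      proof (rule ccontr)
        assume nv: "v \<notin> span A"
        have vA: "v \<notin> A" using nv in_own_span[of A] AW Wc by auto
        have "lin_indpt (A \<union> {v})"
          using lin_dep_iff_in_span[of A v] AW Wc v nv vA by auto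
        then have "A \<union> {v} = A" using A v AW unfolding maximal_def by blast
        with vA show False by auto
      qed
    qed
  qed
  have "\<exists>B. finite B \<and> maximal B (\<lambda>S. S \<subseteq> carrier_vec n \<and> lin_indpt S \<and> A \<subseteq> S)"
    by (rule maximal_exists[where N = n and B = A]) (use bound AW Wc in auto)
  then obtain B where B: "maximal B (\<lambda>S. S \<subseteq> carrier_vec n \<and> lin_indpt S \<and> A \<subseteq> S)"
    by blast
  have Bp: "B \<subseteq> carrier_vec n" "lin_indpt B" "A \<subseteq> B" using B by (auto simp: maximal_def)
  have "S = B" if "B \<subseteq> S" "S \<subseteq> carrier_vec n" "lin_indpt S" for S
  proof -
    have "A \<subseteq> S" using that Bp by blast
    then show ?thesis using B that by (simp add: maximal_def)
  qed
  then have "maximal B (\<lambda>S. S \<subseteq> carrier_vec n \<and> lin_indpt S)"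
    unfolding maximal_def using Bp by metis
  then have bas: "basis B" by (rule max_li_is_basis)
  have fB: "finite B" using bound Bp by blast
  then have cB: "card B = n" using dim_basis[OF fB bas] dim_is_n by simp
  have fA: "finite A" using fB Bp finite_subset by blast
  obtain as where as: "set as = A" "distinct as" using finite_distinct_list[OF fA] by blast
  obtain bs where bs: "set bs = B - A" "distinct bs" using finite_distinct_list[of "B - A"] fB by blast
  define k where "k = length as"
  \<comment> \<open>The basis vectors of W come first, so every vector of \<open>B - A\<close> sits
    at a position from k on. The coordinates required to vanish are exactly those positions.\<close>
  define cs where "cs = as @ bs"
  have cs: "set cs = B" "distinct cs" "length cs = n"
  proof -
    show c: "set cs = B" "distinct cs" using as bs Bp by (auto simp: cs_def)
    then show "length cs = n" using distinct_card[OF c(2)] cB by simp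
  qed
  define P where "P = mat_of_cols n cs"
  have P: "P \<in> carrier_mat n n" using cs by (simp add: P_def mat_of_cols_carrier(1) carrier_matI)
  have colsP: "cols P = cs" unfolding P_def using cols_mat_of_cols cs Bp by blast
  have "rank P = n" using lin_indpt_full_rank[OF P] colsP cs Bp by simp
  then have "det P \<noteq> 0" using det_rank_iff[OF P] by simp
  then obtain Q where Q: "Q \<in> carrier_mat n n" "P * Q = 1\<^sub>m n" "Q * P = 1\<^sub>m n"
    using det_non_zero_imp_unit[OF P, of "()"] P by (auto simp: Units_def ring_mat_simps)
  have kn: "k \<le> n" using cs by (auto simp: k_def cs_def)
  let ?W = "{v \<in> carrier_vec n. \<forall>i. k \<le> i \<longrightarrow> i < n \<longrightarrow> (Q *\<^sub>v v) $ i = 0}"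
  have Qcs: "Q *\<^sub>v (cs ! j) = unit_vec n j" if "j < n" for j
  proof -
    have "col (Q * P) j = Q *\<^sub>v col P j" using that P Q by (intro col_mult2) auto
    then show ?thesis using Q that colsP P by (metis carrier_matD(2) cols_nth col_one)
  qed
  have sub': "submodule class_ring ?W V"
  proof (rule submodule.intro)
    show "Module.module class_ring V" using sub by (rule submodule.module)
    show "?W \<subseteq> carrier V" by auto
    show "v \<oplus>\<^bsub>V\<^esub> w \<in> ?W" if "v \<in> ?W" "w \<in> ?W" for v w
    proof -
      have "Q *\<^sub>v (v + w) = Q *\<^sub>v v + Q *\<^sub>v w"
        using that Q by (intro mult_add_distrib_mat_vec) auto
      then show ?thesis using that Q
        by (auto simp add: module_vec_simps simp del: index_mult_mat_vec)
    qed
    show "\<zero>\<^bsub>V\<^esub> \<in> ?W" using Q by (simp add: module_vec_simps)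
    show "c \<odot>\<^bsub>V\<^esub> v \<in> ?W" if "c \<in> carrier class_ring" "v \<in> ?W" for c v
    proof -
      have "Q *\<^sub>v (c \<cdot>\<^sub>v v) = c \<cdot>\<^sub>v (Q *\<^sub>v v)"
        using that Q by (intro mult_mat_vec) auto
      then show ?thesis using that Q
        by (auto simp add: module_vec_simps simp del: index_mult_mat_vec)
    qed
  qed
  have "A \<subseteq> ?W"
  proof
    fix v assume v: "v \<in> A"
    then obtain j where "j < k" "v = cs ! j" using as by (metis cs_def in_set_conv_nth k_def nth_append)
    then show "v \<in> ?W" using Qcs[of j] kn v AW Wc by auto
  qed
  then have "span A \<subseteq> ?W" using span_is_subset sub' by blast
  moreover have "?W \<subseteq> span A"
  proof
    fix v assume v: "v \<in> ?W"
    define w where "w = Q *\<^sub>v v"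
    have w: "w \<in> carrier_vec n" "\<And>i. k \<le> i \<Longrightarrow> i < n \<Longrightarrow> w $ i = 0" using v Q by (auto simp: w_def)
    have "v = P *\<^sub>v w" using v P Q by (simp add: w_def assoc_mult_mat_vec[symmetric, of _ n n _ n])
    also have "\<dots> = lincomb (\<lambda>a. w $ find_first a (cols P)) (set (cols P))"
      using lincomb_eq_mat_mult[OF P w(1)] colsP cs by simp
    also have "\<dots> = lincomb (\<lambda>a. w $ find_first a cs) B" using colsP cs by simp
    also have "\<dots> = lincomb (\<lambda>a. w $ find_first a cs) A"
    proof -
      have z: "w $ find_first a cs = 0" if a: "a \<in> B - A" for a
      proof -
        have "a \<in> set bs" using a bs by simp
        then obtain j where j: "j < length bs" "bs ! j = a"
          unfolding in_set_conv_nth by blast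
        have "cs ! (k + j) = a" "k + j < n" using j cs by (auto simp: cs_def k_def)
        then have "find_first a cs = k + j" using cs find_first_unique by metis
        then show ?thesis using w(2)[of "k+j"] \<open>k + j < n\<close> by simp
      qed
      have z': "w $ find_first a cs \<cdot>\<^sub>v a = 0\<^sub>v n" if "a \<in> B - A" for a
      proof -
        have "a \<in> carrier_vec n" using that Bp by auto
        then show ?thesis using z[OF that] by (intro eq_vecI) auto
      qed
      show ?thesis unfolding lincomb_def
        apply (rule M.add.finprod_mono_neutral_cong_right)
        subgoal using fB .
        subgoal using Bp(3) .
        subgoal using z' by (simp add: module_vec_simps)
        subgoal by simp
        subgoal using Bp(1) by (auto simp: module_vec_simps)
        done
    qed
    finally show "v \<in> span A" using finite_span[OF fA] AW Wc by auto
  qed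
  ultimately have "W = ?W" using spanA by simp
  then show thesis using that kn P Q by blast
qed

section \<open>Traces, matrix representations and Schur's lemma\<close>

lemma index_mult_mat_sum:
  assumes "A \<in> carrier_mat n m" "B \<in> carrier_mat m l" "i < n" "j < l"
  shows "(A * B) $$ (i, j) = (\<Sum>k<m. A $$ (i, k) * B $$ (k, j))"
  using assms by (auto simp: scalar_prod_def lessThan_atLeast0 intro!: sum.cong)

lemma mat_trace_carrier:
  "A \<in> carrier_mat n n \<Longrightarrow> mat_trace A = (\<Sum>i<n. A $$ (i, i))"
  by (auto simp: mat_trace_def)

lemma mat_trace_mult_comm:
  assumes A: "A \<in> carrier_mat n m" and B: "B \<in> carrier_mat m n"
  shows "mat_trace (A * B) = mat_trace (B * A)"
proof -
  have "mat_trace (A * B) = (\<Sum>i<n. \<Sum>k<m. A $$ (i, k) * B $$ (k, i))"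
    using A B index_mult_mat_sum[OF A B] by (auto simp: mat_trace_def intro!: sum.cong)
  also have "\<dots> = (\<Sum>k<m. \<Sum>i<n. B $$ (k, i) * A $$ (i, k))"
    by (subst sum.swap) (simp add: mult.commute)
  also have "\<dots> = mat_trace (B * A)"
    using A B index_mult_mat_sum[OF B A] by (auto simp: mat_trace_def intro!: sum.cong)
  finally show ?thesis .
qed

text \<open>Stated by equations alone, this passes at once to subgroups and to diagonal blocks;
  invertibility of \<open>\<rho> h\<close> comes back from \<open>\<rho> (inv h)\<close>. Dimension
  0 is allowed.\<close>

definition matrix_rep :: "('a, 'b) monoid_scheme \<Rightarrow> nat \<Rightarrow> ('a \<Rightarrow> complex mat) \<Rightarrow> bool" where
  "matrix_rep H n \<rho> \<longleftrightarrow>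
     (\<forall>h\<in>carrier H. \<rho> h \<in> carrier_mat n n) \<and> \<rho> \<one>\<^bsub>H\<^esub> = 1\<^sub>m n \<and>
     (\<forall>g\<in>carrier H. \<forall>h\<in>carrier H. \<rho> (g \<otimes>\<^bsub>H\<^esub> h) = \<rho> g * \<rho> h)"

lemma (in group) hom_GL_iff: "\<rho> \<in> hom G (GL n) \<longleftrightarrow> matrix_rep G n \<rho>"
proof
  interpret M: ring "ring_mat TYPE(complex) n ()" by (rule ring_mat)
  assume hom: "\<rho> \<in> hom G (GL n)"
  then have "\<rho> \<one> = \<one>\<^bsub>GL n\<^esub>" using hom_one[OF hom] M.units_group is_group by blast
  then show "matrix_rep G n \<rho>"
    using hom by (auto simp: matrix_rep_def hom_def units_of_def Units_def ring_mat_simps)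
next
  assume r: "matrix_rep G n \<rho>"
  have "\<rho> h \<in> Units (ring_mat TYPE(complex) n ())" if h: "h \<in> carrier G" for h
  proof -
    have "\<rho> (inv h) * \<rho> h = 1\<^sub>m n" "\<rho> h * \<rho> (inv h) = 1\<^sub>m n"
      using r h unfolding matrix_rep_def by (metis inv_closed l_inv r_inv)+
    then show ?thesis using r h by (auto simp: Units_def ring_mat_simps matrix_rep_def)
  qed
  then show "\<rho> \<in> hom G (GL n)"
    using r by (auto simp: matrix_rep_def hom_def units_of_def ring_mat_simps)
qed

text \<open>A complex matrix has an eigenvalue c, and the eigenspace is invariant because A commutes
  with the representation. It is nonzero, so irreducibility makes it the whole space.\<close>

lemma Schur_scalar:
  assumes irr: "irreducible_rep H n \<rho>" and rep: "matrix_rep H n \<rho>"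
    and A: "A \<in> carrier_mat n n"
    and comm: "\<And>h. h \<in> carrier H \<Longrightarrow> A * \<rho> h = \<rho> h * A"
  obtains c where "A = c \<cdot>\<^sub>m 1\<^sub>m n"
proof -
  have n: "n > 0" using irr by (simp add: irreducible_rep_def)
  obtain c where "eigenvalue A c" using spectrum_non_empty[OF A n] by (auto simp: spectrum_def)
  then obtain v where v: "v \<in> carrier_vec n" "v \<noteq> 0\<^sub>v n" "A *\<^sub>v v = c \<cdot>\<^sub>v v"
    using A by (auto simp: eigenvalue_def eigenvector_def)
  define W where "W = {v \<in> carrier_vec n. A *\<^sub>v v = c \<cdot>\<^sub>v v}"
  have sub: "VectorSpace.subspace class_ring W (module_vec TYPE(complex) n)"
  proof (intro subspace.intro submodule.intro)
    show "vectorspace class_ring (module_vec TYPE(complex) n)" by (rule vec_vs)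
    then show "Module.module class_ring (module_vec TYPE(complex) n)"
      by (simp add: vectorspace_def)
    show "W \<subseteq> carrier (module_vec TYPE(complex) n)" by (auto simp: W_def module_vec_simps)
    show "v \<oplus>\<^bsub>module_vec TYPE(complex) n\<^esub> w \<in> W" if "v \<in> W" "w \<in> W" for v w
    proof -
      have "A *\<^sub>v (v + w) = A *\<^sub>v v + A *\<^sub>v w"
        using that A by (intro mult_add_distrib_mat_vec) (auto simp: W_def)
      then show ?thesis using that
        by (auto simp: W_def module_vec_simps smult_add_distrib_vec[of _ n])
    qed
    show "\<zero>\<^bsub>module_vec TYPE(complex) n\<^esub> \<in> W" using A by (auto simp: W_def module_vec_simps)
    show "a \<odot>\<^bsub>module_vec TYPE(complex) n\<^esub> v \<in> W" if "v \<in> W" for a v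
    proof -
      have "A *\<^sub>v (a \<cdot>\<^sub>v v) = a \<cdot>\<^sub>v (A *\<^sub>v v)"
        using that A by (intro mult_mat_vec) (auto simp: W_def)
      then show ?thesis using that
        by (auto simp: W_def module_vec_simps smult_smult_assoc mult.commute)
    qed
  qed
  have "\<rho> h *\<^sub>v w \<in> W" if h: "h \<in> carrier H" and w: "w \<in> W" for h w
  proof -
    have R: "\<rho> h \<in> carrier_mat n n" using rep h by (auto simp: matrix_rep_def)
    have "A *\<^sub>v (\<rho> h *\<^sub>v w) = (A * \<rho> h) *\<^sub>v w"
      using A R w by (simp add: W_def assoc_mult_mat_vec[of _ n n _ n])
    also have "\<dots> = \<rho> h *\<^sub>v (A *\<^sub>v w)"
      using A R w comm[OF h] by (simp add: W_def assoc_mult_mat_vec[of _ n n _ n])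
    also have "\<dots> = c \<cdot>\<^sub>v (\<rho> h *\<^sub>v w)"
      using R w mult_mat_vec[OF R] by (simp add: W_def)
    finally show ?thesis using R w by (simp add: W_def)
  qed
  then have "W = {0\<^sub>v n} \<or> W = carrier_vec n"
    using irr sub unfolding irreducible_rep_def by blast
  then have all: "W = carrier_vec n" using v by (auto simp: W_def)
  have "A = c \<cdot>\<^sub>m 1\<^sub>m n"
  proof (rule eq_matI)
    fix i j assume ij: "i < dim_row (c \<cdot>\<^sub>m 1\<^sub>m n)" "j < dim_col (c \<cdot>\<^sub>m 1\<^sub>m n)"
    have "unit_vec n j \<in> W" unfolding all using ij by simp
    then have "A *\<^sub>v unit_vec n j = c \<cdot>\<^sub>v unit_vec n j" by (simp add: W_def)
    moreover have "(A *\<^sub>v unit_vec n j) $ i = A $$ (i, j)"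
      using A ij by (simp add: scalar_prod_right_unit)
    ultimately show "A $$ (i, j) = (c \<cdot>\<^sub>m 1\<^sub>m n) $$ (i, j)"
      using ij by (auto simp: unit_vec_def)
  qed (use A in auto)
  then show thesis by (rule that)
qed

text \<open>The sum of \<open>\<rho> h * A * \<rho> (inv h)\<close> over h commutes with the
  representation, so it is scalar by Schur's lemma; every summand has the trace of A, which fixes
  the scalar.\<close>

lemma (in group) Schur_average:
  assumes fin: "finite (carrier G)"
    and irr: "irreducible_rep G n \<rho>" and A: "A \<in> carrier_mat n n" and i: "i < n" and j: "j < n"
  shows "(\<Sum>h\<in>carrier G. (\<rho> h * A * \<rho> (inv h)) $$ (i, j)) =
    (if i = j then of_nat (card (carrier G)) / of_nat n * mat_trace A else 0)"
proof -
  have rep: "matrix_rep G n \<rho>" using irr hom_GL_iff by (simp add: irreducible_rep_def)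
  have n: "n > 0" using irr by (simp add: irreducible_rep_def)
  have R [simp]: "\<rho> h \<in> carrier_mat n n" if "h \<in> carrier G" for h
    using rep that by (auto simp: matrix_rep_def)
  have mult: "\<rho> (g \<otimes> h) = \<rho> g * \<rho> h" if "h \<in> carrier G" "g \<in> carrier G" for g h
    using rep that by (auto simp: matrix_rep_def)
  have mc: "B * C \<in> carrier_mat n n" if "B \<in> carrier_mat n n" "C \<in> carrier_mat n n"
    for B C :: "complex mat" using that by (rule mult_carrier_mat)
  define X where "X h = \<rho> h * A * \<rho> (inv h)" for h
  have X [simp]: "X h \<in> carrier_mat n n" if "h \<in> carrier G" for h
    unfolding X_def using that A R by (intro mult_carrier_mat[where n = n]) auto
  define M where "M = mat n n (\<lambda>(i, j). \<Sum>h\<in>carrier G. X h $$ (i, j))"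
  have M: "M \<in> carrier_mat n n" by (simp add: M_def)
  have "M * \<rho> g = \<rho> g * M" if g: "g \<in> carrier G" for g
  proof (rule eq_matI)
    fix i j assume "i < dim_row (\<rho> g * M)" "j < dim_col (\<rho> g * M)"
    then have ij: "i < n" "j < n" using R[OF g] M by auto
    \<comment> \<open>Replacing h by \<open>g \<otimes> h\<close> turns multiplication by
      \<open>\<rho> g\<close> on the left into multiplication on the right.\<close>
    have *: "\<rho> g * X h = X (g \<otimes> h) * \<rho> g" if h: "h \<in> carrier G" for h
    proof -
      have "X (g \<otimes> h) * \<rho> g = (\<rho> g * \<rho> h) * A * (\<rho> (inv h) * \<rho> (inv g)) * \<rho> g"
        using g h by (simp add: X_def mult inv_mult_group)
      also have "\<dots> = \<rho> g * (\<rho> h * A * (\<rho> (inv h) * (\<rho> (inv g) * \<rho> g)))"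
        using g h A R by (simp add: mc assoc_mult_mat[of _ n n _ n _ n])
      also have "\<rho> (inv g) * \<rho> g = 1\<^sub>m n"
        using rep g mult[of g "inv g"] by (auto simp: matrix_rep_def)
      finally show ?thesis using g h A R
        by (simp add: mc X_def right_mult_one_mat[of _ n n] assoc_mult_mat[of _ n n _ n _ n])
    qed
    have "(\<rho> g * M) $$ (i, j) = (\<Sum>k<n. \<rho> g $$ (i, k) * (\<Sum>h\<in>carrier G. X h $$ (k, j)))"
      using ij g by (subst index_mult_mat_sum[OF R M]) (auto simp: M_def intro!: sum.cong)
    also have "\<dots> = (\<Sum>h\<in>carrier G. \<Sum>k<n. \<rho> g $$ (i, k) * X h $$ (k, j))"
      by (subst sum.swap) (simp add: sum_distrib_left)
    also have "\<dots> = (\<Sum>h\<in>carrier G. (\<rho> g * X h) $$ (i, j))"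
      using ij g by (intro sum.cong refl) (subst index_mult_mat_sum[OF R X], auto)
    also have "\<dots> = (\<Sum>h\<in>carrier G. (X (g \<otimes> h) * \<rho> g) $$ (i, j))"
      using * by simp
    also have "\<dots> = (\<Sum>h\<in>carrier G. (X h * \<rho> g) $$ (i, j))"
    proof (rule sum.reindex_bij_betw)
      show "bij_betw ((\<otimes>) g) (carrier G) (carrier G)"
        using g by (intro bij_betwI[where g = "(\<otimes>) (inv g)"]) (auto simp: m_assoc[symmetric])
    qed
    also have "\<dots> = (\<Sum>h\<in>carrier G. \<Sum>k<n. X h $$ (i, k) * \<rho> g $$ (k, j))"
      using ij g by (intro sum.cong refl) (subst index_mult_mat_sum[OF X R], auto)
    also have "\<dots> = (\<Sum>k<n. (\<Sum>h\<in>carrier G. X h $$ (i, k)) * \<rho> g $$ (k, j))"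
      by (subst sum.swap) (simp add: sum_distrib_right)
    also have "\<dots> = (M * \<rho> g) $$ (i, j)"
      using ij g by (subst index_mult_mat_sum[OF M R]) (auto simp: M_def intro!: sum.cong)
    finally show "(M * \<rho> g) $$ (i, j) = (\<rho> g * M) $$ (i, j)" by simp
  qed (use M R[OF g] in auto)
  then obtain c where c: "M = c \<cdot>\<^sub>m 1\<^sub>m n" using Schur_scalar[OF irr rep M] by blast
  have trX: "mat_trace (X h) = mat_trace A" if h: "h \<in> carrier G" for h
  proof -
    have "mat_trace (X h) = mat_trace (\<rho> (inv h) * (\<rho> h * A))"
      unfolding X_def using h A R by (intro mat_trace_mult_comm[of _ n n] mc) auto
    also have "\<rho> (inv h) * (\<rho> h * A) = (\<rho> (inv h) * \<rho> h) * A"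
      using h A R by (simp add: mc assoc_mult_mat[of _ n n _ n _ n])
    also have "\<rho> (inv h) * \<rho> h = 1\<^sub>m n"
      using rep h mult[of h "inv h"] by (auto simp: matrix_rep_def)
    finally show ?thesis using A by simp
  qed
  have "of_nat n * c = mat_trace M" using c M by (simp add: mat_trace_def)
  also have "\<dots> = (\<Sum>i<n. \<Sum>h\<in>carrier G. X h $$ (i, i))" by (simp add: mat_trace_def M_def)
  also have "\<dots> = (\<Sum>h\<in>carrier G. mat_trace (X h))"
    by (subst sum.swap) (simp add: mat_trace_carrier[OF X])
  also have "\<dots> = of_nat (card (carrier G)) * mat_trace A" using trX by simp
  finally have "c = of_nat (card (carrier G)) / of_nat n * mat_trace A"
    using n by (simp add: field_simps)
  moreover have "(\<Sum>h\<in>carrier G. (\<rho> h * A * \<rho> (inv h)) $$ (i, j)) = M $$ (i, j)"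
    using i j by (simp add: M_def X_def)
  ultimately show ?thesis using c i j by auto
qed

text \<open>In coordinates adapted to a proper nonzero invariant subspace the matrices become block
  upper triangular. The diagonal blocks are representations again, and the trace is the sum of their
  traces.\<close>

lemma matrix_rep_split:
  assumes rep: "matrix_rep H n \<rho>" and H: "group H" and n: "n > 0"
    and red: "\<not> irreducible_rep H n \<rho>"
  obtains k \<rho>1 \<rho>2 where "k < n" "n - k < n" "matrix_rep H k \<rho>1" "matrix_rep H (n - k) \<rho>2"
    "\<And>h. h \<in> carrier H \<Longrightarrow> mat_trace (\<rho> h) = mat_trace (\<rho>1 h) + mat_trace (\<rho>2 h)"
proof -
  interpret H: group H by fact
  have R: "\<rho> h \<in> carrier_mat n n" if "h \<in> carrier H" for h
    using rep that by (auto simp: matrix_rep_def)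
  obtain W where W: "VectorSpace.subspace class_ring W (module_vec TYPE(complex) n)"
    and inv: "\<And>h w. h \<in> carrier H \<Longrightarrow> w \<in> W \<Longrightarrow> \<rho> h *\<^sub>v w \<in> W"
    and ne: "W \<noteq> {0\<^sub>v n}" "W \<noteq> carrier_vec n"
  proof -
    have "\<exists>W. VectorSpace.subspace class_ring W (module_vec TYPE(complex) n) \<and>
        (\<forall>h\<in>carrier H. \<forall>w\<in>W. \<rho> h *\<^sub>v w \<in> W) \<and> W \<noteq> {0\<^sub>v n} \<and> W \<noteq> carrier_vec n"
      using red rep n by (simp add: irreducible_rep_def H.hom_GL_iff)
    then show thesis using that by auto
  qed
  interpret vec_space "TYPE(complex)" n .
  obtain k P Q where k: "k \<le> n" and P: "P \<in> carrier_mat n n" and Q: "Q \<in> carrier_mat n n"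
    and PQ: "P * Q = 1\<^sub>m n" "Q * P = 1\<^sub>m n"
    and WQ: "W = {v \<in> carrier_vec n. \<forall>i. k \<le> i \<longrightarrow> i < n \<longrightarrow> (Q *\<^sub>v v) $ i = 0}"
    by (rule subspace_coordinates[OF W])
  have mc: "B * C \<in> carrier_mat n n" if "B \<in> carrier_mat n n" "C \<in> carrier_mat n n"
    for B C :: "complex mat" using that by (rule mult_carrier_mat)
  define S where "S h = Q * \<rho> h * P" for h
  have S: "S h \<in> carrier_mat n n" if "h \<in> carrier H" for h
    using R[OF that] P Q by (simp add: S_def mc)
  have S1: "S \<one>\<^bsub>H\<^esub> = 1\<^sub>m n" using rep P Q PQ by (simp add: S_def matrix_rep_def)
  have Smult: "S (g \<otimes>\<^bsub>H\<^esub> h) = S g * S h" if "g \<in> carrier H" "h \<in> carrier H" for g h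
  proof -
    have "S g * S h = Q * \<rho> g * ((P * Q) * (\<rho> h * P))"
      using R[OF that(1)] R[OF that(2)] P Q
      by (simp add: S_def mc assoc_mult_mat[of _ n n _ n _ n])
    also have "\<dots> = S (g \<otimes>\<^bsub>H\<^esub> h)"
      using R[OF that(1)] R[OF that(2)] P Q rep that
      by (simp add: S_def PQ mc left_mult_one_mat[of _ n n] assoc_mult_mat[of _ n n _ n _ n]
          matrix_rep_def)
    finally show ?thesis by simp
  qed
  \<comment> \<open>Column j of P is a basis vector of W, so its image under \<open>\<rho> h\<close>
    stays in W, where the coordinates from k on vanish.\<close>
  have S0: "S h $$ (i, j) = 0" if h: "h \<in> carrier H" and i: "k \<le> i" "i < n" and j: "j < k" for h i j
  proof -
    have jn: "j < n" using j k by simp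
    have Pj: "col P j \<in> W"
    proof -
      have "Q *\<^sub>v col P j = col (Q * P) j" using jn P Q by (intro col_mult2[symmetric]) auto
      then have "Q *\<^sub>v col P j = unit_vec n j" using PQ jn by simp
      then show ?thesis using j P jn by (auto simp: WQ simp del: index_mult_mat_vec)
    qed
    have "S h $$ (i, j) = col (Q * (\<rho> h * P)) j $ i"
      using i jn R[OF h] P Q by (simp add: S_def mc assoc_mult_mat[of _ n n _ n _ n])
    also have "col (Q * (\<rho> h * P)) j = Q *\<^sub>v (\<rho> h *\<^sub>v col P j)"
      by (simp only: col_mult2[OF Q mc[OF R[OF h] P] jn] col_mult2[OF R[OF h] P jn])
    finally show ?thesis using inv[OF h Pj] i by (simp add: WQ del: index_mult_mat_vec)
  qed
  \<comment> \<open>With k = 0 the subspace W would be zero, with k = n everything. Excluding both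
    makes both blocks smaller than n, as induction on the dimension demands.\<close>
  have k0: "k \<noteq> 0"
  proof
    assume "k = 0"
    have "v = 0\<^sub>v n" if v: "v \<in> W" for v
    proof -
      have vc: "v \<in> carrier_vec n" using v by (simp add: WQ)
      have "Q *\<^sub>v v = 0\<^sub>v n"
        using v \<open>k = 0\<close> Q by (intro eq_vecI) (auto simp: WQ simp del: index_mult_mat_vec)
      moreover have "v = P *\<^sub>v (Q *\<^sub>v v)"
        using vc P Q PQ by (simp add: assoc_mult_mat_vec[symmetric, of _ n n _ n])
      moreover have "P *\<^sub>v 0\<^sub>v n = 0\<^sub>v n" using P by (intro eq_vecI) auto
      ultimately show ?thesis by simp
    qed
    moreover have "0\<^sub>v n \<in> W" using Q by (simp add: WQ)
    ultimately show False using ne by blast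
  qed
  have kn: "k \<noteq> n" using ne(2) by (auto simp: WQ)
  define \<rho>1 where "\<rho>1 h = mat k k (\<lambda>ij. S h $$ ij)" for h
  define \<rho>2 where "\<rho>2 h = mat (n - k) (n - k) (\<lambda>(i, j). S h $$ (i + k, j + k))" for h
  have split: "(\<Sum>l<n. f l) = (\<Sum>l<k. f l) + (\<Sum>l<n - k. f (l + k))" for f :: "nat \<Rightarrow> complex"
  proof -
    have "(\<Sum>l<n. f l) = (\<Sum>l\<in>{..<k} \<union> {k..<n}. f l)" using k by (intro sum.cong) auto
    also have "\<dots> = (\<Sum>l<k. f l) + (\<Sum>l=k..<n. f l)" by (rule sum.union_disjoint) auto
    also have "(\<Sum>l=k..<n. f l) = (\<Sum>l<n - k. f (l + k))"
      using k by (intro sum.reindex_bij_witness[where i = "\<lambda>l. l + k" and j = "\<lambda>l. l - k"]) auto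
    finally show ?thesis .
  qed
  have c1: "\<rho>1 h \<in> carrier_mat k k" and c2: "\<rho>2 h \<in> carrier_mat (n - k) (n - k)" for h
    by (auto simp: \<rho>1_def \<rho>2_def)
  have "matrix_rep H k \<rho>1"
    unfolding matrix_rep_def
  proof (intro conjI ballI)
    show "\<rho>1 \<one>\<^bsub>H\<^esub> = 1\<^sub>m k" using k by (intro eq_matI) (auto simp: \<rho>1_def S1)
    fix g h assume gh: "g \<in> carrier H" "h \<in> carrier H"
    show "\<rho>1 (g \<otimes>\<^bsub>H\<^esub> h) = \<rho>1 g * \<rho>1 h"
    proof (rule eq_matI)
      fix i j assume "i < dim_row (\<rho>1 g * \<rho>1 h)" "j < dim_col (\<rho>1 g * \<rho>1 h)"
      then have ij: "i < k" "j < k" by (auto simp: \<rho>1_def)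
      have "\<rho>1 (g \<otimes>\<^bsub>H\<^esub> h) $$ (i, j) = (\<Sum>l<n. S g $$ (i, l) * S h $$ (l, j))"
        using ij k gh index_mult_mat_sum[OF S[OF gh(1)] S[OF gh(2)]] by (simp add: \<rho>1_def Smult)
      also have "\<dots> = (\<Sum>l<k. S g $$ (i, l) * S h $$ (l, j))"
        using S0[OF gh(2)] ij by (simp add: split)
      also have "\<dots> = (\<rho>1 g * \<rho>1 h) $$ (i, j)"
        using ij by (simp add: index_mult_mat_sum[OF c1 c1]) (simp add: \<rho>1_def)
      finally show "\<rho>1 (g \<otimes>\<^bsub>H\<^esub> h) $$ (i, j) = (\<rho>1 g * \<rho>1 h) $$ (i, j)" .
    qed (auto simp: \<rho>1_def)
  qed (rule c1)
  moreover have "matrix_rep H (n - k) \<rho>2"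
    unfolding matrix_rep_def
  proof (intro conjI ballI)
    show "\<rho>2 \<one>\<^bsub>H\<^esub> = 1\<^sub>m (n - k)" using k by (intro eq_matI) (auto simp: \<rho>2_def S1)
    fix g h assume gh: "g \<in> carrier H" "h \<in> carrier H"
    show "\<rho>2 (g \<otimes>\<^bsub>H\<^esub> h) = \<rho>2 g * \<rho>2 h"
    proof (rule eq_matI)
      fix i j assume "i < dim_row (\<rho>2 g * \<rho>2 h)" "j < dim_col (\<rho>2 g * \<rho>2 h)"
      then have ij: "i < n - k" "j < n - k" by (auto simp: \<rho>2_def)
      have "\<rho>2 (g \<otimes>\<^bsub>H\<^esub> h) $$ (i, j) = (\<Sum>l<n. S g $$ (i + k, l) * S h $$ (l, j + k))"
        using ij k gh index_mult_mat_sum[OF S[OF gh(1)] S[OF gh(2)]] by (simp add: \<rho>2_def Smult)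
      also have "\<dots> = (\<Sum>l<n - k. S g $$ (i + k, l + k) * S h $$ (l + k, j + k))"
        using S0[OF gh(1)] ij by (simp add: split)
      also have "\<dots> = (\<rho>2 g * \<rho>2 h) $$ (i, j)"
        using ij by (simp add: index_mult_mat_sum[OF c2 c2]) (simp add: \<rho>2_def)
      finally show "\<rho>2 (g \<otimes>\<^bsub>H\<^esub> h) $$ (i, j) = (\<rho>2 g * \<rho>2 h) $$ (i, j)" .
    qed (auto simp: \<rho>2_def)
  qed (rule c2)
  moreover have "mat_trace (\<rho> h) = mat_trace (\<rho>1 h) + mat_trace (\<rho>2 h)" if h: "h \<in> carrier H" for h
  proof -
    have "mat_trace (S h) = mat_trace (P * (Q * \<rho> h))"
      unfolding S_def using R[OF h] P Q by (intro mat_trace_mult_comm[of _ n n] mc) auto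
    also have "P * (Q * \<rho> h) = \<rho> h"
      using R[OF h] P Q PQ by (simp add: assoc_mult_mat[symmetric, of _ n n _ n _ n])
    finally have "mat_trace (\<rho> h) = (\<Sum>i<n. S h $$ (i, i))" using mat_trace_carrier[OF S[OF h]] by simp
    then show ?thesis by (simp add: split mat_trace_carrier[OF c1] mat_trace_carrier[OF c2])
        (simp add: \<rho>1_def \<rho>2_def)
  qed
  ultimately show thesis using that[of k \<rho>1 \<rho>2] k0 kn k by simp
qed

text \<open>Induction on the dimension, with the empty list for dimension 0. A list of characters,
  unlike a set, records multiplicities.\<close>

lemma matrix_rep_decompose:
  assumes "group H" and "matrix_rep H n \<rho>"
  shows "\<exists>cs. set cs \<subseteq> Irr H \<and> (\<forall>h\<in>carrier H. mat_trace (\<rho> h) = (\<Sum>\<chi>\<leftarrow>cs. \<chi> h))"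
  using assms(2)
proof (induction n arbitrary: \<rho> rule: less_induct)
  case (less n)
  show ?case
  proof (cases "n = 0")
    case True
    then show ?thesis using less.prems
      by (intro exI[of _ "[]"]) (auto simp: matrix_rep_def mat_trace_def)
  next
    case False
    show ?thesis
    proof (cases "irreducible_rep H n \<rho>")
      case True
      then show ?thesis
        by (intro exI[of _ "[rep_character H \<rho>]"]) (auto simp: Irr_def rep_character_def)
    next
      case red: False
      obtain k \<rho>1 \<rho>2 where s: "k < n" "n - k < n" "matrix_rep H k \<rho>1" "matrix_rep H (n - k) \<rho>2"
        "\<And>h. h \<in> carrier H \<Longrightarrow> mat_trace (\<rho> h) = mat_trace (\<rho>1 h) + mat_trace (\<rho>2 h)"
        using matrix_rep_split[OF less.prems assms(1) _ red] False by blast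
      obtain cs ds where
        "set cs \<subseteq> Irr H" "\<forall>h\<in>carrier H. mat_trace (\<rho>1 h) = (\<Sum>\<chi>\<leftarrow>cs. \<chi> h)"
        "set ds \<subseteq> Irr H" "\<forall>h\<in>carrier H. mat_trace (\<rho>2 h) = (\<Sum>\<chi>\<leftarrow>ds. \<chi> h)"
        using less.IH[OF s(1,3)] less.IH[OF s(2,4)] by blast
      then show ?thesis using s(5) by (intro exI[of _ "cs @ ds"]) auto
    qed
  qed
qed

subsection \<open>Irreducible characters as solutions of a functional equation\<close>

text \<open>The product equation says that \<chi> divided by its degree is multiplicative on the
  centre of the group algebra. It is homogeneous of degree two and so constrains \<chi> only up to a
  scalar; the norm equation fixes the scalar up to sign, and the positive degree fixes the
  sign.\<close>

definition spherical :: "('a, 'b) monoid_scheme \<Rightarrow> 'a set \<Rightarrow> ('a \<Rightarrow> complex) \<Rightarrow> bool" where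
  "spherical G K \<chi> \<longleftrightarrow>
     (\<exists>d::nat. d > 0 \<and> \<chi> \<one>\<^bsub>G\<^esub> = of_nat d) \<and> (\<forall>x. x \<notin> K \<longrightarrow> \<chi> x = 0) \<and>
     (\<forall>x\<in>K. \<forall>y\<in>K. of_nat (card K) * (\<chi> x * \<chi> y) =
        \<chi> \<one>\<^bsub>G\<^esub> * (\<Sum>h\<in>K. \<chi> (x \<otimes>\<^bsub>G\<^esub> (h \<otimes>\<^bsub>G\<^esub> y \<otimes>\<^bsub>G\<^esub> inv\<^bsub>G\<^esub> h)))) \<and>
     (\<Sum>x\<in>K. \<chi> x * \<chi> (inv\<^bsub>G\<^esub> x)) = of_nat (card K)"

definition class_fun :: "('a, 'b) monoid_scheme \<Rightarrow> 'a set \<Rightarrow> ('a \<Rightarrow> complex) \<Rightarrow> bool" where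
  "class_fun G K f \<longleftrightarrow> (\<forall>h\<in>K. \<forall>y\<in>K. f (h \<otimes>\<^bsub>G\<^esub> y \<otimes>\<^bsub>G\<^esub> inv\<^bsub>G\<^esub> h) = f y)"

text \<open>For characters this is |K| times the usual inner product. With \<open>inv x\<close> in
  place of complex conjugation the form is bilinear, and a field embedding can be applied to it term
  by term.\<close>

definition char_prod ::
    "('a, 'b) monoid_scheme \<Rightarrow> 'a set \<Rightarrow> ('a \<Rightarrow> complex) \<Rightarrow> ('a \<Rightarrow> complex) \<Rightarrow> complex" where
  "char_prod G K f g = (\<Sum>x\<in>K. f x * g (inv\<^bsub>G\<^esub> x))"

lemma sphericalD:
  assumes "spherical G K \<chi>"
  shows "\<chi> \<one>\<^bsub>G\<^esub> \<noteq> 0" "\<And>x. x \<notin> K \<Longrightarrow> \<chi> x = 0"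
    "\<And>x y. x \<in> K \<Longrightarrow> y \<in> K \<Longrightarrow> of_nat (card K) * (\<chi> x * \<chi> y) =
        \<chi> \<one>\<^bsub>G\<^esub> * (\<Sum>h\<in>K. \<chi> (x \<otimes>\<^bsub>G\<^esub> (h \<otimes>\<^bsub>G\<^esub> y \<otimes>\<^bsub>G\<^esub> inv\<^bsub>G\<^esub> h)))"
    "char_prod G K \<chi> \<chi> = of_nat (card K)"
  using assms by (auto simp: spherical_def char_prod_def)

lemma spherical_degree:
  assumes "spherical G K \<chi>"
  obtains d :: nat where "d > 0" "\<chi> \<one>\<^bsub>G\<^esub> = of_nat d"
  using assms by (auto simp: spherical_def)

lemma sum_list_neq_0E:
  assumes "(\<Sum>x\<leftarrow>xs. f x) \<noteq> (0 :: 'a :: comm_monoid_add)"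
  obtains x where "x \<in> set xs" "f x \<noteq> 0"
  using assms by (metis map_cong sum_list_0)

section \<open>Orthogonality, and irreducible characters as spherical functions\<close>

context group
begin

lemma subgroup_card_neq_0:
  assumes "subgroup K G" "finite K"
  shows "of_nat (card K) \<noteq> (0 :: complex)"
  using assms subgroup.one_closed by fastforce

lemma bij_betw_conj:
  assumes "subgroup K G" "h \<in> K"
  shows "bij_betw (\<lambda>y. h \<otimes> y \<otimes> inv h) K K"
proof -
  interpret K: subgroup K G by fact
  show ?thesis
    using assms(2)
    by (intro bij_betwI[where g = "\<lambda>y. inv h \<otimes> y \<otimes> h"])
       (auto simp: m_assoc K.mem_carrier, auto simp: m_assoc[symmetric] K.mem_carrier)
qed

lemma bij_betw_inv:
  assumes "subgroup K G"
  shows "bij_betw (\<lambda>y. inv y) K K"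
proof -
  interpret K: subgroup K G by fact
  show ?thesis by (intro bij_betwI[where g = "\<lambda>y. inv y"]) auto
qed

lemma bij_betw_mult_right:
  assumes "subgroup K G" "y \<in> K"
  shows "bij_betw (\<lambda>x. x \<otimes> y) K K"
proof -
  interpret K: subgroup K G by fact
  show ?thesis
    using assms(2)
    by (intro bij_betwI[where g = "\<lambda>x. x \<otimes> inv y"]) (auto simp: m_assoc)
qed

lemma char_prod_commute:
  assumes "subgroup K G"
  shows "char_prod G K f g = char_prod G K g f"
proof -
  interpret K: subgroup K G by fact
  have "(\<Sum>x\<in>K. f x * g (inv x)) = (\<Sum>x\<in>K. f (inv x) * g (inv (inv x)))"
    by (rule sum.reindex_bij_betw[OF bij_betw_inv[OF assms], symmetric])
  then show ?thesis by (simp add: char_prod_def mult.commute)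
qed

lemma class_fun_mult_commute:
  assumes K: "subgroup K G" and f: "class_fun G K f" and "x \<in> K" "y \<in> K"
  shows "f (x \<otimes> y) = f (y \<otimes> x)"
proof -
  interpret K: subgroup K G by fact
  have "f (inv x \<otimes> (x \<otimes> y) \<otimes> inv (inv x)) = f (x \<otimes> y)"
    using f assms(3,4) unfolding class_fun_def by blast
  moreover have "inv x \<otimes> (x \<otimes> y) \<otimes> inv (inv x) = y \<otimes> x"
    using assms(3,4) by (simp add: m_assoc[symmetric])
  ultimately show ?thesis by simp
qed

text \<open>At x = 1 the product equation expresses \<open>\<chi> y\<close> as the average of \<chi>
  over the conjugates of y, and that average depends on the class of y only.\<close>

lemma spherical_class_fun:
  assumes K: "subgroup K G" and fin: "finite K" and s: "spherical G K \<chi>"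
  shows "class_fun G K \<chi>"
  unfolding class_fun_def
proof (intro ballI)
  interpret K: subgroup K G by fact
  have avg: "of_nat (card K) * \<chi> y = (\<Sum>h\<in>K. \<chi> (h \<otimes> y \<otimes> inv h))" if y: "y \<in> K" for y
    using sphericalD(3)[OF s, of \<one> y] sphericalD(1)[OF s] y by simp
  fix h y assume h: "h \<in> K" and y: "y \<in> K"
  have "of_nat (card K) * \<chi> (h \<otimes> y \<otimes> inv h) = (\<Sum>k\<in>K. \<chi> (k \<otimes> (h \<otimes> y \<otimes> inv h) \<otimes> inv k))"
    using h y by (intro avg) auto
  also have "\<dots> = (\<Sum>k\<in>K. \<chi> ((k \<otimes> h) \<otimes> y \<otimes> inv (k \<otimes> h)))"
    using h y by (intro sum.cong refl) (simp add: inv_mult_group m_assoc)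
  also have "\<dots> = (\<Sum>k\<in>K. \<chi> (k \<otimes> y \<otimes> inv k))"
    by (rule sum.reindex_bij_betw[OF bij_betw_mult_right[OF K h]])
  also have "\<dots> = of_nat (card K) * \<chi> y" using avg[OF y] by simp
  finally show "\<chi> (h \<otimes> y \<otimes> inv h) = \<chi> y"
    using subgroup_card_neq_0[OF K fin] by simp
qed

text \<open>The product equation is multiplied by \<open>f (inv y)\<close> and summed over y; since
  f is a class function, conjugation by h is absorbed by a change of variable. So convolution with f
  acts on \<chi> as a scalar.\<close>

lemma spherical_convolution:
  assumes K: "subgroup K G" and fin: "finite K" and s: "spherical G K \<chi>" and f: "class_fun G K f"
    and x: "x \<in> K"
  shows "\<chi> \<one> * (\<Sum>y\<in>K. f (inv y) * \<chi> (x \<otimes> y)) = \<chi> x * char_prod G K \<chi> f"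
proof -
  interpret K: subgroup K G by fact
  have "of_nat (card K) * (\<chi> x * char_prod G K \<chi> f) =
      (\<Sum>y\<in>K. f (inv y) * (of_nat (card K) * (\<chi> x * \<chi> y)))"
    by (simp add: char_prod_def sum_distrib_left mult_ac)
  also have "\<dots> = \<chi> \<one> * (\<Sum>y\<in>K. \<Sum>h\<in>K. f (inv y) * \<chi> (x \<otimes> (h \<otimes> y \<otimes> inv h)))"
    using sphericalD(3)[OF s x] by (simp add: sum_distrib_left mult_ac)
  also have "(\<Sum>y\<in>K. \<Sum>h\<in>K. f (inv y) * \<chi> (x \<otimes> (h \<otimes> y \<otimes> inv h))) =
      (\<Sum>h\<in>K. \<Sum>y\<in>K. f (inv y) * \<chi> (x \<otimes> (h \<otimes> y \<otimes> inv h)))" by (rule sum.swap)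
  also have "\<dots> = (\<Sum>h\<in>K. \<Sum>y\<in>K. f (inv y) * \<chi> (x \<otimes> y))"
  proof (rule sum.cong[OF refl])
    fix h assume h: "h \<in> K"
    have "f (inv y) = f (inv (h \<otimes> y \<otimes> inv h))" if y: "y \<in> K" for y
    proof -
      have "inv (h \<otimes> y \<otimes> inv h) = h \<otimes> inv y \<otimes> inv h"
        using h y by (simp add: inv_mult_group m_assoc)
      then show ?thesis using f h y by (simp add: class_fun_def)
    qed
    then have "(\<Sum>y\<in>K. f (inv y) * \<chi> (x \<otimes> (h \<otimes> y \<otimes> inv h))) =
        (\<Sum>y\<in>K. f (inv (h \<otimes> y \<otimes> inv h)) * \<chi> (x \<otimes> (h \<otimes> y \<otimes> inv h)))" by simp
    also have "\<dots> = (\<Sum>y\<in>K. f (inv y) * \<chi> (x \<otimes> y))"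
      by (rule sum.reindex_bij_betw[OF bij_betw_conj[OF K h]])
    finally show "(\<Sum>y\<in>K. f (inv y) * \<chi> (x \<otimes> (h \<otimes> y \<otimes> inv h))) =
        (\<Sum>y\<in>K. f (inv y) * \<chi> (x \<otimes> y))" .
  qed
  also have "\<chi> \<one> * \<dots> = of_nat (card K) * (\<chi> \<one> * (\<Sum>y\<in>K. f (inv y) * \<chi> (x \<otimes> y)))" by simp
  finally show ?thesis using subgroup_card_neq_0[OF K fin] by simp
qed

text \<open>The mirror image of the preceding identity: here values of f at products are averaged
  against \<chi>. In Clifford's theorem f is a character of a larger group.\<close>

lemma spherical_convolution':
  assumes K: "subgroup K G" and fin: "finite K" and s: "spherical G K \<chi>" and f: "class_fun G K f"
    and y: "y \<in> K"
  shows "\<chi> \<one> * (\<Sum>x\<in>K. \<chi> (inv x) * f (x \<otimes> y)) = \<chi> y * char_prod G K \<chi> f"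
proof -
  interpret K: subgroup K G by fact
  have "(\<Sum>x\<in>K. \<chi> (inv x) * f (x \<otimes> y)) = (\<Sum>x\<in>K. \<chi> (y \<otimes> inv (x \<otimes> y)) * f (x \<otimes> y))"
    using y by (intro sum.cong refl) (simp add: inv_mult_group m_assoc[symmetric])
  also have "\<dots> = (\<Sum>z\<in>K. \<chi> (y \<otimes> inv z) * f z)"
    by (rule sum.reindex_bij_betw[OF bij_betw_mult_right[OF K y]])
  also have "\<dots> = (\<Sum>z\<in>K. \<chi> (y \<otimes> inv (inv z)) * f (inv z))"
    by (rule sum.reindex_bij_betw[OF bij_betw_inv[OF K], symmetric])
  also have "\<dots> = (\<Sum>z\<in>K. f (inv z) * \<chi> (y \<otimes> z))"
    by (intro sum.cong refl) (simp add: mult.commute)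
  finally show ?thesis using spherical_convolution[OF K fin s f y] by simp
qed

text \<open>The convolution of \<chi> and \<psi> is a multiple of each of them. If their pairing is
  not 0 they are therefore proportional; equal norms leave the factors 1 and -1, and positive
  degrees exclude -1.\<close>

lemma spherical_eqI:
  assumes K: "subgroup K G" and fin: "finite K" and s: "spherical G K \<chi>" and t: "spherical G K \<psi>"
    and ne: "char_prod G K \<chi> \<psi> \<noteq> 0"
  shows "\<chi> = \<psi>"
proof -
  interpret K: subgroup K G by fact
  have cf: "class_fun G K \<chi>" "class_fun G K \<psi>" using spherical_class_fun[OF K fin] s t by auto
  have eq: "\<chi> x * \<psi> \<one> = \<psi> x * \<chi> \<one>" if x: "x \<in> K" for x
  proof -
    have "\<chi> x * char_prod G K \<chi> \<psi> * \<psi> \<one> =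
        \<chi> \<one> * (\<psi> \<one> * (\<Sum>y\<in>K. \<psi> (inv y) * \<chi> (y \<otimes> x)))"
      unfolding spherical_convolution[OF K fin s cf(2) x, symmetric]
      using class_fun_mult_commute[OF K cf(1) x] by simp
    also have "\<dots> = \<chi> \<one> * (\<psi> x * char_prod G K \<chi> \<psi>)"
      using spherical_convolution'[OF K fin t cf(1) x] char_prod_commute[OF K] by simp
    finally show ?thesis using ne by simp
  qed
  define r where "r = \<chi> \<one> / \<psi> \<one>"
  have r: "\<chi> x = r * \<psi> x" if "x \<in> K" for x
    using eq[OF that] sphericalD(1)[OF t] by (simp add: r_def field_simps)
  have "char_prod G K \<chi> \<chi> = r\<^sup>2 * char_prod G K \<psi> \<psi>"
    unfolding char_prod_def sum_distrib_left
    by (intro sum.cong refl) (simp add: r power2_eq_square)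
  then have "r\<^sup>2 = 1"
    using sphericalD(4)[OF s] sphericalD(4)[OF t] subgroup_card_neq_0[OF K fin] by simp
  moreover obtain c d :: nat where "c > 0" "\<chi> \<one> = of_nat c" "d > 0" "\<psi> \<one> = of_nat d"
    using s t by (auto elim!: spherical_degree)
  ultimately have "(of_nat c :: complex)\<^sup>2 = (of_nat d)\<^sup>2"
    by (simp add: r_def power_divide)
  then have "c\<^sup>2 = d\<^sup>2" by (metis of_nat_eq_iff of_nat_power)
  then have "r = 1" using \<open>\<chi> \<one> = of_nat c\<close> \<open>\<psi> \<one> = of_nat d\<close> \<open>d > 0\<close> by (simp add: r_def)
  then show ?thesis using r sphericalD(2)[OF s] sphericalD(2)[OF t] by (intro ext) (metis mult_1)
qed

text \<open>Schur averaging with \<open>\<rho> y\<close> in the middle yields the product equation,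
  and with matrix units in the middle the norm equation.\<close>

lemma Irr_imp_spherical:
  assumes fin: "finite (carrier G)" and "\<chi> \<in> Irr G"
  shows "spherical G (carrier G) \<chi>"
proof -
  obtain n \<rho> where irr: "irreducible_rep G n \<rho>" and \<chi>: "\<chi> = rep_character G \<rho>"
    using assms(2) by (auto simp: Irr_def)
  have n: "n > 0" and rep: "matrix_rep G n \<rho>"
    using irr hom_GL_iff by (auto simp: irreducible_rep_def)
  have R: "\<rho> h \<in> carrier_mat n n" if "h \<in> carrier G" for h
    using rep that by (auto simp: matrix_rep_def)
  have mult: "\<rho> (g \<otimes> h) = \<rho> g * \<rho> h" if "h \<in> carrier G" "g \<in> carrier G" for g h
    using rep that by (auto simp: matrix_rep_def)
  have mc: "B * C \<in> carrier_mat n n" if "B \<in> carrier_mat n n" "C \<in> carrier_mat n n"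
    for B C :: "complex mat" using that by (rule mult_carrier_mat)
  have \<chi>': "\<chi> h = (\<Sum>i<n. \<rho> h $$ (i, i))" if "h \<in> carrier G" for h
    using that mat_trace_carrier[OF R[OF that]] by (simp add: \<chi> rep_character_def)
  let ?N = "of_nat (card (carrier G)) :: complex"
  have deg: "\<chi> \<one> = of_nat n" using rep by (simp add: \<chi>' matrix_rep_def)
  have sph: "?N * (\<chi> x * \<chi> y) = \<chi> \<one> * (\<Sum>h\<in>carrier G. \<chi> (x \<otimes> (h \<otimes> y \<otimes> inv h)))"
    if x: "x \<in> carrier G" and y: "y \<in> carrier G" for x y
  proof -
    have "(\<Sum>h\<in>carrier G. \<chi> (x \<otimes> (h \<otimes> y \<otimes> inv h))) =
        (\<Sum>h\<in>carrier G. \<Sum>i<n. \<Sum>j<n. \<rho> x $$ (i, j) * (\<rho> h * \<rho> y * \<rho> (inv h)) $$ (j, i))"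
    proof (intro sum.cong refl)
      fix h assume h: "h \<in> carrier G"
      have "\<chi> (x \<otimes> (h \<otimes> y \<otimes> inv h)) = (\<Sum>i<n. (\<rho> x * (\<rho> h * \<rho> y * \<rho> (inv h))) $$ (i, i))"
        using x y h by (simp add: \<chi>' mult)
      also have "\<dots> = (\<Sum>i<n. \<Sum>j<n. \<rho> x $$ (i, j) * (\<rho> h * \<rho> y * \<rho> (inv h)) $$ (j, i))"
        using x y h
        by (intro sum.cong refl index_mult_mat_sum[where n = n and m = n and l = n] mc R) auto
      finally show "\<chi> (x \<otimes> (h \<otimes> y \<otimes> inv h)) = \<dots>" .
    qed
    also have "\<dots> = (\<Sum>i<n. \<Sum>h\<in>carrier G. \<Sum>j<n. \<rho> x $$ (i, j) * (\<rho> h * \<rho> y * \<rho> (inv h)) $$ (j, i))"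
      by (rule sum.swap)
    also have "\<dots> = (\<Sum>i<n. \<Sum>j<n. \<Sum>h\<in>carrier G. \<rho> x $$ (i, j) * (\<rho> h * \<rho> y * \<rho> (inv h)) $$ (j, i))"
      by (intro sum.cong refl sum.swap)
    also have "\<dots> = (\<Sum>i<n. \<Sum>j<n. \<rho> x $$ (i, j) * (if j = i then ?N / of_nat n * mat_trace (\<rho> y) else 0))"
      using Schur_average[OF fin irr R[OF y]]
      by (intro sum.cong refl) (simp add: sum_distrib_left[symmetric])
    also have "\<dots> = (\<Sum>i<n. \<rho> x $$ (i, i) * (?N / of_nat n * mat_trace (\<rho> y)))"
      by (intro sum.cong refl) (simp add: if_distrib[where f = "\<lambda>a. _ * a"] sum.delta cong: if_cong)
    also have "\<dots> = \<chi> x * (?N / of_nat n * \<chi> y)"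
      using x y by (simp add: \<chi>' sum_distrib_right sum_divide_distrib mat_trace_carrier[OF R[OF y]])
    finally show ?thesis using n by (simp add: deg)
  qed
  have "(\<Sum>x\<in>carrier G. \<chi> x * \<chi> (inv x)) =
      (\<Sum>x\<in>carrier G. \<Sum>a<n. \<Sum>b<n. \<rho> x $$ (a, a) * \<rho> (inv x) $$ (b, b))"
    by (intro sum.cong refl) (simp add: \<chi>' sum_product)
  also have "\<dots> = (\<Sum>a<n. \<Sum>x\<in>carrier G. \<Sum>b<n. \<rho> x $$ (a, a) * \<rho> (inv x) $$ (b, b))"
    by (rule sum.swap)
  also have "\<dots> = (\<Sum>a<n. \<Sum>b<n. \<Sum>x\<in>carrier G. \<rho> x $$ (a, a) * \<rho> (inv x) $$ (b, b))"
    by (intro sum.cong refl sum.swap)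
  also have "\<dots> = (\<Sum>a<n. \<Sum>b<n. if a = b then ?N / of_nat n else 0)"
  proof (intro sum.cong refl)
    fix a b assume ab: "a \<in> {..<n}" "b \<in> {..<n}"
    \<comment> \<open>With this matrix unit in the middle, the (a, b) entry of
      \<open>\<rho> x * E * \<rho> (inv x)\<close> is the product of the two diagonal entries to be
      summed.\<close>
    define E where "E = mat n n (\<lambda>ij. if ij = (a, b) then 1 else (0::complex))"
    have E: "E \<in> carrier_mat n n" by (simp add: E_def)
    have trE: "mat_trace E = (if a = b then 1 else 0)"
    proof -
      have "mat_trace E = (\<Sum>i<n. if i = a then (if a = b then 1 else 0) else 0)"
        unfolding mat_trace_carrier[OF E] by (intro sum.cong refl) (auto simp: E_def)
      then show ?thesis using ab by simp
    qed
    have "(\<Sum>x\<in>carrier G. \<rho> x $$ (a, a) * \<rho> (inv x) $$ (b, b)) =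
        (\<Sum>x\<in>carrier G. (\<rho> x * E * \<rho> (inv x)) $$ (a, b))"
    proof (intro sum.cong refl)
      fix x assume x: "x \<in> carrier G"
      have RE: "(\<rho> x * E) $$ (a, j) = (if j = b then \<rho> x $$ (a, a) else 0)" if "j < n" for j
      proof -
        have "(\<rho> x * E) $$ (a, j) = (\<Sum>i<n. \<rho> x $$ (a, i) * E $$ (i, j))"
          using ab that x by (intro index_mult_mat_sum[OF R E]) auto
        also have "\<dots> = (\<Sum>i<n. if i = a then (if j = b then \<rho> x $$ (a, a) else 0) else 0)"
          using that by (intro sum.cong refl) (auto simp: E_def)
        finally show ?thesis using ab by simp
      qed
      have "(\<rho> x * E * \<rho> (inv x)) $$ (a, b) = (\<Sum>j<n. (\<rho> x * E) $$ (a, j) * \<rho> (inv x) $$ (j, b))"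
        using ab x by (intro index_mult_mat_sum[where n = n and m = n and l = n] mc R E) auto
      also have "\<dots> = (\<Sum>j<n. if j = b then \<rho> x $$ (a, a) * \<rho> (inv x) $$ (b, b) else 0)"
        by (intro sum.cong refl) (simp add: RE)
      finally show "\<rho> x $$ (a, a) * \<rho> (inv x) $$ (b, b) = (\<rho> x * E * \<rho> (inv x)) $$ (a, b)"
        using ab by simp
    qed
    also have "\<dots> = (if a = b then ?N / of_nat n * mat_trace E else 0)"
      using ab by (intro Schur_average[OF fin irr E]) auto
    finally show "(\<Sum>x\<in>carrier G. \<rho> x $$ (a, a) * \<rho> (inv x) $$ (b, b)) =
        (if a = b then ?N / of_nat n else 0)" by (simp add: trE)
  qed
  also have "\<dots> = ?N" using n by simp
  finally have "(\<Sum>x\<in>carrier G. \<chi> x * \<chi> (inv x)) = ?N" .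
  moreover have "\<chi> x = 0" if "x \<notin> carrier G" for x using that by (simp add: \<chi> rep_character_def)
  ultimately show ?thesis using sph deg n unfolding spherical_def by blast
qed

text \<open>The permutation matrices of left multiplication have trace 0 except at the identity,
  since no other element fixes a point. Pairing this character with a function extracts |G| times
  its value at the identity.\<close>

lemma regular_character:
  assumes fin: "finite (carrier G)"
  obtains cs where "set cs \<subseteq> Irr G"
    "\<And>x. x \<in> carrier G \<Longrightarrow> (\<Sum>\<chi>\<leftarrow>cs. \<chi> x) = (if x = \<one> then of_nat (card (carrier G)) else 0)"
proof -
  let ?n = "card (carrier G)"
  obtain e where e: "bij_betw e {..<?n} (carrier G)"
    using ex_bij_betw_nat_finite[OF fin] by (auto simp: atLeast0LessThan)
  have eG: "e i \<in> carrier G" if "i < ?n" for i using e that by (auto simp: bij_betw_def)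
  have inj: "e i = e j \<longleftrightarrow> i = j" if "i < ?n" "j < ?n" for i j
    using e that by (auto simp: bij_betw_def inj_on_def)
  define \<rho> where "\<rho> g = mat ?n ?n (\<lambda>(i, j). if e i = g \<otimes> e j then 1 else (0::complex))" for g
  have R: "\<rho> g \<in> carrier_mat ?n ?n" for g by (simp add: \<rho>_def)
  have "matrix_rep G ?n \<rho>"
    unfolding matrix_rep_def
  proof (intro conjI ballI R)
    show "\<rho> \<one> = 1\<^sub>m ?n" using eG inj by (intro eq_matI) (auto simp: \<rho>_def)
    fix g h assume gh: "g \<in> carrier G" "h \<in> carrier G"
    show "\<rho> (g \<otimes> h) = \<rho> g * \<rho> h"
    proof (rule eq_matI)
      fix i j assume "i < dim_row (\<rho> g * \<rho> h)" "j < dim_col (\<rho> g * \<rho> h)"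
      then have ij: "i < ?n" "j < ?n" by (auto simp: \<rho>_def)
      have "h \<otimes> e j \<in> e ` {..<?n}" using e gh eG[OF ij(2)] by (simp add: bij_betw_def)
      then obtain l where l: "l < ?n" "e l = h \<otimes> e j" by auto
      have "(\<rho> g * \<rho> h) $$ (i, j) = (\<Sum>k<?n. \<rho> g $$ (i, k) * \<rho> h $$ (k, j))"
        using ij by (intro index_mult_mat_sum[OF R R]) auto
      also have "\<dots> = (\<Sum>k<?n. if k = l then \<rho> g $$ (i, l) else 0)"
        using ij l inj by (intro sum.cong refl) (auto simp: \<rho>_def l(2)[symmetric])
      also have "\<dots> = \<rho> (g \<otimes> h) $$ (i, j)"
        using ij l gh eG by (simp add: \<rho>_def m_assoc)
      finally show "\<rho> (g \<otimes> h) $$ (i, j) = (\<rho> g * \<rho> h) $$ (i, j)" by simp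
    qed (auto simp: \<rho>_def)
  qed
  then obtain cs where cs: "set cs \<subseteq> Irr G" "\<forall>h\<in>carrier G. mat_trace (\<rho> h) = (\<Sum>\<chi>\<leftarrow>cs. \<chi> h)"
    using matrix_rep_decompose[OF is_group] by blast
  have "mat_trace (\<rho> x) = (if x = \<one> then of_nat ?n else 0)" if x: "x \<in> carrier G" for x
  proof -
    have "(e i = x \<otimes> e i) = (x = \<one>)" if "i < ?n" for i
      using x eG[OF that] by simp
    then have "mat_trace (\<rho> x) = (\<Sum>i<?n. if x = \<one> then 1 else 0)"
      unfolding mat_trace_carrier[OF R] by (intro sum.cong refl) (simp add: \<rho>_def)
    then show ?thesis by simp
  qed
  then show thesis using that[of cs] cs by simp
qed

lemma sum_list_char_prod:
  "(\<Sum>x\<in>K. (\<Sum>\<psi>\<leftarrow>cs. \<psi> x) * f (inv x)) = (\<Sum>\<psi>\<leftarrow>cs. char_prod G K \<psi> f)"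
  by (induction cs) (simp_all add: char_prod_def sum.distrib distrib_right)

text \<open>For the converse, the pairing of \<chi> with the regular character is |G| times the
  degree of \<chi>, hence not 0. So some irreducible constituent pairs nontrivially with \<chi> and
  equals it by orthogonality.\<close>

lemma Irr_iff_spherical:
  assumes fin: "finite (carrier G)"
  shows "\<chi> \<in> Irr G \<longleftrightarrow> spherical G (carrier G) \<chi>"
proof
  assume s: "spherical G (carrier G) \<chi>"
  obtain cs where cs: "set cs \<subseteq> Irr G"
    "\<And>x. x \<in> carrier G \<Longrightarrow> (\<Sum>\<psi>\<leftarrow>cs. \<psi> x) = (if x = \<one> then of_nat (card (carrier G)) else 0)"
    using regular_character[OF fin] by blast
  have "(\<Sum>\<psi>\<leftarrow>cs. char_prod G (carrier G) \<psi> \<chi>) =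
      (\<Sum>x\<in>carrier G. (\<Sum>\<psi>\<leftarrow>cs. \<psi> x) * \<chi> (inv x))" by (rule sum_list_char_prod[symmetric])
  also have "\<dots> = (\<Sum>x\<in>carrier G. if x = \<one> then of_nat (card (carrier G)) * \<chi> \<one> else 0)"
    by (intro sum.cong refl) (simp add: cs(2))
  also have "\<dots> = of_nat (card (carrier G)) * \<chi> \<one>" using fin by simp
  finally have "(\<Sum>\<psi>\<leftarrow>cs. char_prod G (carrier G) \<psi> \<chi>) \<noteq> 0"
    using sphericalD(1)[OF s] subgroup_card_neq_0[OF subgroup_self fin] by simp
  then obtain \<psi> where \<psi>: "\<psi> \<in> set cs" "char_prod G (carrier G) \<psi> \<chi> \<noteq> 0"
    by (rule sum_list_neq_0E)
  then have "\<psi> = \<chi>"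
    using spherical_eqI[OF subgroup_self fin Irr_imp_spherical[OF fin] s] cs(1) by blast
  then show "\<chi> \<in> Irr G" using \<psi> cs by blast
qed (rule Irr_imp_spherical[OF fin])

lemma spherical_subgroup:
  assumes "subgroup K G"
  shows "spherical (G\<lparr>carrier := K\<rparr>) K \<chi> \<longleftrightarrow> spherical G K \<chi>"
  unfolding spherical_def using m_inv_consistent[OF assms] by (simp cong: sum.cong)

lemma Irr_subgroup_iff:
  assumes "subgroup K G" "finite K"
  shows "\<chi> \<in> Irr (G\<lparr>carrier := K\<rparr>) \<longleftrightarrow> spherical G K \<chi>"
  using group.Irr_iff_spherical[OF subgroup_imp_group[OF assms(1)]] assms spherical_subgroup
  by simp

lemma restrict_decompose:
  assumes L: "subgroup L G" and K: "subgroup K G" and "L \<subseteq> K"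
    and "\<theta> \<in> Irr (G\<lparr>carrier := K\<rparr>)"
  obtains cs where "set cs \<subseteq> Irr (G\<lparr>carrier := L\<rparr>)" "\<And>x. x \<in> L \<Longrightarrow> \<theta> x = (\<Sum>\<chi>\<leftarrow>cs. \<chi> x)"
proof -
  obtain n \<rho> where irr: "irreducible_rep (G\<lparr>carrier := K\<rparr>) n \<rho>"
    and \<theta>: "\<theta> = rep_character (G\<lparr>carrier := K\<rparr>) \<rho>" using assms(4) by (auto simp: Irr_def)
  then have "matrix_rep (G\<lparr>carrier := K\<rparr>) n \<rho>"
    using group.hom_GL_iff[OF subgroup_imp_group[OF K]] by (auto simp: irreducible_rep_def)
  then have "matrix_rep (G\<lparr>carrier := L\<rparr>) n \<rho>"
    using \<open>L \<subseteq> K\<close> by (auto simp: matrix_rep_def)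
  from matrix_rep_decompose[OF subgroup_imp_group[OF L] this]
  obtain cs where "set cs \<subseteq> Irr (G\<lparr>carrier := L\<rparr>)" "\<forall>x\<in>L. mat_trace (\<rho> x) = (\<Sum>\<chi>\<leftarrow>cs. \<chi> x)"
    by auto
  moreover from this have "\<theta> x = (\<Sum>\<chi>\<leftarrow>cs. \<chi> x)" if "x \<in> L" for x
    using that \<open>L \<subseteq> K\<close> by (auto simp: \<theta> rep_character_def)
  ultimately show thesis using that by blast
qed

end

subsection \<open>Embeddings of cyclotomic extensions\<close>

text \<open>Closure under inverses can include 0 because \<open>inverse 0 = 0\<close>.\<close>

definition csubfield :: "complex set \<Rightarrow> bool" where
  "csubfield F \<longleftrightarrow> 1 \<in> F \<and> (\<forall>x\<in>F. \<forall>y\<in>F. x - y \<in> F \<and> x * y \<in> F) \<and> (\<forall>x\<in>F. inverse x \<in> F)"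

lemma csubfieldD:
  assumes "csubfield F"
  shows "1 \<in> F" "0 \<in> F" "\<And>x y. x \<in> F \<Longrightarrow> y \<in> F \<Longrightarrow> x - y \<in> F"
    "\<And>x y. x \<in> F \<Longrightarrow> y \<in> F \<Longrightarrow> x + y \<in> F" "\<And>x y. x \<in> F \<Longrightarrow> y \<in> F \<Longrightarrow> x * y \<in> F"
    "\<And>x. x \<in> F \<Longrightarrow> - x \<in> F" "\<And>x. x \<in> F \<Longrightarrow> inverse x \<in> F"
proof -
  show 1: "1 \<in> F" and d: "\<And>x y. x \<in> F \<Longrightarrow> y \<in> F \<Longrightarrow> x - y \<in> F"
    and "\<And>x y. x \<in> F \<Longrightarrow> y \<in> F \<Longrightarrow> x * y \<in> F" and "\<And>x. x \<in> F \<Longrightarrow> inverse x \<in> F"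
    using assms by (auto simp: csubfield_def)
  show 0: "0 \<in> F" using d[OF 1 1] by simp
  show m: "- x \<in> F" if "x \<in> F" for x using d[OF 0 that] by simp
  show "x + y \<in> F" if "x \<in> F" "y \<in> F" for x y using d[OF that(1) m[OF that(2)]] by simp
qed

lemma csubfield_sum:
  assumes "csubfield F" "\<And>i. i \<in> A \<Longrightarrow> f i \<in> F"
  shows "(\<Sum>i\<in>A. f i) \<in> F"
  using assms(2) by (induction A rule: infinite_finite_induct) (auto intro: csubfieldD[OF assms(1)])

lemma csubfield_power: "csubfield F \<Longrightarrow> x \<in> F \<Longrightarrow> x ^ n \<in> F"
  by (induction n) (auto intro: csubfieldD)

lemma csubfield_of_nat: "csubfield F \<Longrightarrow> of_nat n \<in> F"
  by (induction n) (auto intro: csubfieldD)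

lemma class_ring_inv: "x \<noteq> 0 \<Longrightarrow> inv\<^bsub>complex_field\<^esub> x = inverse x"
proof -
  assume "x \<noteq> 0"
  then show ?thesis by (intro monoid.inv_char class_ring.is_monoid) auto
qed

lemma class_ring_uminus: "\<ominus>\<^bsub>complex_field\<^esub> x = - x"
  by (simp add: class_ring_simps)

lemma subfield_imp_csubfield:
  assumes "subfield F complex_field"
  shows "csubfield F"
proof -
  have sr: "subring F complex_field" using subfieldE(1)[OF assms] .
  have m: "- x \<in> F" if "x \<in> F" for x
    using subringE(5)[OF sr that] by (simp add: class_ring_uminus)
  have z: "0 \<in> F" using subringE(2)[OF sr] by simp
  have i: "inverse x \<in> F" if "x \<in> F" for x
  proof (cases "x = 0")
    case False
    then show ?thesis
      using ring.subfield_m_inv(1)[OF class_ring.ring_axioms assms, of x] that class_ring_inv[of x] by auto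
  qed (use z in simp)
  have "x - y \<in> F" if "x \<in> F" "y \<in> F" for x y
    using subringE(7)[OF sr that(1) m[OF that(2)]] by simp
  then show ?thesis
    using subringE(3)[OF sr] subringE(6)[OF sr] i by (auto simp: csubfield_def)
qed

lemma csubfield_generate_field: "csubfield (generate_field complex_field S)"
proof -
  have "subfield (generate_field complex_field S) complex_field"
    by (rule field.generate_field_is_subfield[OF class_field]) auto
  then show ?thesis by (rule subfield_imp_csubfield)
qed

lemma generate_field_subset:
  assumes E: "csubfield E" and "S \<subseteq> E"
  shows "generate_field complex_field S \<subseteq> E"
proof
  fix x assume "x \<in> generate_field complex_field S"
  then show "x \<in> E"
    by induction (use assms class_ring_inv in
        \<open>auto simp: class_ring_uminus intro: csubfieldD[OF E]\<close>)
qed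

text \<open>An embedding of E into the complex numbers: its image may leave E, and its values
  outside E are arbitrary.\<close>

definition field_emb :: "complex set \<Rightarrow> (complex \<Rightarrow> complex) \<Rightarrow> bool" where
  "field_emb E \<sigma> \<longleftrightarrow> \<sigma> 1 = 1 \<and> (\<forall>x\<in>E. \<forall>y\<in>E. \<sigma> (x + y) = \<sigma> x + \<sigma> y \<and> \<sigma> (x * y) = \<sigma> x * \<sigma> y)"

lemma field_embD:
  assumes "field_emb E \<sigma>" and E: "csubfield E"
  shows "\<sigma> 1 = 1" "\<sigma> 0 = 0" "\<And>x y. x \<in> E \<Longrightarrow> y \<in> E \<Longrightarrow> \<sigma> (x + y) = \<sigma> x + \<sigma> y"
    "\<And>x y. x \<in> E \<Longrightarrow> y \<in> E \<Longrightarrow> \<sigma> (x * y) = \<sigma> x * \<sigma> y"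
    "\<And>x. x \<in> E \<Longrightarrow> \<sigma> (- x) = - \<sigma> x" "\<And>x y. x \<in> E \<Longrightarrow> y \<in> E \<Longrightarrow> \<sigma> (x - y) = \<sigma> x - \<sigma> y"
    "\<And>x. x \<in> E \<Longrightarrow> \<sigma> (inverse x) = inverse (\<sigma> x)"
    "\<And>x. x \<in> E \<Longrightarrow> \<sigma> x = 0 \<longleftrightarrow> x = 0"
proof -
  note Ec = csubfieldD[OF E]
  show 1: "\<sigma> 1 = 1" and add: "\<And>x y. x \<in> E \<Longrightarrow> y \<in> E \<Longrightarrow> \<sigma> (x + y) = \<sigma> x + \<sigma> y"
    and mult: "\<And>x y. x \<in> E \<Longrightarrow> y \<in> E \<Longrightarrow> \<sigma> (x * y) = \<sigma> x * \<sigma> y"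
    using assms by (auto simp: field_emb_def)
  show 0: "\<sigma> 0 = 0" using add[OF Ec(2) Ec(2)] by simp
  show m: "\<sigma> (- x) = - \<sigma> x" if "x \<in> E" for x
    using add[OF that Ec(6)[OF that]] 0 by (simp add: eq_neg_iff_add_eq_0 add.commute)
  show "\<sigma> (x - y) = \<sigma> x - \<sigma> y" if "x \<in> E" "y \<in> E" for x y
    using add[OF that(1) Ec(6)[OF that(2)]] m[OF that(2)] by simp
  show z: "\<sigma> x = 0 \<longleftrightarrow> x = 0" if "x \<in> E" for x
    using mult[OF that Ec(7)[OF that]] 0 1 by (cases "x = 0") auto
  show "\<sigma> (inverse x) = inverse (\<sigma> x)" if "x \<in> E" for x
    using mult[OF that Ec(7)[OF that]] 0 1 by (cases "x = 0") (auto simp: inverse_unique)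
qed

lemma field_emb_sum:
  assumes "field_emb E \<sigma>" "csubfield E" "\<And>i. i \<in> A \<Longrightarrow> f i \<in> E"
  shows "\<sigma> (\<Sum>i\<in>A. f i) = (\<Sum>i\<in>A. \<sigma> (f i))"
  using assms(3)
  by (induction A rule: infinite_finite_induct)
     (simp_all add: field_embD[OF assms(1,2)] csubfield_sum[OF assms(2)])

lemma field_emb_power:
  "field_emb E \<sigma> \<Longrightarrow> csubfield E \<Longrightarrow> x \<in> E \<Longrightarrow> \<sigma> (x ^ n) = \<sigma> x ^ n"
  by (induction n) (auto simp: field_embD csubfield_power)

lemma field_emb_of_nat: "field_emb E \<sigma> \<Longrightarrow> csubfield E \<Longrightarrow> \<sigma> (of_nat n) = of_nat n"
  by (induction n) (auto simp: field_embD csubfield_of_nat csubfieldD)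

lemma field_emb_inj:
  assumes "field_emb E \<sigma>" "csubfield E" "x \<in> E" "y \<in> E" "\<sigma> x = \<sigma> y"
  shows "x = y"
proof -
  have "\<sigma> (x - y) = 0" using field_embD(6)[OF assms(1,2)] assms by simp
  then show ?thesis using field_embD(8)[OF assms(1,2), of "x - y"] csubfieldD[OF assms(2)] assms by simp
qed

text \<open>This reduces the equality of two embeddings to a check on generators of the
  field.\<close>

lemma field_emb_eq_csubfield:
  assumes "field_emb E \<sigma>" "field_emb E \<tau>" "csubfield E"
  shows "csubfield {x \<in> E. \<sigma> x = \<tau> x}"
  using field_embD[OF assms(1,3)] field_embD[OF assms(2,3)] csubfieldD[OF assms(3)]
  by (auto simp: csubfield_def)

lemma field_emb_subset: "field_emb E \<sigma> \<Longrightarrow> M \<subseteq> E \<Longrightarrow> field_emb M \<sigma>"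
  by (auto simp: field_emb_def)

section \<open>Polynomials over a subfield and simple algebraic extensions\<close>

definition poly_over :: "complex set \<Rightarrow> complex poly set" where
  "poly_over F = {p. \<forall>i. Polynomial.coeff p i \<in> F}"

lemma poly_over_intros:
  assumes F: "csubfield F"
  shows "0 \<in> poly_over F" "\<And>p q. p \<in> poly_over F \<Longrightarrow> q \<in> poly_over F \<Longrightarrow> p + q \<in> poly_over F"
    "\<And>p q. p \<in> poly_over F \<Longrightarrow> q \<in> poly_over F \<Longrightarrow> p - q \<in> poly_over F"
    "\<And>p q. p \<in> poly_over F \<Longrightarrow> q \<in> poly_over F \<Longrightarrow> p * q \<in> poly_over F"
    "\<And>c n. c \<in> F \<Longrightarrow> Polynomial.monom c n \<in> poly_over F" "\<And>c. c \<in> F \<Longrightarrow> [:c:] \<in> poly_over F"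
proof -
  note D = csubfieldD[OF F]
  show "0 \<in> poly_over F" using D by (simp add: poly_over_def)
  show "p + q \<in> poly_over F" "p - q \<in> poly_over F" "p * q \<in> poly_over F"
    if "p \<in> poly_over F" "q \<in> poly_over F" for p q
    using that D by (simp_all add: poly_over_def coeff_mult csubfield_sum[OF F])
  show "Polynomial.monom c n \<in> poly_over F" if "c \<in> F" for c n
    using that D by (simp add: poly_over_def)
  show "[:c:] \<in> poly_over F" if "c \<in> F" for c
    using that D by (simp add: poly_over_def coeff_pCons split: nat.splits)
qed

text \<open>Long division subtracts multiples of q whose coefficients lie in F, so quotient and
  remainder stay over F.\<close>

lemma poly_over_division:
  assumes F: "csubfield F" and q: "q \<in> poly_over F" "q \<noteq> 0" and "p \<in> poly_over F"
  shows "\<exists>a r. a \<in> poly_over F \<and> r \<in> poly_over F \<and> p = a * q + r \<and> (r = 0 \<or> degree r < degree q)"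
  using assms(4)
\<comment> \<open>Measuring the zero polynomial by 0 and degree d by d + 1 makes the passage from a
  nonzero constant to zero a descent as well.\<close>
proof (induction "if p = 0 then 0 else Suc (degree p)" arbitrary: p rule: less_induct)
  case less
  note P = poly_over_intros[OF F]
  show ?case
  proof (cases "p = 0 \<or> degree p < degree q")
    case True
    then show ?thesis using less.prems P(1) by (intro exI[of _ 0] exI[of _ p]) auto
  next
    case False
    define m where "m = Polynomial.monom (lead_coeff p * inverse (lead_coeff q)) (degree p - degree q)"
    have m: "m \<in> poly_over F"
      unfolding m_def using less.prems q csubfieldD[OF F] by (intro P) (auto simp: poly_over_def)
    define p' where "p' = p - m * q"
    have p': "p' \<in> poly_over F" using less.prems q m P by (simp add: p'_def)
    have "degree m \<le> degree p - degree q" unfolding m_def by (rule degree_monom_le)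
    then have deg: "degree (m * q) \<le> degree p"
      using False degree_mult_le[of m q] by linarith
    have "Polynomial.coeff (m * q) (degree p) = lead_coeff p"
      using False q by (simp add: m_def coeff_monom_mult)
    then have c: "Polynomial.coeff p' (degree p) = 0" by (simp add: p'_def)
    have "degree p' \<le> degree p" unfolding p'_def using deg by (intro degree_diff_le) auto
    then have "p' = 0 \<or> degree p' < degree p"
      using c by (metis le_neq_implies_less leading_coeff_0_iff)
    then have "(if p' = 0 then 0 else Suc (degree p')) < (if p = 0 then 0 else Suc (degree p))"
      using False by auto
    from less.hyps[OF this p'] obtain a r where
      "a \<in> poly_over F" "r \<in> poly_over F" "p' = a * q + r" "r = 0 \<or> degree r < degree q"
      by blast
    then show ?thesis using m P
      by (intro exI[of _ "a + m"] exI[of _ r]) (auto simp: p'_def algebra_simps)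
  qed
qed

text \<open>This is the ring F[\<zeta>]; it is a field as soon as \<zeta> is algebraic over
  F.\<close>

definition adjoin :: "complex set \<Rightarrow> complex \<Rightarrow> complex set" where
  "adjoin F \<zeta> = (\<lambda>p. poly p \<zeta>) ` poly_over F"

lemma adjoin_base: "csubfield F \<Longrightarrow> F \<subseteq> adjoin F \<zeta>"
  using poly_over_intros(6) by (force simp: adjoin_def image_iff)

lemma adjoin_gen: "csubfield F \<Longrightarrow> \<zeta> \<in> adjoin F \<zeta>"
  unfolding adjoin_def
  by (rule image_eqI[of _ _ "Polynomial.monom 1 1"]) (auto simp: poly_monom intro: poly_over_intros csubfieldD)

lemma adjoin_least:
  assumes "csubfield E" "F \<subseteq> E" "\<zeta> \<in> E"
  shows "adjoin F \<zeta> \<subseteq> E"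
  using assms unfolding adjoin_def poly_over_def
  by (auto simp: poly_altdef intro!: csubfield_sum csubfieldD(5) csubfield_power)

definition min_poly :: "complex set \<Rightarrow> complex \<Rightarrow> complex poly \<Rightarrow> bool" where
  "min_poly F \<zeta> p \<longleftrightarrow> p \<in> poly_over F \<and> p \<noteq> 0 \<and> poly p \<zeta> = 0 \<and>
     (\<forall>q\<in>poly_over F. poly q \<zeta> = 0 \<longrightarrow> q \<noteq> 0 \<longrightarrow> degree p \<le> degree q)"

lemma min_poly_exists:
  assumes "q \<in> poly_over F" "q \<noteq> 0" "poly q \<zeta> = 0"
  obtains p where "min_poly F \<zeta> p"
  using assms arg_min_nat_lemma[of "\<lambda>p. p \<in> poly_over F \<and> p \<noteq> 0 \<and> poly p \<zeta> = 0" q degree]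
  unfolding min_poly_def by blast

lemma min_poly_dvd:
  assumes F: "csubfield F" and m: "min_poly F \<zeta> p" and q: "q \<in> poly_over F" "poly q \<zeta> = 0"
  obtains a where "a \<in> poly_over F" "q = a * p"
proof -
  obtain a r where ar: "a \<in> poly_over F" "r \<in> poly_over F" "q = a * p + r" "r = 0 \<or> degree r < degree p"
    using poly_over_division[OF F _ _ q(1), of p] m by (auto simp: min_poly_def)
  have "poly r \<zeta> = 0" using q(2) ar(3) m by (simp add: min_poly_def)
  then have "r = 0" using m ar by (auto simp: min_poly_def)
  then show thesis using that ar by simp
qed

lemma min_poly_degree_pos: "min_poly F \<zeta> p \<Longrightarrow> degree p > 0"
  by (rule ccontr) (auto simp: min_poly_def elim!: degree_eq_zeroE)

lemma adjoin_reduced: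
  assumes F: "csubfield F" and m: "min_poly F \<zeta> p" and x: "x \<in> adjoin F \<zeta>"
  obtains r where "r \<in> poly_over F" "x = poly r \<zeta>" "degree r < degree p"
proof -
  obtain f where f: "f \<in> poly_over F" "x = poly f \<zeta>" using x by (auto simp: adjoin_def)
  obtain a r where ar: "a \<in> poly_over F" "r \<in> poly_over F" "f = a * p + r" "r = 0 \<or> degree r < degree p"
    using poly_over_division[OF F _ _ f(1), of p] m by (auto simp: min_poly_def)
  then have "x = poly r \<zeta>" using f m by (simp add: min_poly_def)
  then show thesis using that ar min_poly_degree_pos[OF m] by auto
qed

text \<open>Euclid's algorithm: with \<open>p = a * f + r\<close>, evaluation at \<zeta> reduces the
  inverse of f to that of the remainder r of smaller degree. The remainder is not 0, for otherwise p
  would be a product of polynomials of smaller degree, one of them vanishing at \<zeta>.\<close>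

lemma adjoin_inverse:
  assumes F: "csubfield F" and m: "min_poly F \<zeta> p"
    and "f \<in> poly_over F" "degree f < degree p"
  shows "inverse (poly f \<zeta>) \<in> adjoin F \<zeta>"
  using assms(3,4)
proof (induction "degree f" arbitrary: f rule: less_induct)
  case less
  note P = poly_over_intros[OF F]
  have p: "p \<in> poly_over F" "p \<noteq> 0" "poly p \<zeta> = 0" using m by (auto simp: min_poly_def)
  show ?case
  proof (cases "degree f = 0")
    case True
    then obtain c where c: "f = [:c:]" by (auto elim: degree_eq_zeroE)
    then have "c \<in> F" using less.prems(1) by (auto simp: poly_over_def dest: spec[of _ 0])
    then show ?thesis using c adjoin_base[OF F] csubfieldD(7)[OF F] by auto
  next
    case False
    then have "f \<noteq> 0" by auto
    then obtain a r where ar: "a \<in> poly_over F" "r \<in> poly_over F" "p = a * f + r" "r = 0 \<or> degree r < degree f"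
      using poly_over_division[OF F less.prems(1) _ p(1)] by blast
    have e: "poly a \<zeta> * poly f \<zeta> = - poly r \<zeta>" using p(3) ar(3) by (simp add: eq_neg_iff_add_eq_0)
    have "r \<noteq> 0"
    proof
      assume "r = 0"
      then have pa: "p = a * f" using ar by simp
      then have "a \<noteq> 0" "degree p = degree a + degree f"
        using p(2) \<open>f \<noteq> 0\<close> by (auto simp: degree_mult_eq)
      then have "poly a \<zeta> \<noteq> 0" "poly f \<zeta> \<noteq> 0"
        using m ar(1) less.prems \<open>f \<noteq> 0\<close> False by (auto simp: min_poly_def)
      then show False using e \<open>r = 0\<close> by simp
    qed
    then have dr: "degree r < degree f" using ar by simp
    have "poly r \<zeta> \<noteq> 0" using m ar(2) dr less.prems(2) \<open>r \<noteq> 0\<close> by (auto simp: min_poly_def)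
    then have "poly f \<zeta> \<noteq> 0" using e by auto
    then have "inverse (poly f \<zeta>) = - poly a \<zeta> * inverse (poly r \<zeta>)"
      using e \<open>poly r \<zeta> \<noteq> 0\<close> by (simp add: field_simps)
    moreover obtain s where s: "s \<in> poly_over F" "inverse (poly r \<zeta>) = poly s \<zeta>"
      using less.hyps[OF dr ar(2)] dr less.prems(2) by (auto simp: adjoin_def)
    ultimately have "inverse (poly f \<zeta>) = poly (0 - a * s) \<zeta>" by simp
    then show ?thesis using P ar(1) s(1) unfolding adjoin_def by blast
  qed
qed

lemma csubfield_adjoin:
  assumes F: "csubfield F" and m: "min_poly F \<zeta> p"
  shows "csubfield (adjoin F \<zeta>)"
  unfolding csubfield_def
proof (intro conjI ballI)
  note P = poly_over_intros[OF F]
  show "1 \<in> adjoin F \<zeta>" using adjoin_base[OF F] csubfieldD(1)[OF F] by auto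
  fix x assume x: "x \<in> adjoin F \<zeta>"
  show "inverse x \<in> adjoin F \<zeta>"
    using adjoin_reduced[OF F m x] adjoin_inverse[OF F m] by metis
  fix y assume y: "y \<in> adjoin F \<zeta>"
  obtain f g where "f \<in> poly_over F" "g \<in> poly_over F" "x = poly f \<zeta>" "y = poly g \<zeta>"
    using x y by (auto simp: adjoin_def)
  then show "x - y \<in> adjoin F \<zeta>" "x * y \<in> adjoin F \<zeta>"
    unfolding adjoin_def using P by (metis image_eqI poly_diff, metis image_eqI poly_mult)
qed

lemma map_poly_emb:
  assumes F: "csubfield F" and \<sigma>: "field_emb F \<sigma>" and "p \<in> poly_over F" "q \<in> poly_over F"
  shows "map_poly \<sigma> (p + q) = map_poly \<sigma> p + map_poly \<sigma> q"
    "map_poly \<sigma> (p * q) = map_poly \<sigma> p * map_poly \<sigma> q"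
proof -
  note D = field_embD[OF \<sigma> F]
  show "map_poly \<sigma> (p + q) = map_poly \<sigma> p + map_poly \<sigma> q"
    using assms by (intro poly_eqI) (simp add: coeff_map_poly D poly_over_def)
  show "map_poly \<sigma> (p * q) = map_poly \<sigma> p * map_poly \<sigma> q"
    using assms csubfieldD[OF F]
    by (intro poly_eqI) (simp add: coeff_map_poly coeff_mult D poly_over_def field_emb_sum[OF \<sigma> F])
qed

text \<open>The extension of \<sigma> that sends \<zeta> to \<xi>. It is well defined because two
  polynomials with the same value at \<zeta> differ by a multiple of p, and the image of p under
  \<sigma> vanishes at \<xi>.\<close>

lemma field_emb_extend_root:
  assumes F: "csubfield F" and \<sigma>: "field_emb F \<sigma>" and m: "min_poly F \<zeta> p"
    and \<xi>: "poly (map_poly \<sigma> p) \<xi> = 0"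
  obtains \<tau> where "field_emb (adjoin F \<zeta>) \<tau>"
    "\<And>f. f \<in> poly_over F \<Longrightarrow> \<tau> (poly f \<zeta>) = poly (map_poly \<sigma> f) \<xi>"
proof -
  note P = poly_over_intros[OF F] and D = field_embD[OF \<sigma> F] and M = map_poly_emb[OF F \<sigma>]
  have p: "p \<in> poly_over F" using m by (simp add: min_poly_def)
  have wd: "poly (map_poly \<sigma> f) \<xi> = poly (map_poly \<sigma> g) \<xi>"
    if fg: "f \<in> poly_over F" "g \<in> poly_over F" "poly f \<zeta> = poly g \<zeta>" for f g
  proof -
    obtain a where a: "a \<in> poly_over F" "f - g = a * p"
      using min_poly_dvd[OF F m P(3)[OF fg(1,2)]] fg(3) by auto
    have "map_poly \<sigma> f = map_poly \<sigma> (a * p + g)" using a(2) by (simp add: algebra_simps)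
    also have "\<dots> = map_poly \<sigma> a * map_poly \<sigma> p + map_poly \<sigma> g"
      using M a(1) p fg P by simp
    finally show ?thesis using \<xi> by simp
  qed
  define \<tau> where "\<tau> x = poly (map_poly \<sigma> (SOME f. f \<in> poly_over F \<and> poly f \<zeta> = x)) \<xi>" for x
  have \<tau>: "\<tau> (poly f \<zeta>) = poly (map_poly \<sigma> f) \<xi>" if "f \<in> poly_over F" for f
    unfolding \<tau>_def
    by (rule wd) (use that someI[of "\<lambda>g. g \<in> poly_over F \<and> poly g \<zeta> = poly f \<zeta>" f] in auto)
  have "field_emb (adjoin F \<zeta>) \<tau>"
    unfolding field_emb_def
  proof (intro conjI ballI)
    show "\<tau> 1 = 1"
      using \<tau>[OF P(6)[OF csubfieldD(1)[OF F]]] by (simp add: map_poly_pCons D)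
    fix x y assume "x \<in> adjoin F \<zeta>" "y \<in> adjoin F \<zeta>"
    then obtain f g where fg: "f \<in> poly_over F" "g \<in> poly_over F" "x = poly f \<zeta>" "y = poly g \<zeta>"
      by (auto simp: adjoin_def)
    show "\<tau> (x + y) = \<tau> x + \<tau> y"
      using \<tau>[OF P(2)[OF fg(1,2)]] \<tau> fg M by simp
    show "\<tau> (x * y) = \<tau> x * \<tau> y"
      using \<tau>[OF P(4)[OF fg(1,2)]] \<tau> fg M by simp
  qed
  then show thesis using that \<tau> by blast
qed

text \<open>An embedding kills no leading coefficient, so the image of p is not constant and has a
  complex root, to which \<zeta> can be sent.\<close>

lemma field_emb_extend:
  assumes F: "csubfield F" and \<sigma>: "field_emb F \<sigma>" and m: "min_poly F \<zeta> p"
  obtains \<tau> where "field_emb (adjoin F \<zeta>) \<tau>" "\<And>x. x \<in> F \<Longrightarrow> \<tau> x = \<sigma> x"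
proof -
  note D = field_embD[OF \<sigma> F]
  have p: "p \<in> poly_over F" using m by (simp add: min_poly_def)
  have "Polynomial.coeff (map_poly \<sigma> p) (degree p) \<noteq> 0"
    using D(8)[of "lead_coeff p"] p m by (simp add: coeff_map_poly D min_poly_def poly_over_def)
  then have "degree (map_poly \<sigma> p) > 0"
    using min_poly_degree_pos[OF m] le_degree by fastforce
  then obtain \<xi> where "poly (map_poly \<sigma> p) \<xi> = 0"
    using alg_closed_imp_poly_has_root[of "map_poly \<sigma> p"] by auto
  then obtain \<tau> where \<tau>: "field_emb (adjoin F \<zeta>) \<tau>"
    "\<And>f. f \<in> poly_over F \<Longrightarrow> \<tau> (poly f \<zeta>) = poly (map_poly \<sigma> f) \<xi>"
    using field_emb_extend_root[OF F \<sigma> m] by blast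
  have "\<tau> x = \<sigma> x" if "x \<in> F" for x
  proof -
    have "map_poly \<sigma> [:x:] = [:\<sigma> x:]"
      by (intro poly_eqI) (simp add: coeff_map_poly D coeff_pCons split: nat.splits)
    then show ?thesis using \<tau>(2)[OF poly_over_intros(6)[OF F that]] by simp
  qed
  then show thesis using that \<tau>(1) by blast
qed

text \<open>Write x = r(\<zeta>) with r of degree below that of p. Each root \<xi> of p gives an
  embedding over F that sends x to r(\<xi>), so r takes the value x at every root of p. As p divides
  X^N - 1 it has no repeated roots, so there are more of them than the degree of r, and r is the
  constant x.\<close>

lemma fixed_in_base:
  assumes F: "csubfield F" and m: "min_poly F \<zeta> p" and \<zeta>: "\<zeta> ^ N = 1" "N > 0"
    and x: "x \<in> adjoin F \<zeta>"
    and fixed: "\<And>\<tau>. field_emb (adjoin F \<zeta>) \<tau> \<Longrightarrow> \<forall>y\<in>F. \<tau> y = y \<Longrightarrow> \<tau> x = x"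
  shows "x \<in> F"
proof -
  note P = poly_over_intros[OF F]
  have p: "p \<in> poly_over F" "p \<noteq> 0" using m by (auto simp: min_poly_def)
  define u :: "complex poly" where "u = Polynomial.monom 1 N - [:1:]"
  have u: "u \<in> poly_over F" unfolding u_def by (intro P csubfieldD(1)[OF F])
  obtain a where a: "u = a * p"
    using min_poly_dvd[OF F m u] \<zeta> by (auto simp: u_def poly_monom)
  have sep: "rsquarefree p"
  proof (subst rsquarefree_roots, intro allI notI)
    fix z assume z: "poly p z = 0 \<and> poly (pderiv p) z = 0"
    then have "poly u z = 0" "poly (pderiv u) z = 0" by (auto simp: a pderiv_mult)
    then have "z ^ N = 1" "of_nat N * z ^ (N - 1) = 0"
      by (auto simp: u_def poly_monom pderiv_diff pderiv_monom pderiv_pCons)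
    then show False using \<open>N > 0\<close> by (auto simp: power_0_left)
  qed
  have "degree p = degree (Polynomial.smult (lead_coeff p) (\<Prod>z | poly p z = 0. [:-z, 1:]))"
    by (simp only: complex_poly_decompose_rsquarefree[OF sep])
  also have "\<dots> = degree (\<Prod>z | poly p z = 0. [:-z, 1:])" using p(2) by simp
  also have "\<dots> = card {z. poly p z = 0}" by (subst degree_prod_sum_eq) auto
  finally have card: "card {z. poly p z = 0} = degree p" by simp
  obtain r where r: "r \<in> poly_over F" "x = poly r \<zeta>" "degree r < degree p"
    using adjoin_reduced[OF F m x] by blast
  have id: "field_emb F (\<lambda>x. x)" by (simp add: field_emb_def)
  have "poly (r - [:x:]) \<xi> = 0" if rt: "poly p \<xi> = 0" for \<xi>
  proof -
    obtain \<tau> where \<tau>: "field_emb (adjoin F \<zeta>) \<tau>"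
      "\<And>f. f \<in> poly_over F \<Longrightarrow> \<tau> (poly f \<zeta>) = poly f \<xi>"
      using field_emb_extend_root[OF F id m, of \<xi>] rt by (auto simp: map_poly_id')
    have "\<tau> y = y" if "y \<in> F" for y using \<tau>(2)[OF P(6)[OF that]] by simp
    then have "\<tau> x = x" using fixed[OF \<tau>(1)] by blast
    then show ?thesis using \<tau>(2)[OF r(1)] r(2) by simp
  qed
  then have "{z. poly p z = 0} \<subseteq> {z. poly (r - [:x:]) z = 0}" by auto
  moreover have "degree (r - [:x:]) < degree p"
    using r(3) degree_diff_le[of r "degree r" "[:x:]"] by simp
  ultimately have "r - [:x:] = 0"
    using card poly_roots_finite[of "r - [:x:]"] card_poly_roots_bound[of "r - [:x:]"]
    by (metis card_mono leD order.trans)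
  then have "x = Polynomial.coeff r 0" by simp
  then show ?thesis using r(1) by (simp add: poly_over_def)
qed

section \<open>Galois theory of the extension by N-th roots of unity\<close>

locale cyclotomic_extension =
  fixes F :: "complex set" and N :: nat
  assumes F: "csubfield F" and N: "N > 0"
begin

definition \<zeta> :: complex where "\<zeta> = cis (2 * pi / of_nat N)"

definition E :: "complex set" where "E = adjoin F \<zeta>"

text \<open>Only the values on E matter, but members are functions on all complex numbers, so that
  they compose without restriction. That they map E onto E is proved below.\<close>

definition auts :: "complex set \<Rightarrow> (complex \<Rightarrow> complex) set" where
  "auts M = {\<sigma>. field_emb E \<sigma> \<and> (\<forall>x\<in>M. \<sigma> x = x)}"

lemma root_of_unity_power:
  assumes "z ^ N = 1"
  obtains k where "z = \<zeta> ^ k"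
proof -
  have "z \<in> (\<lambda>k. cis (2 * pi * real k / real N)) ` {..<N}"
    using bij_betw_roots_unity[OF N] assms by (auto simp: bij_betw_def)
  then obtain k where "z = cis (2 * pi * real k / real N)" by auto
  then have "z = \<zeta> ^ k" by (simp add: \<zeta>_def DeMoivre mult_ac)
  then show thesis by (rule that)
qed

lemma \<zeta>_root: "\<zeta> ^ N = 1"
  using N by (simp add: \<zeta>_def DeMoivre)

lemma min_poly_over:
  assumes M: "csubfield M"
  obtains p where "min_poly M \<zeta> p"
proof (rule min_poly_exists)
  show "Polynomial.monom 1 N - [:1:] \<in> poly_over M"
    by (intro poly_over_intros[OF M] csubfieldD(1)[OF M])
  have "Polynomial.coeff (Polynomial.monom 1 N - [:1:]) N = (1 :: complex)"
    using N by (simp add: coeff_pCons split: nat.splits)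
  then show "Polynomial.monom 1 N - [:1:] \<noteq> (0 :: complex poly)" by force
  show "poly (Polynomial.monom 1 N - [:1:]) \<zeta> = 0" by (simp add: poly_monom \<zeta>_root)
qed (rule that)

lemma E: "csubfield E" "F \<subseteq> E" "\<zeta> \<in> E"
  using min_poly_over[OF F] csubfield_adjoin[OF F] adjoin_base[OF F] adjoin_gen[OF F]
  by (auto simp: E_def)

lemma root_of_unity_in_E: "z ^ N = 1 \<Longrightarrow> z \<in> E"
  using root_of_unity_power csubfield_power[OF E(1,3)] by metis

text \<open>This transfers the extension and fixed point lemmas for simple extensions from F to
  every intermediate field M.\<close>

lemma E_eq:
  assumes M: "csubfield M" "F \<subseteq> M" "M \<subseteq> E"
  shows "adjoin M \<zeta> = E"
proof
  show "adjoin M \<zeta> \<subseteq> E" by (rule adjoin_least[OF E(1) M(3) E(3)])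
  obtain p where "min_poly M \<zeta> p" using min_poly_over[OF M(1)] .
  then have "csubfield (adjoin M \<zeta>)" by (rule csubfield_adjoin[OF M(1)])
  then show "E \<subseteq> adjoin M \<zeta>"
    unfolding E_def using adjoin_base[OF M(1)] adjoin_gen[OF M(1)] M(2)
    by (intro adjoin_least) auto
qed

lemma auts_extend:
  assumes M: "csubfield M" "F \<subseteq> M" "M \<subseteq> E" and "field_emb M \<alpha>" "\<And>x. x \<in> F \<Longrightarrow> \<alpha> x = x"
  obtains \<sigma> where "\<sigma> \<in> auts F" "\<And>x. x \<in> M \<Longrightarrow> \<sigma> x = \<alpha> x"
proof -
  obtain p where "min_poly M \<zeta> p" using min_poly_over[OF M(1)] .
  then obtain \<sigma> where "field_emb E \<sigma>" "\<And>x. x \<in> M \<Longrightarrow> \<sigma> x = \<alpha> x"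
    using field_emb_extend[OF M(1) assms(4)] E_eq[OF M] by metis
  moreover from this have "\<sigma> \<in> auts F" using assms(5) M(2) by (auto simp: auts_def)
  ultimately show thesis using that by blast
qed

text \<open>The half of the Galois correspondence that recovers a field from its automorphisms;
  membership in F(\<theta>) is later proved through it.\<close>

lemma auts_fixed:
  assumes M: "csubfield M" "F \<subseteq> M" "M \<subseteq> E" and "x \<in> E" "\<And>\<sigma>. \<sigma> \<in> auts M \<Longrightarrow> \<sigma> x = x"
  shows "x \<in> M"
proof -
  obtain p where "min_poly M \<zeta> p" using min_poly_over[OF M(1)] .
  then show ?thesis
    using fixed_in_base[OF M(1) _ \<zeta>_root N] assms(4,5) by (auto simp: E_eq[OF M] auts_def)
qed

lemma auts_\<zeta>:
  assumes "\<sigma> \<in> auts F"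
  obtains k where "\<sigma> \<zeta> = \<zeta> ^ k"
proof -
  have "\<sigma> \<zeta> ^ N = \<sigma> (\<zeta> ^ N)"
    using assms field_emb_power[OF _ E(1,3)] by (auto simp: auts_def)
  also have "\<dots> = 1" using assms by (auto simp: \<zeta>_root auts_def field_emb_def)
  finally show thesis using root_of_unity_power that by blast
qed

lemma auts_eqI:
  assumes \<sigma>: "field_emb E \<sigma>" "field_emb E \<tau>" and "\<And>x. x \<in> F \<Longrightarrow> \<sigma> x = \<tau> x" "\<sigma> \<zeta> = \<tau> \<zeta>"
    and "x \<in> E"
  shows "\<sigma> x = \<tau> x"
proof -
  have "adjoin F \<zeta> \<subseteq> {x \<in> E. \<sigma> x = \<tau> x}"
    using assms(3,4) E by (intro adjoin_least field_emb_eq_csubfield[OF \<sigma> E(1)]) auto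
  then show ?thesis using assms(5) by (auto simp: E_def)
qed

lemma auts_closed:
  assumes \<sigma>: "\<sigma> \<in> auts F" and "x \<in> E"
  shows "\<sigma> x \<in> E"
proof -
  have e: "field_emb E \<sigma>" and fx: "\<And>x. x \<in> F \<Longrightarrow> \<sigma> x = x" using \<sigma> by (auto simp: auts_def)
  note D = field_embD[OF e E(1)] and C = csubfieldD[OF E(1)]
  obtain k where "\<sigma> \<zeta> = \<zeta> ^ k" using auts_\<zeta>[OF \<sigma>] .
  then have "\<sigma> \<zeta> \<in> E" using csubfield_power[OF E(1,3)] by simp
  moreover have "csubfield {x \<in> E. \<sigma> x \<in> E}" using C D by (auto simp: csubfield_def)
  ultimately have "adjoin F \<zeta> \<subseteq> {x \<in> E. \<sigma> x \<in> E}"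
    using E fx by (intro adjoin_least) auto
  then show ?thesis using assms(2) by (auto simp: E_def)
qed

lemma auts_comp:
  assumes "\<sigma> \<in> auts F" "\<tau> \<in> auts F"
  shows "(\<lambda>x. \<sigma> (\<tau> x)) \<in> auts F"
  using assms auts_closed[OF assms(2)] by (auto simp: auts_def field_emb_def)

text \<open>Each automorphism raises \<zeta> to some power, and taking powers commutes; agreement at
  \<zeta> and on F is agreement on E.\<close>

lemma auts_commute:
  assumes \<sigma>: "\<sigma> \<in> auts F" and \<tau>: "\<tau> \<in> auts F" and "x \<in> E"
  shows "\<sigma> (\<tau> x) = \<tau> (\<sigma> x)"
proof (rule auts_eqI[OF _ _ _ _ assms(3)])
  have e: "field_emb E \<sigma>" "field_emb E \<tau>" using \<sigma> \<tau> by (auto simp: auts_def)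
  show "field_emb E (\<lambda>x. \<sigma> (\<tau> x))" "field_emb E (\<lambda>x. \<tau> (\<sigma> x))"
    using auts_comp[OF \<sigma> \<tau>] auts_comp[OF \<tau> \<sigma>] by (auto simp: auts_def)
  show "\<sigma> (\<tau> x) = \<tau> (\<sigma> x)" if "x \<in> F" for x using that \<sigma> \<tau> by (auto simp: auts_def)
  obtain k l where k: "\<sigma> \<zeta> = \<zeta> ^ k" and l: "\<tau> \<zeta> = \<zeta> ^ l" using auts_\<zeta> \<sigma> \<tau> by metis
  have "\<sigma> (\<tau> \<zeta>) = \<zeta> ^ (k * l)" using k l field_emb_power[OF e(1) E(1,3)] by (simp add: power_mult)
  moreover have "\<tau> (\<sigma> \<zeta>) = \<zeta> ^ (l * k)" using k l field_emb_power[OF e(2) E(1,3)] by (simp add: power_mult)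
  ultimately show "\<sigma> (\<tau> \<zeta>) = \<tau> (\<sigma> \<zeta>)" by (simp add: mult.commute)
qed

text \<open>Being injective on the finite set of N-th roots of unity, \<sigma> permutes it. So the
  image of E is a field that contains F and \<zeta>, hence E.\<close>

lemma auts_surj:
  assumes \<sigma>: "\<sigma> \<in> auts F" and "x \<in> E"
  obtains y where "y \<in> E" "\<sigma> y = x"
proof -
  have e: "field_emb E \<sigma>" and fx: "\<And>x. x \<in> F \<Longrightarrow> \<sigma> x = x" using \<sigma> by (auto simp: auts_def)
  note D = field_embD[OF e E(1)] and C = csubfieldD[OF E(1)]
  let ?U = "{z :: complex. z ^ N = 1}"
  have "\<sigma> ` ?U \<subseteq> ?U"
    using field_emb_power[OF e E(1) root_of_unity_in_E] D by (auto simp flip: field_emb_power[OF e E(1) root_of_unity_in_E])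
  moreover have "inj_on \<sigma> ?U"
    using field_emb_inj[OF e E(1)] root_of_unity_in_E by (intro inj_onI) auto
  moreover have "finite ?U" using N finite_roots_unity[of N] by simp
  ultimately have "\<sigma> ` ?U = ?U" by (simp add: endo_inj_surj)
  then have "\<zeta> \<in> \<sigma> ` E" using \<zeta>_root root_of_unity_in_E by blast
  moreover have "csubfield (\<sigma> ` E)"
    unfolding csubfield_def
  proof (intro conjI ballI)
    show "1 \<in> \<sigma> ` E" using D(1) C(1) by force
    fix a assume "a \<in> \<sigma> ` E"
    then obtain a' where a: "a' \<in> E" "a = \<sigma> a'" by auto
    then show "inverse a \<in> \<sigma> ` E" using D(7) C(7) by (metis image_eqI)
    fix b assume "b \<in> \<sigma> ` E"
    then obtain b' where b: "b' \<in> E" "b = \<sigma> b'" by auto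
    show "a - b \<in> \<sigma> ` E" using a b D(6) C(3) by (metis image_eqI)
    show "a * b \<in> \<sigma> ` E" using a b D(4) C(5) by (metis image_eqI)
  qed
  moreover have "F \<subseteq> \<sigma> ` E" using fx E(2) by force
  ultimately have "adjoin F \<zeta> \<subseteq> \<sigma> ` E" by (intro adjoin_least)
  then have "E \<subseteq> \<sigma> ` E" by (metis E_def)
  then show thesis using assms(2) that by blast
qed

text \<open>In an abelian extension every intermediate field is normal: an automorphism \<tau> over
  M commutes with \<sigma>, so it fixes \<open>\<sigma> x\<close> for x in M, and the elements fixed
  by all such \<tau> form M. Preimages are treated in the same way.\<close>

lemma auts_image:
  assumes M: "csubfield M" "F \<subseteq> M" "M \<subseteq> E" and \<sigma>: "\<sigma> \<in> auts F"
  shows "\<sigma> ` M = M"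
proof -
  have sub: "auts M \<subseteq> auts F" using M(2) by (auto simp: auts_def)
  have "\<sigma> x \<in> M" if x: "x \<in> M" for x
  proof (rule auts_fixed[OF M])
    show "\<sigma> x \<in> E" using auts_closed[OF \<sigma>] x M by auto
    fix \<tau> assume \<tau>: "\<tau> \<in> auts M"
    have "\<tau> (\<sigma> x) = \<sigma> (\<tau> x)" using auts_commute[of \<tau> \<sigma> x] \<tau> sub \<sigma> x M by auto
    then show "\<tau> (\<sigma> x) = \<sigma> x" using \<tau> x by (simp add: auts_def)
  qed
  moreover have "\<exists>y\<in>M. x = \<sigma> y" if x: "x \<in> M" for x
  proof -
    obtain y where y: "y \<in> E" "\<sigma> y = x" using auts_surj[OF \<sigma>] x M by blast
    have "y \<in> M"
    proof (rule auts_fixed[OF M y(1)])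
      fix \<tau> assume \<tau>: "\<tau> \<in> auts M"
      have "\<sigma> (\<tau> y) = \<tau> (\<sigma> y)" using auts_commute[OF \<sigma> _ y(1)] \<tau> sub by auto
      also have "\<dots> = \<sigma> y" using \<tau> y x by (simp add: auts_def)
      finally show "\<tau> y = y"
        using field_emb_inj[OF _ E(1)] \<sigma> \<tau> sub auts_closed[of \<tau> y] y(1) by (auto simp: auts_def)
    qed
    then show ?thesis using y by auto
  qed
  ultimately show ?thesis by auto
qed

end

subsection \<open>Restriction to normal subgroups\<close>

lemma restrict_char_eqI:
  assumes "\<And>x. x \<in> X \<Longrightarrow> f x = g x" "\<And>x. x \<notin> X \<Longrightarrow> g x = 0"
  shows "restrict_char X f = g"
  using assms by (auto simp: restrict_char_def)

context group
begin

text \<open>The field M is a parameter because the lemma serves both automorphisms of the cyclotomic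
  extension and those of a field of values.\<close>

lemma spherical_field_emb:
  assumes K: "subgroup K G" and s: "spherical G K \<chi>"
    and M: "csubfield M" "\<chi> ` K \<subseteq> M" and \<sigma>: "field_emb M \<sigma>"
  shows "spherical G K (\<lambda>x. \<sigma> (\<chi> x))"
proof -
  interpret K: subgroup K G by fact
  note D = field_embD[OF \<sigma> M(1)]
  have m: "\<chi> x \<in> M" if "x \<in> K" for x using M(2) that by blast
  have sum: "\<sigma> (\<Sum>x\<in>K. f x) = (\<Sum>x\<in>K. \<sigma> (f x))" if "\<And>x. x \<in> K \<Longrightarrow> f x \<in> M" for f
    by (rule field_emb_sum[OF \<sigma> M(1) that])
  obtain d :: nat where d: "d > 0" "\<chi> \<one> = of_nat d" using spherical_degree[OF s] .
  have n: "\<sigma> (of_nat j) = of_nat j" for j by (rule field_emb_of_nat[OF \<sigma> M(1)])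
  have "of_nat (card K) * (\<sigma> (\<chi> x) * \<sigma> (\<chi> y)) =
      \<sigma> (\<chi> \<one>) * (\<Sum>h\<in>K. \<sigma> (\<chi> (x \<otimes> (h \<otimes> y \<otimes> inv h))))" if xy: "x \<in> K" "y \<in> K" for x y
  proof -
    have "of_nat (card K) * (\<sigma> (\<chi> x) * \<sigma> (\<chi> y)) = \<sigma> (of_nat (card K) * (\<chi> x * \<chi> y))"
      using m xy csubfield_of_nat[OF M(1)] csubfieldD(5)[OF M(1)] by (simp add: D n)
    also have "\<dots> = \<sigma> (\<chi> \<one> * (\<Sum>h\<in>K. \<chi> (x \<otimes> (h \<otimes> y \<otimes> inv h))))"
      using sphericalD(3)[OF s xy] by simp
    also have "\<dots> = \<sigma> (\<chi> \<one>) * \<sigma> (\<Sum>h\<in>K. \<chi> (x \<otimes> (h \<otimes> y \<otimes> inv h)))"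
      using m xy by (intro D csubfield_sum[OF M(1)]) auto
    also have "\<sigma> (\<Sum>h\<in>K. \<chi> (x \<otimes> (h \<otimes> y \<otimes> inv h))) = (\<Sum>h\<in>K. \<sigma> (\<chi> (x \<otimes> (h \<otimes> y \<otimes> inv h))))"
      using m xy by (intro sum) auto
    finally show ?thesis .
  qed
  moreover have "(\<Sum>x\<in>K. \<sigma> (\<chi> x) * \<sigma> (\<chi> (inv x))) = of_nat (card K)"
  proof -
    have "(\<Sum>x\<in>K. \<sigma> (\<chi> x) * \<sigma> (\<chi> (inv x))) = (\<Sum>x\<in>K. \<sigma> (\<chi> x * \<chi> (inv x)))"
      using m by (simp add: D)
    also have "\<dots> = \<sigma> (char_prod G K \<chi> \<chi>)"
      unfolding char_prod_def using m csubfieldD(5)[OF M(1)] by (intro sum[symmetric]) auto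
    finally show ?thesis using sphericalD(4)[OF s] n by simp
  qed
  ultimately show ?thesis using d n D(2) sphericalD(2)[OF s] unfolding spherical_def by auto
qed

lemma spherical_trivial:
  assumes "subgroup K G"
  shows "spherical G K (\<lambda>x. if x \<in> K then 1 else 0)"
proof -
  interpret K: subgroup K G by fact
  show ?thesis unfolding spherical_def by (auto intro!: exI[of _ 1])
qed

lemma mult_inv_cancel:
  assumes "x \<in> carrier G" "y \<in> carrier G"
  shows "inv x \<otimes> (x \<otimes> y) = y" "x \<otimes> (inv x \<otimes> y) = y"
  using assms by (simp_all add: m_assoc[symmetric])

lemma bij_betw_conj_normal:
  assumes X: "X \<lhd> G" and g: "g \<in> carrier G"
  shows "bij_betw (\<lambda>x. g \<otimes> x \<otimes> inv g) X X"
proof (rule bij_betwI[where g = "\<lambda>y. inv g \<otimes> y \<otimes> g"])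
  interpret X: normal X G by fact
  show "(\<lambda>x. g \<otimes> x \<otimes> inv g) \<in> X \<rightarrow> X" using X.inv_op_closed2[OF g] by blast
  show "(\<lambda>y. inv g \<otimes> y \<otimes> g) \<in> X \<rightarrow> X" using X.inv_op_closed1[OF g] by blast
  show "inv g \<otimes> (g \<otimes> x \<otimes> inv g) \<otimes> g = x" "g \<otimes> (inv g \<otimes> x \<otimes> g) \<otimes> inv g = x"
    if "x \<in> X" for x using g that by (simp_all add: m_assoc mult_inv_cancel)
qed

lemma spherical_conj:
  assumes X: "X \<lhd> G" and s: "spherical G X \<chi>" and g: "g \<in> carrier G"
  shows "spherical G X (restrict_char X (\<lambda>x. \<chi> (g \<otimes> x \<otimes> inv g)))"
proof -
  interpret X: normal X G by fact
  have mem: "g \<otimes> x \<otimes> inv g \<in> X" if "x \<in> X" for x using X.inv_op_closed2[OF g that] .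
  have bij: "bij_betw (\<lambda>x. g \<otimes> x \<otimes> inv g) X X" by (rule bij_betw_conj_normal[OF X g])
  have cm: "g \<otimes> (x \<otimes> y) \<otimes> inv g = (g \<otimes> x \<otimes> inv g) \<otimes> (g \<otimes> y \<otimes> inv g)" if "x \<in> X" "y \<in> X" for x y
    using g that by (simp add: m_assoc mult_inv_cancel)
  have ci: "g \<otimes> inv x \<otimes> inv g = inv (g \<otimes> x \<otimes> inv g)" if "x \<in> X" for x
    using g that by (simp add: inv_mult_group m_assoc)
  let ?f = "restrict_char X (\<lambda>x. \<chi> (g \<otimes> x \<otimes> inv g))"
  have one: "?f \<one> = \<chi> \<one>" using g by (simp add: restrict_char_def)
  have "of_nat (card X) * (?f x * ?f y) = ?f \<one> * (\<Sum>h\<in>X. ?f (x \<otimes> (h \<otimes> y \<otimes> inv h)))"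
    if xy: "x \<in> X" "y \<in> X" for x y
  proof -
    have "of_nat (card X) * (?f x * ?f y) = \<chi> \<one> * (\<Sum>h\<in>X. \<chi> ((g \<otimes> x \<otimes> inv g) \<otimes> (h \<otimes> (g \<otimes> y \<otimes> inv g) \<otimes> inv h)))"
      using sphericalD(3)[OF s mem[OF xy(1)] mem[OF xy(2)]] xy by (simp add: restrict_char_def)
    also have "(\<Sum>h\<in>X. \<chi> ((g \<otimes> x \<otimes> inv g) \<otimes> (h \<otimes> (g \<otimes> y \<otimes> inv g) \<otimes> inv h))) =
        (\<Sum>h\<in>X. \<chi> ((g \<otimes> x \<otimes> inv g) \<otimes> ((g \<otimes> h \<otimes> inv g) \<otimes> (g \<otimes> y \<otimes> inv g) \<otimes> inv (g \<otimes> h \<otimes> inv g))))"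
      by (rule sum.reindex_bij_betw[OF bij, symmetric])
    also have "\<dots> = (\<Sum>h\<in>X. ?f (x \<otimes> (h \<otimes> y \<otimes> inv h)))"
      using xy by (intro sum.cong refl) (simp add: restrict_char_def cm ci)
    finally show ?thesis by (simp add: one)
  qed
  moreover have "(\<Sum>x\<in>X. ?f x * ?f (inv x)) = of_nat (card X)"
  proof -
    have "(\<Sum>x\<in>X. ?f x * ?f (inv x)) = (\<Sum>x\<in>X. \<chi> (g \<otimes> x \<otimes> inv g) * \<chi> (inv (g \<otimes> x \<otimes> inv g)))"
      by (intro sum.cong refl) (simp add: restrict_char_def ci)
    also have "\<dots> = (\<Sum>x\<in>X. \<chi> x * \<chi> (inv x))"
      by (rule sum.reindex_bij_betw[OF bij])
    finally show ?thesis using sphericalD(4)[OF s] by (simp add: char_prod_def)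
  qed
  moreover obtain d :: nat where "d > 0" "\<chi> \<one> = of_nat d" using spherical_degree[OF s] .
  ultimately show ?thesis using one unfolding spherical_def by (auto simp: restrict_char_def)
qed

text \<open>Conjugation is trivial here, so the product equation becomes
  \<open>\<chi> x * \<chi> y = \<chi> \<one> * \<chi> (x \<otimes> y)\<close>. The norm equation
  then gives a degree with square 1.\<close>

lemma spherical_linear:
  assumes K: "subgroup K G" and fin: "finite K"
    and comm: "\<And>x y. x \<in> K \<Longrightarrow> y \<in> K \<Longrightarrow> x \<otimes> y = y \<otimes> x" and s: "spherical G K \<chi>"
  shows "\<chi> \<one> = 1" "\<And>x y. x \<in> K \<Longrightarrow> y \<in> K \<Longrightarrow> \<chi> (x \<otimes> y) = \<chi> x * \<chi> y"
proof -
  interpret K: subgroup K G by fact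
  note c = subgroup_card_neq_0[OF K fin]
  have m: "\<chi> x * \<chi> y = \<chi> \<one> * \<chi> (x \<otimes> y)" if "x \<in> K" "y \<in> K" for x y
  proof -
    have "h \<otimes> y \<otimes> inv h = y" if "h \<in> K" for h
      using comm[of h y] that \<open>y \<in> K\<close> by (simp add: m_assoc)
    then show ?thesis using sphericalD(3)[OF s that] c by simp
  qed
  have "char_prod G K \<chi> \<chi> = (\<Sum>x\<in>K. \<chi> \<one> * \<chi> \<one>)"
    unfolding char_prod_def
  proof (intro sum.cong refl)
    fix x assume "x \<in> K"
    then show "\<chi> x * \<chi> (inv x) = \<chi> \<one> * \<chi> \<one>" using m[of x "inv x"] by simp
  qed
  then have "\<chi> \<one> * \<chi> \<one> = 1" using sphericalD(4)[OF s] c by simp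
  moreover obtain d :: nat where "\<chi> \<one> = of_nat d" using spherical_degree[OF s] .
  ultimately have "d * d = 1" by (metis of_nat_1 of_nat_eq_iff of_nat_mult)
  then show one: "\<chi> \<one> = 1" using \<open>\<chi> \<one> = of_nat d\<close> by simp
  show "\<chi> (x \<otimes> y) = \<chi> x * \<chi> y" if "x \<in> K" "y \<in> K" for x y using m[OF that] one by simp
qed

text \<open>On the cyclic subgroup generated by x all constituents are linear, so
  \<open>\<chi> x\<close> is a sum of |G|-th roots of unity.\<close>

lemma character_value_in_field:
  assumes fin: "finite (carrier G)" and K: "subgroup K G" and \<chi>: "\<chi> \<in> Irr (G\<lparr>carrier := K\<rparr>)"
    and x: "x \<in> K" and M: "csubfield M" "\<And>z. z ^ card (carrier G) = 1 \<Longrightarrow> z \<in> M"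
  shows "\<chi> x \<in> M"
proof -
  interpret K: subgroup K G by fact
  have xG: "x \<in> carrier G" using x by auto
  define C where "C = generate G {x}"
  have C: "subgroup C G" unfolding C_def using xG by (intro generate_is_subgroup) auto
  interpret C: subgroup C G by fact
  have CK: "C \<subseteq> K" unfolding C_def using x K by (intro generate_subgroup_incl) auto
  have xC: "x \<in> C" unfolding C_def by (intro generate.incl) auto
  have finC: "finite C" using fin C.subset finite_subset by blast
  have comm: "a \<otimes> b = b \<otimes> a" if "a \<in> C" "b \<in> C" for a b
    using that xG unfolding C_def generate_pow[OF xG]
    by (auto simp: int_pow_mult[symmetric] add.commute)
  obtain cs where cs: "set cs \<subseteq> Irr (G\<lparr>carrier := C\<rparr>)" "\<And>x. x \<in> C \<Longrightarrow> \<chi> x = (\<Sum>\<psi>\<leftarrow>cs. \<psi> x)"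
    using restrict_decompose[OF C K CK \<chi>] by blast
  have "\<psi> x \<in> M" if "\<psi> \<in> set cs" for \<psi>
  proof -
    have s: "spherical G C \<psi>" using that cs(1) Irr_subgroup_iff[OF C finC] by auto
    note lin = spherical_linear[OF C finC comm s]
    have pw: "x [^] n \<in> C" for n :: nat
      by (induction n) (auto intro: xC)
    have "\<psi> (x [^] n) = \<psi> x ^ n" for n :: nat
      by (induction n) (auto simp: lin pw xC)
    from this[of "card (carrier G)"] have "\<psi> x ^ card (carrier G) = 1"
      using pow_order_eq_1[OF xG] lin(1) by (simp add: Coset.order_def)
    then show ?thesis by (rule M(2))
  qed
  then have "(\<Sum>\<psi>\<leftarrow>cs. \<psi> x) \<in> M" by (induction cs) (auto intro: csubfieldD[OF M(1)])
  then show ?thesis using cs(2)[OF xC] by simp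
qed

section \<open>Constituents of restricted characters\<close>

lemma char_prod_spherical:
  assumes K: "subgroup K G" and fin: "finite K" and "spherical G K \<chi>" "spherical G K \<psi>"
  shows "char_prod G K \<chi> \<psi> = (if \<chi> = \<psi> then of_nat (card K) else 0)"
  using spherical_eqI[OF assms] sphericalD(4)[OF assms(3)] by auto

lemma sum_list_char_prod_count:
  assumes K: "subgroup K G" and fin: "finite K"
    and "\<forall>\<chi>\<in>set cs. spherical G K \<chi>" "spherical G K \<psi>"
  shows "(\<Sum>\<chi>\<leftarrow>cs. char_prod G K \<chi> \<psi>) = of_nat (card K) * of_nat (count_list cs \<psi>)"
  using assms(3)
  by (induction cs) (auto simp: char_prod_spherical[OF K fin _ assms(4)] algebra_simps)

lemma char_prod_restrict_nat:
  assumes L: "subgroup L G" "finite L" and K: "subgroup K G" "L \<subseteq> K"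
    and \<theta>: "\<theta> \<in> Irr (G\<lparr>carrier := K\<rparr>)" and \<phi>: "spherical G L \<phi>"
  obtains m :: nat where "char_prod G L \<theta> \<phi> = of_nat (card L) * of_nat m"
proof -
  obtain cs where cs: "set cs \<subseteq> Irr (G\<lparr>carrier := L\<rparr>)" "\<And>x. x \<in> L \<Longrightarrow> \<theta> x = (\<Sum>\<chi>\<leftarrow>cs. \<chi> x)"
    using restrict_decompose[OF L(1) K \<theta>] by blast
  have "char_prod G L \<theta> \<phi> = (\<Sum>x\<in>L. (\<Sum>\<chi>\<leftarrow>cs. \<chi> x) * \<phi> (inv x))"
    unfolding char_prod_def using cs(2) by (intro sum.cong) auto
  also have "\<dots> = (\<Sum>\<chi>\<leftarrow>cs. char_prod G L \<chi> \<phi>)" by (rule sum_list_char_prod)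
  also have "\<dots> = of_nat (card L) * of_nat (count_list cs \<phi>)"
    using cs(1) Irr_subgroup_iff[OF L] by (intro sum_list_char_prod_count[OF L _ \<phi>]) auto
  finally show thesis by (rule that)
qed

text \<open>Expanded over the list of constituents, the norm is |L| times the sum, over all list
  entries, of the multiplicity of the entry. Each multiplicity is at least 1, so a total of 1 leaves
  a single entry.\<close>

lemma restrict_irreducible:
  assumes L: "subgroup L G" "finite L" and K: "subgroup K G" "L \<subseteq> K"
    and \<theta>: "\<theta> \<in> Irr (G\<lparr>carrier := K\<rparr>)" and norm: "char_prod G L \<theta> \<theta> = of_nat (card L)"
  shows "restrict_char L \<theta> \<in> Irr (G\<lparr>carrier := L\<rparr>)"
proof -
  interpret L: subgroup L G by fact
  obtain cs where cs: "set cs \<subseteq> Irr (G\<lparr>carrier := L\<rparr>)" "\<And>x. x \<in> L \<Longrightarrow> \<theta> x = (\<Sum>\<chi>\<leftarrow>cs. \<chi> x)"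
    using restrict_decompose[OF L(1) K \<theta>] by blast
  have csL: "\<forall>\<chi>\<in>set cs. spherical G L \<chi>" using cs(1) Irr_subgroup_iff[OF L] by auto
  have mult: "char_prod G L \<theta> \<phi> = (\<Sum>\<chi>\<leftarrow>cs. char_prod G L \<chi> \<phi>)" for \<phi>
  proof -
    have "char_prod G L \<theta> \<phi> = (\<Sum>x\<in>L. (\<Sum>\<chi>\<leftarrow>cs. \<chi> x) * \<phi> (inv x))"
      unfolding char_prod_def using cs(2) by (intro sum.cong) auto
    then show ?thesis by (simp add: sum_list_char_prod)
  qed
  have "of_nat (card L) = (\<Sum>\<chi>\<leftarrow>cs. char_prod G L \<chi> \<theta>)" using norm mult by simp
  also have "\<dots> = (\<Sum>\<chi>\<leftarrow>cs. of_nat (card L) * of_nat (count_list cs \<chi>))"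
  proof -
    have "char_prod G L \<chi> \<theta> = of_nat (card L) * of_nat (count_list cs \<chi>)" if "\<chi> \<in> set cs" for \<chi>
      using that mult[of \<chi>] sum_list_char_prod_count[OF L csL, of \<chi>] csL
      by (simp add: char_prod_commute[OF L(1), of \<chi> \<theta>])
    then show ?thesis by (intro arg_cong[where f = sum_list] map_cong) auto
  qed
  also have "\<dots> = of_nat (card L) * of_nat (\<Sum>\<chi>\<leftarrow>cs. count_list cs \<chi>)"
  proof -
    have "(\<Sum>\<chi>\<leftarrow>xs. of_nat (card L) * of_nat (f \<chi>)) = of_nat (card L) * (of_nat (\<Sum>\<chi>\<leftarrow>xs. f \<chi>) :: complex)"
      for xs :: "('a \<Rightarrow> complex) list" and f by (induction xs) (auto simp: algebra_simps)
    then show ?thesis .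
  qed
  finally have one: "(\<Sum>\<chi>\<leftarrow>cs. count_list cs \<chi>) = 1"
    using subgroup_card_neq_0[OF L] by (metis mult.right_neutral mult_cancel_left of_nat_1 of_nat_eq_iff)
  have "length cs = (\<Sum>\<chi>\<leftarrow>cs. 1)" by (simp add: sum_list_triv)
  also have "\<dots> \<le> (\<Sum>\<chi>\<leftarrow>cs. count_list cs \<chi>)"
    by (intro sum_list_mono) (metis One_nat_def Suc_leI count_list_0_iff neq0_conv)
  finally have "length cs \<le> 1" using one by simp
  moreover have "cs \<noteq> []" using one by auto
  ultimately obtain \<chi> where "cs = [\<chi>]" by (cases cs) auto
  then have "restrict_char L \<theta> = \<chi>"
    using cs(2) csL sphericalD(2)[of G L \<chi>] by (intro restrict_char_eqI) auto
  then show ?thesis using cs(1) \<open>cs = [\<chi>]\<close> by simp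
qed

text \<open>
  Multiplying the functional equation of \<open>\<theta>\<close> by \<open>\<phi>(x\<^sup>-\<^sup>1)\<close> and summing over \<open>L\<close> yields the
  formula of Clifford's theorem without decomposing the restriction of \<open>\<theta>\<close>.
\<close>
lemma Clifford:
  assumes K: "subgroup K G" "finite K" and L: "L \<lhd> G" "L \<subseteq> K"
    and s: "spherical G K \<theta>" and t: "spherical G L \<phi>" and ne: "char_prod G L \<theta> \<phi> \<noteq> 0" and y: "y \<in> L"
  shows "of_nat (card K) * \<phi> \<one> * \<theta> y = \<theta> \<one> * (\<Sum>k\<in>K. \<phi> (k \<otimes> y \<otimes> inv k))"
proof -
  interpret K: subgroup K G by fact
  interpret L: normal L G by fact
  have Ls: "subgroup L G" by (rule L.subgroup_axioms)
  have finL: "finite L" using K(2) L(2) finite_subset by blast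
  have cf: "class_fun G L \<theta>"
    using spherical_class_fun[OF K s] L(2) unfolding class_fun_def by blast
  let ?c = "char_prod G L \<theta> \<phi>"
  have "?c * (of_nat (card K) * \<phi> \<one> * \<theta> y) =
      \<phi> \<one> * (\<Sum>x\<in>L. \<phi> (inv x) * (of_nat (card K) * (\<theta> x * \<theta> y)))"
    unfolding char_prod_def by (simp add: sum_distrib_left sum_distrib_right mult_ac)
  also have "(\<Sum>x\<in>L. \<phi> (inv x) * (of_nat (card K) * (\<theta> x * \<theta> y))) =
      (\<Sum>x\<in>L. \<theta> \<one> * (\<Sum>k\<in>K. \<phi> (inv x) * \<theta> (x \<otimes> (k \<otimes> y \<otimes> inv k))))"
  proof (intro sum.cong refl)
    fix x assume "x \<in> L"
    then have "of_nat (card K) * (\<theta> x * \<theta> y) = \<theta> \<one> * (\<Sum>k\<in>K. \<theta> (x \<otimes> (k \<otimes> y \<otimes> inv k)))"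
      using sphericalD(3)[OF s] y L(2) by blast
    then show "\<phi> (inv x) * (of_nat (card K) * (\<theta> x * \<theta> y)) =
        \<theta> \<one> * (\<Sum>k\<in>K. \<phi> (inv x) * \<theta> (x \<otimes> (k \<otimes> y \<otimes> inv k)))"
      by (simp add: sum_distrib_left mult_ac)
  qed
  also have "\<phi> \<one> * \<dots> = \<theta> \<one> * (\<Sum>x\<in>L. \<Sum>k\<in>K. \<phi> \<one> * (\<phi> (inv x) * \<theta> (x \<otimes> (k \<otimes> y \<otimes> inv k))))"
    by (simp add: sum_distrib_left mult_ac)
  also have "(\<Sum>x\<in>L. \<Sum>k\<in>K. \<phi> \<one> * (\<phi> (inv x) * \<theta> (x \<otimes> (k \<otimes> y \<otimes> inv k)))) =
      (\<Sum>k\<in>K. \<Sum>x\<in>L. \<phi> \<one> * (\<phi> (inv x) * \<theta> (x \<otimes> (k \<otimes> y \<otimes> inv k))))" by (rule sum.swap)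
  also have "\<dots> = (\<Sum>k\<in>K. \<phi> (k \<otimes> y \<otimes> inv k) * ?c)"
  proof (intro sum.cong refl)
    fix k assume "k \<in> K"
    then have "k \<otimes> y \<otimes> inv k \<in> L" using L.inv_op_closed2 y by auto
    from spherical_convolution'[OF Ls finL t cf this]
    show "(\<Sum>x\<in>L. \<phi> \<one> * (\<phi> (inv x) * \<theta> (x \<otimes> (k \<otimes> y \<otimes> inv k)))) = \<phi> (k \<otimes> y \<otimes> inv k) * ?c"
      by (simp add: sum_distrib_left char_prod_commute[OF Ls])
  qed
  finally have "?c * (of_nat (card K) * \<phi> \<one> * \<theta> y) = ?c * (\<theta> \<one> * (\<Sum>k\<in>K. \<phi> (k \<otimes> y \<otimes> inv k)))"
    by (simp add: sum_distrib_left mult_ac)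
  then show ?thesis using ne by (simp only: mult_cancel_left) simp
qed

text \<open>Clifford's formula paired with \<psi> gives a nonzero sum of pairings of \<psi> with
  conjugates of \<phi>. One of these pairings is not 0, and orthogonality identifies that conjugate
  with \<psi>.\<close>

lemma Clifford_conjugate:
  assumes K: "subgroup K G" "finite K" and L: "L \<lhd> G" "L \<subseteq> K"
    and s: "spherical G K \<theta>" and t: "spherical G L \<phi>" and ne: "char_prod G L \<theta> \<phi> \<noteq> 0"
    and u: "spherical G L \<psi>" and ne': "char_prod G L \<theta> \<psi> \<noteq> 0"
  obtains k where "k \<in> K" "\<And>y. y \<in> L \<Longrightarrow> \<psi> y = \<phi> (k \<otimes> y \<otimes> inv k)"
proof -
  interpret K: subgroup K G by fact
  interpret L: normal L G by fact
  have Ls: "subgroup L G" by (rule L.subgroup_axioms)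
  have finL: "finite L" using K(2) L(2) finite_subset by blast
  let ?f = "\<lambda>k. restrict_char L (\<lambda>y. \<phi> (k \<otimes> y \<otimes> inv k))"
  have "of_nat (card K) * \<phi> \<one> * char_prod G L \<theta> \<psi> =
      (\<Sum>y\<in>L. (of_nat (card K) * \<phi> \<one> * \<theta> y) * \<psi> (inv y))"
    unfolding char_prod_def by (simp add: sum_distrib_left mult_ac)
  also have "\<dots> = (\<Sum>y\<in>L. \<Sum>k\<in>K. \<theta> \<one> * (\<phi> (k \<otimes> y \<otimes> inv k) * \<psi> (inv y)))"
  proof (intro sum.cong refl)
    fix y assume "y \<in> L"
    then have "of_nat (card K) * \<phi> \<one> * \<theta> y * \<psi> (inv y) =
        \<theta> \<one> * (\<Sum>k\<in>K. \<phi> (k \<otimes> y \<otimes> inv k)) * \<psi> (inv y)"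
      by (simp only: Clifford[OF assms(1-7)])
    also have "\<dots> = (\<Sum>k\<in>K. \<theta> \<one> * (\<phi> (k \<otimes> y \<otimes> inv k) * \<psi> (inv y)))"
      by (simp add: sum_distrib_left sum_distrib_right mult.assoc)
    finally show "of_nat (card K) * \<phi> \<one> * \<theta> y * \<psi> (inv y) =
        (\<Sum>k\<in>K. \<theta> \<one> * (\<phi> (k \<otimes> y \<otimes> inv k) * \<psi> (inv y)))" .
  qed
  also have "\<dots> = (\<Sum>k\<in>K. \<theta> \<one> * char_prod G L (?f k) \<psi>)"
    by (subst sum.swap) (simp add: char_prod_def sum_distrib_left restrict_char_def cong: sum.cong)
  finally have "(\<Sum>k\<in>K. \<theta> \<one> * char_prod G L (?f k) \<psi>) \<noteq> 0"
    using ne' sphericalD(1)[OF t] subgroup_card_neq_0[OF K] by (metis mult_eq_0_iff)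
  then obtain k where k: "k \<in> K" "char_prod G L (?f k) \<psi> \<noteq> 0"
    by (metis (mono_tags, lifting) mult_zero_right sum.neutral)
  then have "?f k = \<psi>"
    by (intro spherical_eqI[OF Ls finL spherical_conj[OF L(1) t] u]) auto
  then have "\<psi> y = \<phi> (k \<otimes> y \<otimes> inv k)" if "y \<in> L" for y
    using that by (auto simp: restrict_char_def dest: fun_cong[of _ _ y])
  then show thesis using that k(1) by blast
qed

text \<open>The characters \<lambda> of the abelian quotient are linear, and the regular one is
  |G:L| times the indicator of L. Hence |G:L| times the norm on L is the sum of the pairings of
  \<lambda>\<theta> with \<theta>, where only those \<lambda> with \<lambda>\<theta> = \<theta>
  survive. Such a \<lambda> is 1 wherever \<theta> is not 0, so it is trivial by
  \<open>gen\<close>.\<close>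

lemma norm_restrict_normal:
  assumes fin: "finite (carrier G)" and L: "L \<lhd> G" and comm: "comm_group (G Mod L)"
    and s: "spherical G (carrier G) \<theta>"
    and gen: "\<And>\<mu>. (\<And>x y. x \<in> carrier G \<Longrightarrow> y \<in> carrier G \<Longrightarrow> \<mu> (x \<otimes> y) = \<mu> x * \<mu> y) \<Longrightarrow>
      (\<And>x. x \<in> L \<Longrightarrow> \<mu> x = (1::complex)) \<Longrightarrow> (\<And>x. x \<in> carrier G \<Longrightarrow> \<theta> x \<noteq> 0 \<Longrightarrow> \<mu> x = 1) \<Longrightarrow>
      (\<And>x. x \<in> carrier G \<Longrightarrow> \<mu> x = 1)"
  shows "char_prod G L \<theta> \<theta> = of_nat (card L)"
proof -
  interpret L: normal L G by fact
  interpret Q: comm_group "G Mod L" by fact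
  note [simp del] = mult_FactGroup one_FactGroup
  let ?Q = "G Mod L"
  have cQ: "carrier ?Q = (\<lambda>x. L #> x) ` carrier G" by (auto simp: FactGroup_def RCOSETS_def)
  have finQ: "finite (carrier ?Q)" using fin by (simp add: cQ)
  have Ls: "subgroup L G" by (rule L.subgroup_axioms)
  have oneQ: "\<one>\<^bsub>?Q\<^esub> = L" by (simp add: FactGroup_def)
  have cosetL: "L #> x = L \<longleftrightarrow> x \<in> L" if "x \<in> carrier G" for x
    using that Ls by (metis coset_join1 coset_join2 L.subset)
  have piQ: "L #> x \<in> carrier ?Q" if "x \<in> carrier G" for x using that by (simp add: cQ)
  have pim: "L #> (x \<otimes> y) = (L #> x) \<otimes>\<^bsub>?Q\<^esub> (L #> y)" if "x \<in> carrier G" "y \<in> carrier G" for x y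
    using that by (simp add: FactGroup_def L.rcos_sum)
  obtain cs where cs: "set cs \<subseteq> Irr ?Q"
    "\<And>q. q \<in> carrier ?Q \<Longrightarrow> (\<Sum>\<eta>\<leftarrow>cs. \<eta> q) = (if q = \<one>\<^bsub>?Q\<^esub> then of_nat (card (carrier ?Q)) else 0)"
    using Q.regular_character[OF finQ] by blast
  have csS: "\<forall>\<eta>\<in>set cs. spherical ?Q (carrier ?Q) \<eta>" using cs(1) Q.Irr_iff_spherical[OF finQ] by blast
  define u where "u = (\<lambda>q. if q \<in> carrier ?Q then 1 else (0 :: complex))"
  have u: "spherical ?Q (carrier ?Q) u"
    unfolding u_def by (rule Q.spherical_trivial[OF Q.subgroup_self])
  have cnt: "count_list cs u = 1"
  proof -
    have "of_nat (card (carrier ?Q)) * of_nat (count_list cs u) = (\<Sum>\<eta>\<leftarrow>cs. char_prod ?Q (carrier ?Q) \<eta> u)"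
      by (rule Q.sum_list_char_prod_count[OF Q.subgroup_self finQ csS u, symmetric])
    also have "\<dots> = (\<Sum>q\<in>carrier ?Q. (\<Sum>\<eta>\<leftarrow>cs. \<eta> q) * u (inv\<^bsub>?Q\<^esub> q))"
      by (rule Q.sum_list_char_prod[symmetric])
    also have "\<dots> = (\<Sum>q\<in>carrier ?Q. if q = \<one>\<^bsub>?Q\<^esub> then of_nat (card (carrier ?Q)) else 0)"
      by (intro sum.cong refl) (simp add: cs(2) u_def)
    also have "\<dots> = of_nat (card (carrier ?Q))"
      by (simp only: sum.delta[OF finQ] Q.one_closed if_True)
    finally show ?thesis
      using Q.subgroup_card_neq_0[OF Q.subgroup_self finQ]
      by (metis mult.right_neutral mult_cancel_left of_nat_1 of_nat_eq_iff)
  qed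
  let ?t = "\<lambda>\<eta> x. \<eta> (L #> x) * \<theta> x"
  have prod: "char_prod G (carrier G) (?t \<eta>) \<theta> = (if \<eta> = u then of_nat (card (carrier G)) else 0)"
    if \<eta>: "\<eta> \<in> set cs" for \<eta>
  proof -
    have sl: "spherical ?Q (carrier ?Q) \<eta>" using csS \<eta> by blast
    note lin = Q.spherical_linear[OF Q.subgroup_self finQ Q.m_comm sl]
    have m: "\<eta> (L #> (x \<otimes> y)) = \<eta> (L #> x) * \<eta> (L #> y)" if "x \<in> carrier G" "y \<in> carrier G" for x y
      using that by (simp add: pim lin(2) piQ)
    have L1: "\<eta> (L #> x) = 1" if "x \<in> L" for x using that lin(1) oneQ cosetL[of x] by auto
    have i: "\<eta> (L #> x) * \<eta> (L #> inv x) = 1" if "x \<in> carrier G" for x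
      using m[of x "inv x"] that L1[of \<one>] by simp
    \<comment> \<open>In an abelian quotient the factor from \<eta> does not depend on h, so it
      comes out of the sum in the product equation.\<close>
    have c: "\<eta> (L #> (x \<otimes> (h \<otimes> y \<otimes> inv h))) = \<eta> (L #> x) * \<eta> (L #> y)"
      if "x \<in> carrier G" "y \<in> carrier G" "h \<in> carrier G" for x y h
      using that i[of h] by (simp add: m)
    have "spherical G (carrier G) (?t \<eta>)"
      unfolding spherical_def
    proof (intro conjI ballI allI impI)
      show "\<exists>d>0. ?t \<eta> \<one> = of_nat d" using spherical_degree[OF s] L1[of \<one>] by auto
      show "?t \<eta> x = 0" if "x \<notin> carrier G" for x using sphericalD(2)[OF s that] by simp
      show "of_nat (card (carrier G)) * (?t \<eta> x * ?t \<eta> y) =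
          ?t \<eta> \<one> * (\<Sum>h\<in>carrier G. ?t \<eta> (x \<otimes> (h \<otimes> y \<otimes> inv h)))"
        if xy: "x \<in> carrier G" "y \<in> carrier G" for x y
      proof -
        have "(\<Sum>h\<in>carrier G. ?t \<eta> (x \<otimes> (h \<otimes> y \<otimes> inv h))) =
            \<eta> (L #> x) * \<eta> (L #> y) * (\<Sum>h\<in>carrier G. \<theta> (x \<otimes> (h \<otimes> y \<otimes> inv h)))"
          using xy by (simp add: c sum_distrib_left)
        then show ?thesis using sphericalD(3)[OF s xy] L1[of \<one>] by (simp add: mult_ac)
      qed
      have "(\<Sum>x\<in>carrier G. ?t \<eta> x * ?t \<eta> (inv x)) =
          (\<Sum>x\<in>carrier G. (\<eta> (L #> x) * \<eta> (L #> inv x)) * (\<theta> x * \<theta> (inv x)))"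
        by (simp add: mult_ac)
      also have "\<dots> = char_prod G (carrier G) \<theta> \<theta>" by (simp add: i char_prod_def)
      finally show "(\<Sum>x\<in>carrier G. ?t \<eta> x * ?t \<eta> (inv x)) = of_nat (card (carrier G))"
        using sphericalD(4)[OF s] by simp
    qed
    then have cp: "char_prod G (carrier G) (?t \<eta>) \<theta> = (if ?t \<eta> = \<theta> then of_nat (card (carrier G)) else 0)"
      using char_prod_spherical[OF subgroup_self fin _ s] by simp
    have "?t \<eta> = \<theta> \<longleftrightarrow> \<eta> = u"
    proof
      assume eq: "?t \<eta> = \<theta>"
      have all: "\<eta> (L #> x) = 1" if "x \<in> carrier G" for x
      proof (rule gen[of "\<lambda>x. \<eta> (L #> x)", OF m L1 _ that])
        fix x assume "\<theta> x \<noteq> 0"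
        then show "\<eta> (L #> x) = 1" using fun_cong[OF eq, of x] by simp
      qed
      show "\<eta> = u"
      proof
        fix q show "\<eta> q = u q"
          using all sphericalD(2)[OF sl] by (cases "q \<in> carrier ?Q") (auto simp: cQ u_def)
      qed
    next
      assume "\<eta> = u"
      then show "?t \<eta> = \<theta>" using sphericalD(2)[OF s] piQ by (fastforce simp: u_def)
    qed
    then show ?thesis using cp by simp
  qed
  have "(\<Sum>\<eta>\<leftarrow>cs. char_prod G (carrier G) (?t \<eta>) \<theta>) =
      (\<Sum>x\<in>carrier G. (\<Sum>\<eta>\<leftarrow>cs. \<eta> (L #> x)) * (\<theta> x * \<theta> (inv x)))"
    by (induction cs) (simp_all add: char_prod_def sum.distrib distrib_left distrib_right mult_ac)
  also have "\<dots> = (\<Sum>x\<in>carrier G. if x \<in> L then of_nat (card (carrier ?Q)) * (\<theta> x * \<theta> (inv x)) else 0)"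
    using cosetL by (intro sum.cong refl) (simp add: cs(2) piQ oneQ)
  also have "\<dots> = of_nat (card (carrier ?Q)) * char_prod G L \<theta> \<theta>"
    using fin L.subset
    by (simp add: sum.If_cases Int_absorb1 char_prod_def sum_distrib_left Collect_mem_eq)
  finally have "of_nat (card (carrier ?Q)) * char_prod G L \<theta> \<theta> =
      (\<Sum>\<eta>\<leftarrow>cs. if \<eta> = u then of_nat (card (carrier G)) else 0)"
    using prod by (simp cong: map_cong)
  also have "\<dots> = of_nat (card (carrier G)) * of_nat (count_list cs u)"
    by (induction cs) (auto simp: algebra_simps)
  also have "of_nat (card (carrier G)) = of_nat (card (carrier ?Q)) * (of_nat (card L) :: complex)"
    using lagrange[OF Ls] by (simp add: FactGroup_def Coset.order_def flip: of_nat_mult)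
  finally show ?thesis
    using Q.subgroup_card_neq_0[OF Q.subgroup_self finQ] by (simp add: cnt)
qed

end

subsection \<open>Semi-invariance and Galois groups\<close>

lemma galois_group_iff:
  "\<alpha> \<in> carrier (galois_group M F) \<longleftrightarrow>
     \<alpha> \<in> extensional M \<and> bij_betw \<alpha> M M \<and> field_emb M \<alpha> \<and> (\<forall>x\<in>F. \<alpha> x = x)"
  unfolding galois_group_def field_emb_def Ring.ring_hom_def Bij_def
  by (auto simp: BijGroup_def bij_betw_imp_funcset Pi_iff dest: bij_betwE)

lemma galois_group_mult:
  assumes "\<alpha> \<in> carrier (galois_group M F)" "\<beta> \<in> carrier (galois_group M F)"
  shows "\<alpha> \<otimes>\<^bsub>galois_group M F\<^esub> \<beta> = compose M \<alpha> \<beta>"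
  using assms by (simp add: galois_group_def BijGroup_def)

lemma galois_group_compose:
  assumes "\<alpha> \<in> carrier (galois_group M F)" "\<beta> \<in> carrier (galois_group M F)" "F \<subseteq> M" "1 \<in> M"
    and "csubfield M"
  shows "compose M \<alpha> \<beta> \<in> carrier (galois_group M F)"
proof -
  have b: "\<And>x. x \<in> M \<Longrightarrow> \<beta> x \<in> M" using assms(2) by (auto simp: galois_group_iff dest: bij_betwE)
  then have "field_emb M (compose M \<alpha> \<beta>)"
    using assms csubfieldD[OF assms(5)] by (simp add: galois_group_iff field_emb_def compose_def)
  moreover have "bij_betw (compose M \<alpha> \<beta>) M M"
    using assms by (intro bij_betw_compose[of _ _ M]) (auto simp: galois_group_iff)
  ultimately show ?thesis using assms by (auto simp: galois_group_iff compose_def)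
qed

lemma value_field:
  "csubfield (value_field F X \<phi>)" "F \<subseteq> value_field F X \<phi>"
  "\<And>x. x \<in> X \<Longrightarrow> \<phi> x \<in> value_field F X \<phi>"
  by (auto simp: value_field_def csubfield_generate_field intro: generate_field.incl)

lemma value_field_least:
  assumes "csubfield M" "F \<subseteq> M" "\<And>x. x \<in> X \<Longrightarrow> \<phi> x \<in> M"
  shows "value_field F X \<phi> \<subseteq> M"
  unfolding value_field_def using assms by (intro generate_field_subset) auto

lemma value_field_emb_eqI:
  assumes "field_emb (value_field F X \<phi>) \<alpha>" "field_emb (value_field F X \<phi>) \<beta>"
    and "\<And>x. x \<in> F \<Longrightarrow> \<alpha> x = \<beta> x" "\<And>x. x \<in> X \<Longrightarrow> \<alpha> (\<phi> x) = \<beta> (\<phi> x)"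
    and "z \<in> value_field F X \<phi>"
  shows "\<alpha> z = \<beta> z"
proof -
  note V = value_field[where F = F and X = X and \<phi> = \<phi>]
  have "value_field F X \<phi> \<subseteq> {z \<in> value_field F X \<phi>. \<alpha> z = \<beta> z}"
    using assms(3,4) V by (intro value_field_least field_emb_eq_csubfield assms) auto
  then show ?thesis using assms(5) by auto
qed

context cyclotomic_extension
begin

text \<open>Restrictions are bijective on M because automorphisms of E map every intermediate field
  onto itself.\<close>

lemma restrict_auts_galois:
  assumes M: "csubfield M" "F \<subseteq> M" "M \<subseteq> E" and \<sigma>: "\<sigma> \<in> auts F"
    and B: "B \<subseteq> M" "\<And>x. x \<in> B \<Longrightarrow> \<sigma> x = x"
  shows "restrict \<sigma> M \<in> carrier (galois_group M B)"
proof -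
  have e: "field_emb E \<sigma>" using \<sigma> by (simp add: auts_def)
  have "inj_on \<sigma> M" using field_emb_inj[OF e E(1)] M(3) by (intro inj_onI) auto
  then have "bij_betw \<sigma> M M" using auts_image[OF M \<sigma>] by (simp add: bij_betw_def)
  then have "bij_betw (restrict \<sigma> M) M M" by (simp add: bij_betw_restrict_eq)
  moreover have "field_emb M (restrict \<sigma> M)"
    using field_emb_subset[OF e M(3)] csubfieldD[OF M(1)] by (simp add: field_emb_def)
  ultimately show ?thesis using B by (auto simp: galois_group_iff)
qed

lemma id_auts: "M \<subseteq> E \<Longrightarrow> (\<lambda>x. x) \<in> auts M"
  by (simp add: auts_def field_emb_def)

lemma galois_group_extend:
  assumes M: "csubfield M" "F \<subseteq> M" "M \<subseteq> E" and \<alpha>: "\<alpha> \<in> carrier (galois_group M F)"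
  obtains \<sigma> where "\<sigma> \<in> auts F" "\<And>x. x \<in> M \<Longrightarrow> \<sigma> x = \<alpha> x"
  using auts_extend[OF M, of \<alpha>] \<alpha> by (auto simp: galois_group_iff)

text \<open>An automorphism of M extends to E and is then determined by the image of \<zeta>, an
  N-th root of unity. Finiteness matters since \<open>central_idem_over\<close> sums over this
  group, and a sum over an infinite set is 0 by convention.\<close>

lemma finite_galois_group:
  assumes M: "csubfield M" "F \<subseteq> M" "M \<subseteq> E"
  shows "finite (carrier (galois_group M F))"
proof -
  let ?\<Gamma> = "carrier (galois_group M F)"
  have "\<forall>\<alpha>\<in>?\<Gamma>. \<exists>\<sigma>. \<sigma> \<in> auts F \<and> (\<forall>x\<in>M. \<sigma> x = \<alpha> x)"
    using galois_group_extend[OF M] by metis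
  then obtain s where s: "\<And>\<alpha>. \<alpha> \<in> ?\<Gamma> \<Longrightarrow> s \<alpha> \<in> auts F"
    "\<And>\<alpha> x. \<alpha> \<in> ?\<Gamma> \<Longrightarrow> x \<in> M \<Longrightarrow> s \<alpha> x = \<alpha> x" by metis
  have "inj_on (\<lambda>\<alpha>. s \<alpha> \<zeta>) ?\<Gamma>"
  proof (rule inj_onI)
    fix \<alpha> \<beta> assume \<alpha>: "\<alpha> \<in> ?\<Gamma>" and \<beta>: "\<beta> \<in> ?\<Gamma>" and eq: "s \<alpha> \<zeta> = s \<beta> \<zeta>"
    have sa: "field_emb E (s \<alpha>)" "\<forall>x\<in>F. s \<alpha> x = x" and sb: "field_emb E (s \<beta>)" "\<forall>x\<in>F. s \<beta> x = x"
      using s(1)[OF \<alpha>] s(1)[OF \<beta>] by (auto simp: auts_def)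
    have "\<alpha> x = \<beta> x" if x: "x \<in> M" for x
    proof -
      have "s \<alpha> x = s \<beta> x"
        by (rule auts_eqI[OF sa(1) sb(1) _ eq]) (use sa(2) sb(2) x M(3) in auto)
      then show ?thesis using s(2)[OF \<alpha> x] s(2)[OF \<beta> x] by simp
    qed
    then show "\<alpha> = \<beta>" using \<alpha> \<beta> by (intro extensionalityI[of _ M]) (auto simp: galois_group_iff)
  qed
  moreover have "(\<lambda>\<alpha>. s \<alpha> \<zeta>) ` ?\<Gamma> \<subseteq> {z. z ^ N = 1}"
  proof safe
    fix \<alpha> assume "\<alpha> \<in> ?\<Gamma>"
    then obtain k where "s \<alpha> \<zeta> = \<zeta> ^ k" using auts_\<zeta> s(1) by metis
    then show "s \<alpha> \<zeta> ^ N = 1" using \<zeta>_root by (metis mult.commute power_mult power_one)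
  qed
  moreover have "finite {z :: complex. z ^ N = 1}" using N finite_roots_unity[of N] by simp
  ultimately show ?thesis by (meson finite_imageD finite_subset)
qed

end

section \<open>Semi-invariance as Galois conjugacy of characters\<close>

locale finite_group_field = group G + cyclotomic_extension F "card (carrier G)"
  for G :: "('a, 'b) monoid_scheme" (structure) and F :: "complex set" +
  assumes finite_G: "finite (carrier G)"
begin

lemma finite_sub: "subgroup X G \<Longrightarrow> finite X"
  using finite_G subgroup.subset finite_subset by blast

lemma value_field_subset_E:
  assumes X: "subgroup X G" and s: "spherical G X \<phi>"
  shows "value_field F X \<phi> \<subseteq> E"
proof (rule value_field_least[OF E(1,2)])
  fix x assume "x \<in> X"
  moreover have "\<phi> \<in> Irr (G\<lparr>carrier := X\<rparr>)" using Irr_subgroup_iff[OF X finite_sub[OF X]] s by simp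
  ultimately show "\<phi> x \<in> E"
    using character_value_in_field[OF finite_G X] E(1) root_of_unity_in_E by blast
qed

text \<open>The degree divided by |X| is rational, hence fixed by every \<alpha>.\<close>

lemma central_idem_over_eq:
  assumes X: "subgroup X G" and s: "spherical G X \<phi>" and x: "x \<in> X"
  shows "central_idem_over G X F \<phi> x = \<phi> \<one> / of_nat (card X) *
    (\<Sum>\<alpha>\<in>carrier (galois_group (value_field F X \<phi>) F). \<alpha> (\<phi> (inv x)))"
  unfolding central_idem_over_def sum_distrib_left
proof (intro sum.cong refl)
  interpret X: subgroup X G by fact
  let ?M = "value_field F X \<phi>"
  fix \<alpha> assume "\<alpha> \<in> carrier (galois_group ?M F)"
  then have e: "field_emb ?M \<alpha>" by (simp add: galois_group_iff)
  note D = field_embD[OF e value_field(1)] and C = csubfieldD[OF value_field(1)[where F = F and X = X and \<phi> = \<phi>]]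
  obtain d :: nat where d: "\<phi> \<one> = of_nat d" using spherical_degree[OF s] .
  have n: "of_nat j \<in> ?M" "\<alpha> (of_nat j) = of_nat j" for j
    using csubfield_of_nat[OF value_field(1)] field_emb_of_nat[OF e value_field(1)] by auto
  have i: "inverse (of_nat j) \<in> ?M" "\<alpha> (inverse (of_nat j)) = inverse (of_nat j)" for j
    using n C(7) D(7) by auto
  have "\<phi> (inv x) \<in> ?M" using x by (intro value_field(3)) auto
  then have "\<alpha> (of_nat d * inverse (of_nat (card X)) * \<phi> (inv x)) =
      of_nat d * inverse (of_nat (card X)) * \<alpha> (\<phi> (inv x))"
    using n i C(5) by (simp add: D(4))
  then show "\<alpha> (central_idem G X \<phi> x) = \<phi> \<one> / of_nat (card X) * \<alpha> (\<phi> (inv x))"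
    using x by (simp add: central_idem_def d divide_inverse)
qed

lemma central_idem_over_outside: "x \<notin> X \<Longrightarrow> central_idem_over G X F \<phi> x = 0"
  unfolding central_idem_over_def central_idem_def
  by (auto simp: galois_group_iff field_embD(2)[OF _ value_field(1)] intro!: sum.neutral)

text \<open>Invariance of the idempotent says that \<phi> and its conjugate \<psi> have the same sum
  of Galois conjugates. Paired with \<psi>, the sum for \<psi> has terms 0 or |X|, and the identity
  contributes |X|. So some Galois conjugate of \<phi> also pairs nontrivially with \<psi> and equals
  it.\<close>

lemma semi_invariantD:
  assumes X: "X \<lhd> G" and s: "spherical G X \<phi>" and inv: "semi_invariant G X F \<phi>"
    and g: "g \<in> carrier G"
  obtains \<sigma> where "\<sigma> \<in> auts F" "\<And>x. x \<in> X \<Longrightarrow> \<phi> (g \<otimes> x \<otimes> inv g) = \<sigma> (\<phi> x)"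
proof -
  interpret X: normal X G by fact
  have Xs: "subgroup X G" by (rule X.subgroup_axioms)
  note finX = finite_sub[OF Xs] and V = value_field[where F = F and X = X and \<phi> = \<phi>]
  let ?M = "value_field F X \<phi>"
  let ?\<Gamma> = "carrier (galois_group ?M F)"
  have M: "csubfield ?M" "F \<subseteq> ?M" "?M \<subseteq> E" using V value_field_subset_E[OF Xs s] by auto
  have fin\<Gamma>: "finite ?\<Gamma>" by (rule finite_galois_group[OF M])
  have emb: "field_emb ?M \<alpha>" if "\<alpha> \<in> ?\<Gamma>" for \<alpha> using that by (simp add: galois_group_iff)
  have mem: "g \<otimes> x \<otimes> inv g \<in> X" if "x \<in> X" for x using X.inv_op_closed2[OF g that] .
  have S: "(\<Sum>\<alpha>\<in>?\<Gamma>. \<alpha> (\<phi> (g \<otimes> x \<otimes> inv g))) = (\<Sum>\<alpha>\<in>?\<Gamma>. \<alpha> (\<phi> x))" if x: "x \<in> X" for x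
  proof -
    have y: "inv x \<in> X" "g \<otimes> inv x \<otimes> inv g \<in> X" using x mem by auto
    \<comment> \<open>Coefficients of the idempotent involve inverses, and
      \<open>conj_group_algebra\<close> substitutes a conjugate by the inverse of its argument;
      \<open>inv g\<close> and \<open>inv x\<close> undo both.\<close>
    have "conj_group_algebra G (inv g) (central_idem_over G X F \<phi>) (inv x) = central_idem_over G X F \<phi> (inv x)"
      using inv g unfolding semi_invariant_def by simp
    then have "central_idem_over G X F \<phi> (g \<otimes> inv x \<otimes> inv g) = central_idem_over G X F \<phi> (inv x)"
      using g x by (simp add: conj_group_algebra_def)
    moreover have "\<phi> \<one> / of_nat (card X) \<noteq> 0"
      using sphericalD(1)[OF s] subgroup_card_neq_0[OF Xs finX] by simp
    moreover have "inv (g \<otimes> inv x \<otimes> inv g) = g \<otimes> x \<otimes> inv g"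
      using g x by (simp add: inv_mult_group m_assoc)
    ultimately show ?thesis
      using x by (simp add: central_idem_over_eq[OF Xs s y(1)] central_idem_over_eq[OF Xs s y(2)])
  qed
  define \<psi> where "\<psi> = restrict_char X (\<lambda>x. \<phi> (g \<otimes> x \<otimes> inv g))"
  have \<psi>: "spherical G X \<psi>" unfolding \<psi>_def by (rule spherical_conj[OF X s g])
  have \<phi>M: "\<phi> ` X \<subseteq> ?M" and \<psi>M: "\<psi> ` X \<subseteq> ?M" using V mem by (auto simp: \<psi>_def restrict_char_def)
  have s\<phi>: "spherical G X (\<lambda>x. \<alpha> (\<phi> x))" and s\<psi>: "spherical G X (\<lambda>x. \<alpha> (\<psi> x))" if "\<alpha> \<in> ?\<Gamma>" for \<alpha>
    using spherical_field_emb[OF Xs s M(1) \<phi>M emb[OF that]]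
      spherical_field_emb[OF Xs \<psi> M(1) \<psi>M emb[OF that]] by auto
  have "(\<Sum>\<alpha>\<in>?\<Gamma>. char_prod G X (\<lambda>x. \<alpha> (\<phi> x)) \<psi>) = (\<Sum>x\<in>X. (\<Sum>\<alpha>\<in>?\<Gamma>. \<alpha> (\<phi> x)) * \<psi> (inv x))"
    unfolding char_prod_def by (subst sum.swap) (simp add: sum_distrib_right)
  also have "\<dots> = (\<Sum>x\<in>X. (\<Sum>\<alpha>\<in>?\<Gamma>. \<alpha> (\<psi> x)) * \<psi> (inv x))"
    by (intro sum.cong refl) (simp add: S[symmetric] \<psi>_def restrict_char_def)
  also have "\<dots> = (\<Sum>\<alpha>\<in>?\<Gamma>. char_prod G X (\<lambda>x. \<alpha> (\<psi> x)) \<psi>)"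
    unfolding char_prod_def by (simp add: sum_distrib_right) (rule sum.swap)
  also have "\<dots> = (\<Sum>\<alpha>\<in>?\<Gamma>. if (\<lambda>x. \<alpha> (\<psi> x)) = \<psi> then of_nat (card X) else 0)"
    by (intro sum.cong refl char_prod_spherical[OF Xs finX s\<psi> \<psi>])
  also have "\<dots> = of_nat (card {\<alpha> \<in> ?\<Gamma>. (\<lambda>x. \<alpha> (\<psi> x)) = \<psi>}) * of_nat (card X)"
    using fin\<Gamma> by (simp add: sum.If_cases Int_def)
  also have "\<dots> \<noteq> 0"
  proof -
    have "restrict (\<lambda>x. x) ?M \<in> {\<alpha> \<in> ?\<Gamma>. (\<lambda>x. \<alpha> (\<psi> x)) = \<psi>}"
    proof (intro CollectI conjI ext)
      show "restrict (\<lambda>x. x) ?M \<in> ?\<Gamma>"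
        using restrict_auts_galois[OF M id_auts[OF E(2)]] V(2) by simp
      show "restrict (\<lambda>x. x) ?M (\<psi> x) = \<psi> x" for x
        using \<psi>M sphericalD(2)[OF \<psi>, of x] csubfieldD(2)[OF M(1)] by (cases "x \<in> X") auto
    qed
    then have "card {\<alpha> \<in> ?\<Gamma>. (\<lambda>x. \<alpha> (\<psi> x)) = \<psi>} \<noteq> 0" using fin\<Gamma> by (auto simp: card_eq_0_iff)
    then show ?thesis using subgroup_card_neq_0[OF Xs finX] by simp
  qed
  finally obtain \<alpha> where \<alpha>: "\<alpha> \<in> ?\<Gamma>" "char_prod G X (\<lambda>x. \<alpha> (\<phi> x)) \<psi> \<noteq> 0"
    by (metis (mono_tags, lifting) sum.neutral)
  then have eq: "(\<lambda>x. \<alpha> (\<phi> x)) = \<psi>" using spherical_eqI[OF Xs finX s\<phi> \<psi>] by blast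
  obtain \<sigma> where \<sigma>: "\<sigma> \<in> auts F" "\<And>x. x \<in> ?M \<Longrightarrow> \<sigma> x = \<alpha> x"
    using galois_group_extend[OF M \<alpha>(1)] by blast
  have "\<phi> (g \<otimes> x \<otimes> inv g) = \<sigma> (\<phi> x)" if "x \<in> X" for x
    using fun_cong[OF eq, of x] that \<sigma>(2) V(3) by (simp add: \<psi>_def restrict_char_def)
  then show thesis using that \<sigma>(1) by blast
qed

text \<open>Conjugating the idempotent replaces \<phi> by its image under some \<beta> in the Galois
  group, and composition with \<beta> only permutes the summands.\<close>

lemma semi_invariantI:
  assumes X: "X \<lhd> G" and s: "spherical G X \<phi>"
    and conj: "\<And>g. g \<in> carrier G \<Longrightarrow> \<exists>\<sigma>\<in>auts F. \<forall>x\<in>X. \<phi> (g \<otimes> x \<otimes> inv g) = \<sigma> (\<phi> x)"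
  shows "semi_invariant G X F \<phi>"
  unfolding semi_invariant_def
proof (intro ballI ext)
  interpret X: normal X G by fact
  have Xs: "subgroup X G" by (rule X.subgroup_axioms)
  note V = value_field[where F = F and X = X and \<phi> = \<phi>]
  let ?M = "value_field F X \<phi>"
  let ?\<Gamma> = "carrier (galois_group ?M F)"
  have M: "csubfield ?M" "F \<subseteq> ?M" "?M \<subseteq> E" using V value_field_subset_E[OF Xs s] by auto
  fix g y assume g: "g \<in> carrier G"
  let ?e = "central_idem_over G X F \<phi>"
  show "conj_group_algebra G g ?e y = ?e y"
  proof (cases "y \<in> X")
    case False
    have "inv g \<otimes> y \<otimes> g \<notin> X" if y: "y \<in> carrier G"
    proof
      assume "inv g \<otimes> y \<otimes> g \<in> X"
      then have "g \<otimes> (inv g \<otimes> y \<otimes> g) \<otimes> inv g \<in> X" by (rule X.inv_op_closed2[OF g])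
      then show False using False g y by (simp add: m_assoc mult_inv_cancel)
    qed
    then show ?thesis using False by (simp add: conj_group_algebra_def central_idem_over_outside)
  next
    case True
    obtain \<sigma> where \<sigma>: "\<sigma> \<in> auts F" "\<And>x. x \<in> X \<Longrightarrow> \<phi> (inv g \<otimes> x \<otimes> inv (inv g)) = \<sigma> (\<phi> x)"
      using conj[OF inv_closed[OF g]] by blast
    define \<beta> where "\<beta> = restrict \<sigma> ?M"
    have \<beta>: "\<beta> \<in> ?\<Gamma>"
      unfolding \<beta>_def using restrict_auts_galois[OF M \<sigma>(1)] V(2) \<sigma>(1) by (auto simp: auts_def)
    have y: "inv g \<otimes> y \<otimes> g \<in> X" using X.inv_op_closed1[OF g True] .
    have "inv (inv g \<otimes> y \<otimes> g) = inv g \<otimes> inv y \<otimes> inv (inv g)"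
      using g True by (simp add: inv_mult_group m_assoc)
    then have \<phi>y: "\<phi> (inv (inv g \<otimes> y \<otimes> g)) = \<beta> (\<phi> (inv y))"
      using \<sigma>(2)[of "inv y"] True V(3)[of "inv y"] by (simp add: \<beta>_def)
    have "inj_on (\<lambda>\<alpha>. compose ?M \<alpha> \<beta>) ?\<Gamma>"
    proof (rule inj_onI)
      fix \<alpha> \<alpha>' assume a: "\<alpha> \<in> ?\<Gamma>" "\<alpha>' \<in> ?\<Gamma>" and eq: "compose ?M \<alpha> \<beta> = compose ?M \<alpha>' \<beta>"
      have "\<alpha> z = \<alpha>' z" if z: "z \<in> ?M" for z
      proof -
        have "z \<in> \<beta> ` ?M" using \<beta> z by (simp add: galois_group_iff bij_betw_def)
        then obtain w where "w \<in> ?M" "z = \<beta> w" by blast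
        then show ?thesis using fun_cong[OF eq, of w] by (simp add: compose_def)
      qed
      then show "\<alpha> = \<alpha>'" using a by (intro extensionalityI[of _ ?M]) (auto simp: galois_group_iff)
    qed
    moreover have "(\<lambda>\<alpha>. compose ?M \<alpha> \<beta>) ` ?\<Gamma> \<subseteq> ?\<Gamma>"
      using galois_group_compose[OF _ \<beta> M(2) csubfieldD(1)[OF M(1)] M(1)] by blast
    ultimately have bij: "bij_betw (\<lambda>\<alpha>. compose ?M \<alpha> \<beta>) ?\<Gamma> ?\<Gamma>"
      using finite_galois_group[OF M] by (simp add: bij_betw_def endo_inj_surj)
    have "(\<Sum>\<alpha>\<in>?\<Gamma>. \<alpha> (\<phi> (inv (inv g \<otimes> y \<otimes> g)))) = (\<Sum>\<alpha>\<in>?\<Gamma>. compose ?M \<alpha> \<beta> (\<phi> (inv y)))"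
      using V(3)[of "inv y"] True by (simp add: \<phi>y compose_def)
    also have "\<dots> = (\<Sum>\<alpha>\<in>?\<Gamma>. \<alpha> (\<phi> (inv y)))"
      by (rule sum.reindex_bij_betw[OF bij])
    finally show ?thesis
      using True by (simp add: conj_group_algebra_def central_idem_over_eq[OF Xs s y] central_idem_over_eq[OF Xs s True])
  qed
qed

end

subsection \<open>Characters of abelian chief factors\<close>

locale semi_invariant_chief = finite_group_field G F
  for G :: "('a, 'b) monoid_scheme" (structure) and F +
  fixes K L :: "'a set" and \<theta> :: "'a \<Rightarrow> complex"
  assumes chief: "chief_factor G K L" and comm: "comm_group (factor_group G K L)"
    and \<theta>_Irr: "\<theta> \<in> Irr (G\<lparr>carrier := K\<rparr>)" and semi: "semi_invariant G K F \<theta>"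
begin

lemma K_normal: "K \<lhd> G" and L_normal: "L \<lhd> G" and LK: "L \<subseteq> K"
  and chief_cases: "\<And>M. M \<lhd> G \<Longrightarrow> L \<subseteq> M \<Longrightarrow> M \<subseteq> K \<Longrightarrow> M = L \<or> M = K"
  using chief by (auto simp: chief_factor_def)

sublocale K: normal K G by (rule K_normal)
sublocale L: normal L G by (rule L_normal)

lemma K_sub: "subgroup K G" and L_sub: "subgroup L G"
  by (rule K.subgroup_axioms, rule L.subgroup_axioms)

lemma finK: "finite K" and finL: "finite L"
  using finite_sub K_sub L_sub by auto

lemma \<theta>_spherical: "spherical G K \<theta>"
  using \<theta>_Irr Irr_subgroup_iff[OF K_sub finK] by simp

lemma L_normal_K: "L \<lhd> G\<lparr>carrier := K\<rparr>"
  by (rule normal_restrict_supergroup[OF K_sub L_normal LK])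

lemma carrier_factor: "carrier (factor_group G K L) = (\<lambda>k. L #> k) ` K"
  by (simp add: carrier_FactGroup)

lemma factor_mult: "k \<in> K \<Longrightarrow> l \<in> K \<Longrightarrow> (L #> k) \<otimes>\<^bsub>factor_group G K L\<^esub> (L #> l) = L #> (k \<otimes> l)"
  using normal.rcos_sum[OF L_normal_K, of k l] by simp

lemma commute_mod_L:
  assumes "k \<in> K" "t \<in> K"
  obtains l where "l \<in> L" "k \<otimes> t = l \<otimes> (t \<otimes> k)"
proof -
  interpret Q: comm_group "factor_group G K L" by (rule comm)
  have kt: "k \<otimes> t \<in> carrier G" "t \<otimes> k \<in> carrier G" using assms by auto
  have "L #> (k \<otimes> t) = L #> (t \<otimes> k)"
    using Q.m_comm[of "L #> k" "L #> t"] assms by (simp only: carrier_factor factor_mult imageI)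
  then have "k \<otimes> t \<in> L #> (t \<otimes> k)" using rcos_self[OF kt(1) L_sub] by simp
  then show thesis using that by (auto simp: r_coset_def)
qed

lemma order_factor: "Coset.order (factor_group G K L) * card L = card K"
proof -
  interpret GK: group "G\<lparr>carrier := K\<rparr>" by (rule subgroup_imp_group[OF K_sub])
  have "subgroup L (G\<lparr>carrier := K\<rparr>)" using L_normal_K normal_imp_subgroup by blast
  from GK.lagrange[OF this] show ?thesis by (simp add: Coset.order_def FactGroup_def)
qed

abbreviation conj :: "'a \<Rightarrow> 'a \<Rightarrow> 'a" where "conj g x \<equiv> g \<otimes> x \<otimes> inv g"

lemma conj_mult:
  "g \<in> carrier G \<Longrightarrow> h \<in> carrier G \<Longrightarrow> x \<in> carrier G \<Longrightarrow> conj (g \<otimes> h) x = conj g (conj h x)"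
  by (simp add: inv_mult_group m_assoc)

lemma conj_L: "g \<in> carrier G \<Longrightarrow> x \<in> L \<Longrightarrow> conj g x \<in> L"
  by (rule L.inv_op_closed2)

lemma conj_inv: "g \<in> carrier G \<Longrightarrow> x \<in> carrier G \<Longrightarrow> conj g (conj (inv g) x) = x"
  by (simp add: m_assoc mult_inv_cancel)

lemma \<theta>_conj:
  assumes "g \<in> carrier G"
  obtains \<sigma> where "\<sigma> \<in> auts F" "\<And>x. x \<in> K \<Longrightarrow> \<theta> (conj g x) = \<sigma> (\<theta> x)"
  using semi_invariantD[OF K_normal \<theta>_spherical semi assms] by blast

abbreviation "F\<theta> \<equiv> value_field F K \<theta>"

lemma F\<theta>: "csubfield F\<theta>" "F \<subseteq> F\<theta>" "F\<theta> \<subseteq> E" "\<And>x. x \<in> K \<Longrightarrow> \<theta> x \<in> F\<theta>"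
  using value_field[where F = F and X = K and \<phi> = \<theta>] value_field_subset_E[OF K_sub \<theta>_spherical] by auto

lemma restrict_irreducible_or_vanishes:
  "restrict_char L \<theta> \<in> Irr (G\<lparr>carrier := L\<rparr>) \<or> (\<forall>x\<in>K - L. \<theta> x = 0)"
proof -
  let ?S = "L \<union> {x \<in> K. \<theta> x \<noteq> 0}"
  define U where "U = generate G ?S"
  have S: "?S \<subseteq> K" using LK by auto
  have "U \<lhd> G"
    unfolding U_def
  proof (rule normal_generateI)
    show "?S \<subseteq> carrier G" using S K.subset by blast
    fix h g assume h: "h \<in> ?S" and g: "g \<in> carrier G"
    obtain \<sigma> where \<sigma>: "\<sigma> \<in> auts F" "\<And>x. x \<in> K \<Longrightarrow> \<theta> (conj g x) = \<sigma> (\<theta> x)" using \<theta>_conj[OF g] by blast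
    show "conj g h \<in> ?S"
    proof (cases "h \<in> L")
      case True
      then show ?thesis using conj_L[OF g] by simp
    next
      case False
      then have hK: "h \<in> K" "\<theta> h \<noteq> 0" using h by auto
      then have "\<theta> h \<in> E" using F\<theta> by blast
      \<comment> \<open>An embedding vanishes at 0 only, so conjugation by g preserves the support
        of \<theta>.\<close>
      then have "\<sigma> (\<theta> h) \<noteq> 0"
        using hK \<sigma>(1) field_embD(8)[OF _ E(1)] by (auto simp: auts_def)
      then show ?thesis using \<sigma>(2)[OF hK(1)] K.inv_op_closed2[OF g hK(1)] by simp
    qed
  qed
  moreover have "L \<subseteq> U" unfolding U_def by (auto intro: generate.incl)
  moreover have "U \<subseteq> K" unfolding U_def by (rule generate_subgroup_incl[OF S K_sub])
  ultimately consider "U = L" | "U = K" using chief_cases by blast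
  then show ?thesis
  proof cases
    case 1
    have "\<theta> x = 0" if "x \<in> K - L" for x
    proof (rule ccontr)
      assume "\<theta> x \<noteq> 0"
      then have "x \<in> U" unfolding U_def using that by (intro generate.incl) auto
      then show False using 1 that by simp
    qed
    then show ?thesis by blast
  next
    case 2
    interpret GK: group "G\<lparr>carrier := K\<rparr>" by (rule subgroup_imp_group[OF K_sub])
    have inv: "inv\<^bsub>G\<lparr>carrier := K\<rparr>\<^esub> x = inv x" if "x \<in> K" for x
      using m_inv_consistent[OF K_sub that] .
    have "char_prod (G\<lparr>carrier := K\<rparr>) L \<theta> \<theta> = of_nat (card L)"
    proof (rule GK.norm_restrict_normal[OF _ L_normal_K comm])
      show "finite (carrier (G\<lparr>carrier := K\<rparr>))" using finK by simp
      show "spherical (G\<lparr>carrier := K\<rparr>) (carrier (G\<lparr>carrier := K\<rparr>)) \<theta>"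
        using \<theta>_spherical spherical_subgroup[OF K_sub] by simp
      fix \<mu> :: "'a \<Rightarrow> complex" and x
      assume m: "\<And>x y. x \<in> carrier (G\<lparr>carrier := K\<rparr>) \<Longrightarrow> y \<in> carrier (G\<lparr>carrier := K\<rparr>) \<Longrightarrow>
          \<mu> (x \<otimes>\<^bsub>G\<lparr>carrier := K\<rparr>\<^esub> y) = \<mu> x * \<mu> y"
        and L1: "\<And>x. x \<in> L \<Longrightarrow> \<mu> x = 1"
        and s1: "\<And>x. x \<in> carrier (G\<lparr>carrier := K\<rparr>) \<Longrightarrow> \<theta> x \<noteq> 0 \<Longrightarrow> \<mu> x = 1"
        and x: "x \<in> carrier (G\<lparr>carrier := K\<rparr>)"
      have mm: "\<mu> (a \<otimes> b) = \<mu> a * \<mu> b" if "a \<in> K" "b \<in> K" for a b using m[of a b] that by simp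
      have one: "\<mu> \<one> = 1" using L1 by simp
      \<comment> \<open>The kernel of \<mu> contains L and the support of \<theta>, that is, all
        generators of U, and U is K here.\<close>
      have "subgroup {x \<in> K. \<mu> x = 1} G"
      proof (rule subgroupI)
        show "{x \<in> K. \<mu> x = 1} \<subseteq> carrier G" using K.subset by blast
        show "{x \<in> K. \<mu> x = 1} \<noteq> {}" using one K.one_closed by blast
        show "a \<otimes> b \<in> {x \<in> K. \<mu> x = 1}" if "a \<in> {x \<in> K. \<mu> x = 1}" "b \<in> {x \<in> K. \<mu> x = 1}" for a b
          using that mm by simp
        show "inv a \<in> {x \<in> K. \<mu> x = 1}" if "a \<in> {x \<in> K. \<mu> x = 1}" for a
          using that mm[of a "inv a"] one by simp
      qed
      then have "U \<subseteq> {x \<in> K. \<mu> x = 1}"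
        unfolding U_def using S L1 s1 by (intro generate_subgroup_incl) auto
      then show "\<mu> x = 1" using 2 x by auto
    qed
    moreover have "char_prod (G\<lparr>carrier := K\<rparr>) L \<theta> \<theta> = char_prod G L \<theta> \<theta>"
      unfolding char_prod_def using inv LK by (intro sum.cong) auto
    ultimately show ?thesis
      using restrict_irreducible[OF L_sub finL K_sub LK \<theta>_Irr] by simp
  qed
qed

end

section \<open>The case where the character vanishes off L\<close>

locale chief_constituent = semi_invariant_chief G F K L \<theta>
  for G :: "('a, 'b) monoid_scheme" (structure) and F K L \<theta> +
  fixes \<phi> :: "'a \<Rightarrow> complex"
  assumes vanishes: "\<And>x. x \<in> K - L \<Longrightarrow> \<theta> x = 0"
    and \<phi>_spherical: "spherical G L \<phi>" and constituent: "char_prod G L \<theta> \<phi> \<noteq> 0"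
begin

abbreviation "F\<phi> \<equiv> value_field F L \<phi>"

lemma F\<phi>: "csubfield F\<phi>" "F \<subseteq> F\<phi>" "F\<phi> \<subseteq> E" "\<And>x. x \<in> L \<Longrightarrow> \<phi> x \<in> F\<phi>"
  using value_field[where F = F and X = L and \<phi> = \<phi>] value_field_subset_E[OF L_sub \<phi>_spherical] by auto

lemma \<phi>_E: "x \<in> L \<Longrightarrow> \<phi> x \<in> E"
  using F\<phi> by blast

lemma \<theta>_E: "x \<in> K \<Longrightarrow> \<theta> x \<in> E"
  using F\<theta> by blast

lemma \<phi>_Irr: "\<phi> \<in> Irr (G\<lparr>carrier := L\<rparr>)"
  using \<phi>_spherical Irr_subgroup_iff[OF L_sub finL] by simp

lemma Clifford_\<theta>:
  "y \<in> L \<Longrightarrow> of_nat (card K) * \<phi> \<one> * \<theta> y = \<theta> \<one> * (\<Sum>k\<in>K. \<phi> (conj k y))"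
  by (rule Clifford[OF K_sub finK L_normal LK \<theta>_spherical \<phi>_spherical constituent])

text \<open>The pairing of the images is the image of the pairing, and an embedding is injective. So
  constituents remain constituents under field embeddings.\<close>

lemma char_prod_emb:
  assumes M: "csubfield M" "\<phi> ` L \<subseteq> M" "\<theta> ` L \<subseteq> M" and \<sigma>: "field_emb M \<sigma>"
  shows "char_prod G L (\<lambda>x. \<sigma> (\<theta> x)) (\<lambda>x. \<sigma> (\<phi> x)) \<noteq> 0"
proof -
  have m: "\<phi> x \<in> M" "\<theta> x \<in> M" if "x \<in> L" for x using M that by auto
  have p: "\<theta> x * \<phi> (inv x) \<in> M" if "x \<in> L" for x
    using m that csubfieldD(5)[OF M(1)] by simp
  have "char_prod G L (\<lambda>x. \<sigma> (\<theta> x)) (\<lambda>x. \<sigma> (\<phi> x)) = (\<Sum>x\<in>L. \<sigma> (\<theta> x * \<phi> (inv x)))"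
    unfolding char_prod_def using m by (intro sum.cong refl) (simp add: field_embD(4)[OF \<sigma> M(1)])
  also have "\<dots> = \<sigma> (char_prod G L \<theta> \<phi>)"
    unfolding char_prod_def using p by (intro field_emb_sum[OF \<sigma> M(1), symmetric])
  finally have "char_prod G L (\<lambda>x. \<sigma> (\<theta> x)) (\<lambda>x. \<sigma> (\<phi> x)) = \<sigma> (char_prod G L \<theta> \<phi>)" .
  moreover have "char_prod G L \<theta> \<phi> \<in> M"
    unfolding char_prod_def using p by (intro csubfield_sum[OF M(1)])
  ultimately show ?thesis using field_embD(8)[OF \<sigma> M(1)] constituent by simp
qed

text \<open>By semi-invariance the conjugate of \<theta> by g is \<sigma>\<theta>. Its restriction
  has both the conjugate of \<phi> by g and \<sigma>\<phi> as constituents, and these are conjugate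
  under K by Clifford's theorem.\<close>

lemma \<phi>_conj:
  assumes g: "g \<in> carrier G"
  obtains \<sigma> k where "\<sigma> \<in> auts F" "k \<in> K" "\<And>y. y \<in> L \<Longrightarrow> \<phi> (conj g y) = \<sigma> (\<phi> (conj k y))"
proof -
  obtain \<sigma> where \<sigma>: "\<sigma> \<in> auts F" "\<And>x. x \<in> K \<Longrightarrow> \<theta> (conj g x) = \<sigma> (\<theta> x)" using \<theta>_conj[OF g] by blast
  have e: "field_emb E \<sigma>" using \<sigma>(1) by (simp add: auts_def)
  let ?\<psi> = "restrict_char L (\<lambda>y. \<phi> (conj g y))"
  have "char_prod G L (\<lambda>x. \<sigma> (\<theta> x)) ?\<psi> = (\<Sum>y\<in>L. \<theta> (conj g y) * \<phi> (inv (conj g y)))"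
    unfolding char_prod_def
  proof (intro sum.cong refl)
    fix y assume y: "y \<in> L"
    have "conj g (inv y) = inv (conj g y)" using g y by (simp add: inv_mult_group m_assoc)
    then show "\<sigma> (\<theta> y) * ?\<psi> (inv y) = \<theta> (conj g y) * \<phi> (inv (conj g y))"
      using y LK \<sigma>(2)[of y] by (auto simp: restrict_char_def)
  qed
  also have "\<dots> = char_prod G L \<theta> \<phi>"
    unfolding char_prod_def by (rule sum.reindex_bij_betw[OF bij_betw_conj_normal[OF L_normal g]])
  finally have ne: "char_prod G L (\<lambda>x. \<sigma> (\<theta> x)) ?\<psi> \<noteq> 0" using constituent by simp
  have \<theta>\<sigma>: "spherical G K (\<lambda>x. \<sigma> (\<theta> x))"
    using \<theta>_E by (intro spherical_field_emb[OF K_sub \<theta>_spherical E(1) _ e]) auto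
  have \<phi>\<sigma>: "spherical G L (\<lambda>x. \<sigma> (\<phi> x))"
    using \<phi>_E by (intro spherical_field_emb[OF L_sub \<phi>_spherical E(1) _ e]) auto
  have ne': "char_prod G L (\<lambda>x. \<sigma> (\<theta> x)) (\<lambda>x. \<sigma> (\<phi> x)) \<noteq> 0"
    using \<phi>_E \<theta>_E LK by (intro char_prod_emb[OF E(1) _ _ e]) auto
  obtain k where "k \<in> K" "\<And>y. y \<in> L \<Longrightarrow> ?\<psi> y = \<sigma> (\<phi> (conj k y))"
    using Clifford_conjugate[OF K_sub finK L_normal LK \<theta>\<sigma> \<phi>\<sigma> ne' spherical_conj[OF L_normal \<phi>_spherical g] ne]
    by blast
  then show thesis using that[OF \<sigma>(1)] by (simp add: restrict_char_def)
qed

text \<open>As \<alpha> fixes \<theta> on L, it carries \<phi> to another constituent of the same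
  restriction, hence to a K-conjugate. The inclusion \<open>sub\<close> keeps the values of \<theta>
  where \<alpha> is a homomorphism.\<close>

lemma \<phi>_galois_conj:
  assumes \<alpha>: "field_emb F\<phi> \<alpha>" "\<And>x. x \<in> L \<Longrightarrow> \<alpha> (\<theta> x) = \<theta> x" and sub: "\<theta> ` L \<subseteq> F\<phi>"
  obtains k where "k \<in> K" "\<And>y. y \<in> L \<Longrightarrow> \<alpha> (\<phi> y) = \<phi> (conj k y)"
proof -
  have \<phi>\<alpha>: "spherical G L (\<lambda>x. \<alpha> (\<phi> x))"
    using F\<phi>(4) by (intro spherical_field_emb[OF L_sub \<phi>_spherical F\<phi>(1) _ \<alpha>(1)]) auto
  have "char_prod G L (\<lambda>x. \<alpha> (\<theta> x)) (\<lambda>x. \<alpha> (\<phi> x)) \<noteq> 0"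
    using F\<phi>(4) by (intro char_prod_emb[OF F\<phi>(1) _ sub \<alpha>(1)]) auto
  moreover have "char_prod G L (\<lambda>x. \<alpha> (\<theta> x)) (\<lambda>x. \<alpha> (\<phi> x)) = char_prod G L \<theta> (\<lambda>x. \<alpha> (\<phi> x))"
    unfolding char_prod_def using \<alpha>(2) by (intro sum.cong) auto
  ultimately have ne: "char_prod G L \<theta> (\<lambda>x. \<alpha> (\<phi> x)) \<noteq> 0" by simp
  show thesis
    using Clifford_conjugate[OF K_sub finK L_normal LK \<theta>_spherical \<phi>_spherical constituent \<phi>\<alpha> ne] that
    by blast
qed

lemma \<phi>_conj_L: "l \<in> L \<Longrightarrow> y \<in> L \<Longrightarrow> \<phi> (conj l y) = \<phi> y"
  using spherical_class_fun[OF L_sub finL \<phi>_spherical] by (simp add: class_fun_def)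

text \<open>Modulo L the elements k and t commute, and conjugation by elements of L leaves \<phi>
  unchanged.\<close>

lemma \<phi>_conj_commute:
  assumes "k \<in> K" "t \<in> K" "z \<in> L"
  shows "\<phi> (conj k (conj t z)) = \<phi> (conj t (conj k z))"
proof -
  obtain l where l: "l \<in> L" "k \<otimes> t = l \<otimes> (t \<otimes> k)" using commute_mod_L[OF assms(1,2)] .
  have mem: "k \<in> carrier G" "t \<in> carrier G" "l \<in> carrier G" "z \<in> carrier G" using assms l by auto
  have "conj k (conj t z) = conj (l \<otimes> (t \<otimes> k)) z" using mem l(2) by (simp only: conj_mult[symmetric])
  also have "\<dots> = conj l (conj t (conj k z))" using mem by (simp only: conj_mult m_closed)
  finally show ?thesis using \<phi>_conj_L[OF l(1)] conj_L mem assms(3) by simp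
qed

definition T :: "'a set" where "T = {k \<in> K. \<forall>y\<in>L. \<phi> (conj k y) = \<phi> y}"

text \<open>For normality, \<open>\<phi>_conj\<close> replaces the action of g on \<phi> by an
  automorphism and some k in K. The element t is moved past k and then disappears because it
  stabilises \<phi>.\<close>

lemma T_cases: "T = L \<or> T = K"
proof (rule chief_cases)
  have "subgroup T G"
  proof (rule subgroupI)
    show "T \<subseteq> carrier G" using K.subset by (auto simp: T_def)
    have "\<one> \<in> T" by (simp add: T_def)
    then show "T \<noteq> {}" by blast
    show "inv t \<in> T" if t: "t \<in> T" for t
    proof -
      have tG: "t \<in> carrier G" "t \<in> K" using t by (auto simp: T_def)
      have "\<phi> (conj (inv t) y) = \<phi> y" if y: "y \<in> L" for y
      proof -
        have "\<phi> (conj t (conj (inv t) y)) = \<phi> (conj (inv t) y)"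
          using t conj_L[of "inv t" y] tG y unfolding T_def by blast
        then show ?thesis using conj_inv[OF tG(1)] y by simp
      qed
      then show ?thesis using tG by (simp add: T_def)
    qed
    show "s \<otimes> t \<in> T" if s: "s \<in> T" and t: "t \<in> T" for s t
    proof -
      have G: "s \<in> carrier G" "t \<in> carrier G" using s t by (auto simp: T_def)
      have "\<phi> (conj (s \<otimes> t) y) = \<phi> y" if y: "y \<in> L" for y
        using s t y conj_L[OF G(2) y] conj_mult[OF G, of y] by (simp add: T_def)
      then show ?thesis using s t by (simp add: T_def)
    qed
  qed
  then show "T \<lhd> G"
  proof (rule normal_invI)
    fix g t assume g: "g \<in> carrier G" and t: "t \<in> T"
    have tK: "t \<in> K" "t \<in> carrier G" using t by (auto simp: T_def)
    obtain \<sigma> k where \<sigma>: "\<sigma> \<in> auts F" "k \<in> K" "\<And>y. y \<in> L \<Longrightarrow> \<phi> (conj g y) = \<sigma> (\<phi> (conj k y))"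
      using \<phi>_conj[OF g] by blast
    have "\<phi> (conj (conj g t) y) = \<phi> y" if y: "y \<in> L" for y
    proof -
      define z where "z = conj (inv g) y"
      have z: "z \<in> L" unfolding z_def using g y by (intro conj_L) auto
      have zt: "conj t z \<in> L" and zk: "conj k z \<in> L" using conj_L tK \<sigma>(2) z by auto
      have "conj (conj g t) y = conj g (conj t z)"
        using g tK y by (simp add: z_def conj_mult)
      also have "\<phi> \<dots> = \<sigma> (\<phi> (conj k (conj t z)))" by (rule \<sigma>(3)[OF zt])
      also have "\<phi> (conj k (conj t z)) = \<phi> (conj t (conj k z))"
        by (rule \<phi>_conj_commute[OF \<sigma>(2) tK(1) z])
      also have "\<phi> (conj t (conj k z)) = \<phi> (conj k z)" using t zk unfolding T_def by blast
      also have "\<sigma> (\<phi> (conj k z)) = \<phi> (conj g z)" by (rule \<sigma>(3)[OF z, symmetric])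
      also have "conj g z = y" unfolding z_def using g y by (intro conj_inv) auto
      finally show ?thesis .
    qed
    then show "conj g t \<in> T" using K.inv_op_closed2[OF g tK(1)] by (simp add: T_def)
  qed
  show "L \<subseteq> T" using LK \<phi>_conj_L by (auto simp: T_def)
  show "T \<subseteq> K" by (auto simp: T_def)
qed

text \<open>Here m is the multiplicity of \<phi> in the restriction of \<theta>. Clifford's formula
  is paired over L with \<phi>, where the conjugates equal to \<phi> are counted by T, and with
  \<theta>, whose norm over L is still |K| since it vanishes off L. Eliminating the degrees gives
  the order of T.\<close>

lemma multiplicity:
  obtains m :: nat where "of_nat (card K) * \<phi> \<one> = \<theta> \<one> * of_nat (card L) * of_nat m"
    "card T = card L * m\<^sup>2"
proof -
  obtain m :: nat where m: "char_prod G L \<theta> \<phi> = of_nat (card L) * of_nat m"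
    using char_prod_restrict_nat[OF L_sub finL K_sub LK \<theta>_Irr \<phi>_spherical] .
  have KG: "k \<in> carrier G" if "k \<in> K" for k using that by auto
  have N: "of_nat (card K) * \<phi> \<one> * char_prod G L \<theta> f = \<theta> \<one> * (\<Sum>k\<in>K. \<Sum>y\<in>L. \<phi> (conj k y) * f (inv y))" for f
  proof -
    have "of_nat (card K) * \<phi> \<one> * char_prod G L \<theta> f = (\<Sum>y\<in>L. of_nat (card K) * \<phi> \<one> * \<theta> y * f (inv y))"
      by (simp add: char_prod_def sum_distrib_left mult_ac)
    also have "\<dots> = (\<Sum>y\<in>L. \<theta> \<one> * (\<Sum>k\<in>K. \<phi> (conj k y)) * f (inv y))"
      by (intro sum.cong refl) (simp only: Clifford_\<theta>)
    also have "\<dots> = \<theta> \<one> * (\<Sum>y\<in>L. \<Sum>k\<in>K. \<phi> (conj k y) * f (inv y))"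
      by (simp add: sum_distrib_left sum_distrib_right mult.assoc)
    finally show ?thesis by (simp add: sum.swap[of _ K L])
  qed
  have "(\<Sum>k\<in>K. \<Sum>y\<in>L. \<phi> (conj k y) * \<phi> (inv y)) = (\<Sum>k\<in>K. if k \<in> T then of_nat (card L) else 0)"
  proof (intro sum.cong refl)
    fix k assume k: "k \<in> K"
    let ?f = "restrict_char L (\<lambda>y. \<phi> (conj k y))"
    have "(\<Sum>y\<in>L. \<phi> (conj k y) * \<phi> (inv y)) = char_prod G L ?f \<phi>"
      unfolding char_prod_def by (intro sum.cong refl) (simp add: restrict_char_def)
    also have "\<dots> = (if ?f = \<phi> then of_nat (card L) else 0)"
      by (rule char_prod_spherical[OF L_sub finL spherical_conj[OF L_normal \<phi>_spherical KG[OF k]] \<phi>_spherical])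
    also have "?f = \<phi> \<longleftrightarrow> k \<in> T"
    proof
      assume "?f = \<phi>"
      then have "\<phi> (conj k y) = \<phi> y" if "y \<in> L" for y
        using that by (auto simp: restrict_char_def dest: fun_cong[of _ _ y])
      then show "k \<in> T" using k by (simp add: T_def)
    next
      assume "k \<in> T"
      then show "?f = \<phi>" using sphericalD(2)[OF \<phi>_spherical] by (intro restrict_char_eqI) (auto simp: T_def)
    qed
    finally show "(\<Sum>y\<in>L. \<phi> (conj k y) * \<phi> (inv y)) = (if k \<in> T then of_nat (card L) else 0)" .
  qed
  also have "\<dots> = of_nat (card T) * of_nat (card L)"
  proof -
    have "K \<inter> T = T" by (auto simp: T_def)
    then show ?thesis using finK by (simp add: sum.If_cases[OF finK])
  qed
  finally have N1: "of_nat (card K) * \<phi> \<one> * (of_nat (card L) * of_nat m) = \<theta> \<one> * (of_nat (card T) * of_nat (card L))"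
    using N[of \<phi>] m by simp
  have "char_prod G L \<theta> \<theta> = char_prod G K \<theta> \<theta>"
    unfolding char_prod_def using LK finK vanishes by (intro sum.mono_neutral_left) auto
  then have nK: "char_prod G L \<theta> \<theta> = of_nat (card K)" using sphericalD(4)[OF \<theta>_spherical] by simp
  \<comment> \<open>As \<theta> is a class function of K, all K-conjugates of \<phi> have the same
    pairing with it.\<close>
  have "(\<Sum>k\<in>K. \<Sum>y\<in>L. \<phi> (conj k y) * \<theta> (inv y)) = (\<Sum>k\<in>K. char_prod G L \<phi> \<theta>)"
  proof (intro sum.cong refl)
    fix k assume k: "k \<in> K"
    have "\<theta> (inv y) = \<theta> (inv (conj k y))" if y: "y \<in> L" for y
    proof -
      have "inv (conj k y) = conj k (inv y)" using KG[OF k] y by (simp add: inv_mult_group m_assoc)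
      then show ?thesis
        using spherical_class_fun[OF K_sub finK \<theta>_spherical] k y LK by (auto simp: class_fun_def)
    qed
    then have "(\<Sum>y\<in>L. \<phi> (conj k y) * \<theta> (inv y)) = (\<Sum>y\<in>L. \<phi> (conj k y) * \<theta> (inv (conj k y)))"
      by (intro sum.cong refl) simp
    also have "\<dots> = char_prod G L \<phi> \<theta>"
      unfolding char_prod_def by (rule sum.reindex_bij_betw[OF bij_betw_conj_normal[OF L_normal KG[OF k]]])
    finally show "(\<Sum>y\<in>L. \<phi> (conj k y) * \<theta> (inv y)) = char_prod G L \<phi> \<theta>" .
  qed
  then have "of_nat (card K) * \<phi> \<one> * of_nat (card K) = \<theta> \<one> * (of_nat (card K) * (of_nat (card L) * of_nat m))"
    using N[of \<theta>] nK m char_prod_commute[OF L_sub, of \<phi> \<theta>] by simp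
  then have N2: "of_nat (card K) * \<phi> \<one> = \<theta> \<one> * of_nat (card L) * of_nat m"
    using subgroup_card_neq_0[OF K_sub finK] by (simp add: mult_ac)
  have "\<theta> \<one> * of_nat (card L) * of_nat (card T) = of_nat (card K) * \<phi> \<one> * (of_nat (card L) * of_nat m)"
    using N1[symmetric] by (simp only: mult_ac)
  also have "\<dots> = \<theta> \<one> * of_nat (card L) * (of_nat (card L) * of_nat m * of_nat m)"
    unfolding N2 by (simp only: mult_ac)
  finally have "(of_nat (card T) :: complex) = of_nat (card L) * of_nat m * of_nat m"
    using sphericalD(1)[OF \<theta>_spherical] subgroup_card_neq_0[OF L_sub finL] by simp
  then have "card T = card L * m\<^sup>2"
    by (simp add: power2_eq_square mult.assoc flip: of_nat_mult)
  then show thesis using that N2 by blast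
qed

text \<open>All K-conjugates of \<phi> coincide, so Clifford's formula makes the restriction a
  multiple of \<phi>; the factor is the multiplicity m, and T = K gives m^2 = |K:L|. The fields
  agree since m is rational and nonzero and \<theta> vanishes off L.\<close>

lemma fully_ramified:
  assumes "T = K"
  shows "\<exists>e::nat. restrict_char L \<theta> = (\<lambda>x. of_nat e * \<phi> x) \<and>
    e\<^sup>2 = Coset.order (factor_group G K L) \<and> F\<theta> = F\<phi>"
proof -
  obtain m where m: "of_nat (card K) * \<phi> \<one> = \<theta> \<one> * of_nat (card L) * of_nat m" "card T = card L * m\<^sup>2"
    using multiplicity .
  note cL = subgroup_card_neq_0[OF L_sub finL] and cK = subgroup_card_neq_0[OF K_sub finK]
  have K: "card K = card L * m\<^sup>2" using m(2) assms by simp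
  then have m0: "m \<noteq> 0" using cK by (metis mult_zero_right of_nat_0 power_zero_numeral)
  have "of_nat (card L) * of_nat m * (of_nat m * \<phi> \<one>) = of_nat (card L) * of_nat m * \<theta> \<one>"
    using m(1) unfolding K by (simp add: power2_eq_square mult_ac)
  then have deg: "\<theta> \<one> = of_nat m * \<phi> \<one>" using cL m0 by simp
  have eq: "\<theta> y = of_nat m * \<phi> y" if y: "y \<in> L" for y
  proof -
    have "(\<Sum>k\<in>K. \<phi> (conj k y)) = (\<Sum>k\<in>K. \<phi> y)"
      using y assms unfolding T_def by (intro sum.cong refl) blast
    then have "of_nat (card K) * \<phi> \<one> * \<theta> y = of_nat (card K) * \<phi> \<one> * (of_nat m * \<phi> y)"
      using Clifford_\<theta>[OF y] by (simp add: deg mult_ac)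
    then show ?thesis using cK sphericalD(1)[OF \<phi>_spherical] by simp
  qed
  have "restrict_char L \<theta> = (\<lambda>x. of_nat m * \<phi> x)"
    using eq sphericalD(2)[OF \<phi>_spherical] by (intro restrict_char_eqI) auto
  moreover have "m\<^sup>2 = Coset.order (factor_group G K L)"
    using order_factor K cL by (metis mult.commute mult_cancel_left of_nat_0)
  moreover have "F\<theta> = F\<phi>"
  proof
    show "F\<theta> \<subseteq> F\<phi>"
    proof (rule value_field_least[OF F\<phi>(1,2)])
      fix x assume x: "x \<in> K"
      show "\<theta> x \<in> F\<phi>"
        using x vanishes[of x] eq[of x] csubfieldD[OF F\<phi>(1)] csubfield_of_nat[OF F\<phi>(1)] F\<phi>(4)[of x]
        by (cases "x \<in> L") auto
    qed
    show "F\<phi> \<subseteq> F\<theta>"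
    proof (rule value_field_least[OF F\<theta>(1,2)])
      fix x assume x: "x \<in> L"
      have "\<phi> x = inverse (of_nat m) * \<theta> x" using eq[OF x] m0 by simp
      then show "\<phi> x \<in> F\<theta>"
        using csubfieldD[OF F\<theta>(1)] csubfield_of_nat[OF F\<theta>(1)] F\<theta>(4)[of x] x LK by auto
    qed
  qed
  ultimately show ?thesis by blast
qed

text \<open>Now m = 1, so \<theta> has |K:L| times the degree of \<phi>, and Clifford's formula
  becomes the induction formula on L. Off L the induced character vanishes too, because L is
  normal.\<close>

lemma induced:
  assumes "T = L"
  shows "\<theta> = induced_char G L K \<phi>" "\<theta> ` L \<subseteq> F\<phi>" "F\<theta> \<subseteq> F\<phi>"
proof -
  obtain m where m: "of_nat (card K) * \<phi> \<one> = \<theta> \<one> * of_nat (card L) * of_nat m" "card T = card L * m\<^sup>2"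
    using multiplicity .
  note cL = subgroup_card_neq_0[OF L_sub finL] and cK = subgroup_card_neq_0[OF K_sub finK]
  have "m\<^sup>2 = 1" using m(2) assms cL by simp
  then have "m = 1" by (simp add: power2_eq_1_iff)
  then have deg: "of_nat (card K) * \<phi> \<one> = \<theta> \<one> * of_nat (card L)" using m(1) by simp
  have eq: "\<theta> y = 1 / of_nat (card L) * (\<Sum>k\<in>K. \<phi> (conj k y))" if y: "y \<in> L" for y
  proof -
    have "\<theta> \<one> * (of_nat (card L) * \<theta> y) = \<theta> \<one> * (\<Sum>k\<in>K. \<phi> (conj k y))"
      using Clifford_\<theta>[OF y] deg by (simp add: mult_ac)
    then have "of_nat (card L) * \<theta> y = (\<Sum>k\<in>K. \<phi> (conj k y))"
      using sphericalD(1)[OF \<theta>_spherical] by simp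
    then show ?thesis using cL by (simp add: field_simps)
  qed
  have KG: "k \<in> carrier G" if "k \<in> K" for k using that by auto
  show "\<theta> = induced_char G L K \<phi>"
  proof
    fix x
    consider "x \<in> L" | "x \<in> K - L" | "x \<notin> K" by blast
    then show "\<theta> x = induced_char G L K \<phi> x"
    proof cases
      case 1
      have "(\<Sum>k\<in>K. \<phi> (conj k x)) = (\<Sum>k\<in>K. restrict_char L \<phi> (conj k x))"
        using conj_L[OF KG 1] by (intro sum.cong refl) (simp add: restrict_char_def)
      then show ?thesis using eq[OF 1] 1 LK by (auto simp: induced_char_def)
    next
      case 2
      have "restrict_char L \<phi> (conj k x) = 0" if k: "k \<in> K" for k
      proof -
        have "conj k x \<notin> L"
        proof
          assume "conj k x \<in> L"
          then have "conj (inv k) (conj k x) \<in> L"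
            by (rule conj_L[OF inv_closed[OF KG[OF k]]])
          then show False using 2 KG[OF k] conj_inv[of "inv k" x] by auto
        qed
        then show ?thesis by (simp add: restrict_char_def)
      qed
      then show ?thesis using vanishes[OF 2] by (simp add: induced_char_def)
    next
      case 3
      then show ?thesis using sphericalD(2)[OF \<theta>_spherical] by (simp add: induced_char_def)
    qed
  qed
  have L': "\<theta> y \<in> F\<phi>" if y: "y \<in> L" for y
    unfolding eq[OF y] divide_inverse mult_1
    using conj_L[OF KG y] F\<phi>(4) csubfield_of_nat[OF F\<phi>(1)]
    by (intro csubfieldD(5)[OF F\<phi>(1)] csubfieldD(7)[OF F\<phi>(1)] csubfield_sum[OF F\<phi>(1)]) auto
  then show "\<theta> ` L \<subseteq> F\<phi>" by blast
  show "F\<theta> \<subseteq> F\<phi>"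
  proof (rule value_field_least[OF F\<phi>(1,2)])
    fix x assume "x \<in> K"
    then show "\<theta> x \<in> F\<phi>" using L'[of x] vanishes[of x] csubfieldD(2)[OF F\<phi>(1)] by (cases "x \<in> L") auto
  qed
qed

section \<open>The Galois action on the constituent\<close>

definition A :: "'a set" where
  "A = {k \<in> K. \<exists>\<sigma>\<in>auts F\<theta>. \<forall>y\<in>L. \<phi> (conj k y) = \<sigma> (\<phi> y)}"

lemma auts_F\<theta>: "\<sigma> \<in> auts F\<theta> \<Longrightarrow> \<sigma> \<in> auts F"
  using F\<theta>(2) by (auto simp: auts_def)

text \<open>Normality is shown as for T with one more step: t now acts on \<phi> as \<tau>, and
  \<tau> has to be moved past \<sigma>.\<close>

lemma A_cases: "A = L \<or> A = K"
proof (rule chief_cases)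
  have AG: "A \<subseteq> carrier G" using K.subset by (auto simp: A_def)
  have one: "\<one> \<in> A" using id_auts[OF F\<theta>(3)] by (auto simp: A_def)
  have mult: "s \<otimes> t \<in> A" if s: "s \<in> A" and t: "t \<in> A" for s t
  proof -
    obtain \<sigma> \<tau> where \<sigma>: "\<sigma> \<in> auts F\<theta>" "\<forall>y\<in>L. \<phi> (conj s y) = \<sigma> (\<phi> y)"
      and \<tau>: "\<tau> \<in> auts F\<theta>" "\<forall>y\<in>L. \<phi> (conj t y) = \<tau> (\<phi> y)" using s t by (auto simp: A_def)
    have G: "s \<in> carrier G" "t \<in> carrier G" using s t AG by auto
    have "\<phi> (conj (s \<otimes> t) y) = \<sigma> (\<tau> (\<phi> y))" if y: "y \<in> L" for y
      using \<sigma>(2) \<tau>(2) y conj_L[OF G(2) y] conj_mult[OF G, of y] by simp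
    moreover have "(\<lambda>x. \<sigma> (\<tau> x)) \<in> auts F\<theta>"
      using auts_comp[OF auts_F\<theta> auts_F\<theta>, OF \<sigma>(1) \<tau>(1)] \<sigma>(1) \<tau>(1) by (auto simp: auts_def)
    ultimately show ?thesis using s t unfolding A_def by auto
  qed
  have "subgroup A G"
  proof (rule subgroupI[OF AG])
    show "A \<noteq> {}" using one by blast
    show "inv t \<in> A" if t: "t \<in> A" for t
    proof -
      have tG: "t \<in> carrier G" using t AG by auto
      \<comment> \<open>In a finite group the inverse of t is a power of t, so closure under
        products gives closure under inverses.\<close>
      have pw: "t [^] n \<in> A" for n :: nat by (induction n) (auto simp: one mult t)
      have "0 < Coset.order G" using finite_G by (simp add: order_gt_0_iff_finite)
      then have "t [^] (Coset.order G - 1) \<otimes> t = \<one>"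
        using pow_order_eq_1[OF tG] by (metis Suc_diff_1 nat_pow_Suc)
      then have "inv t = t [^] (Coset.order G - 1)" using tG by (intro inv_equality) auto
      then show ?thesis using pw by simp
    qed
  qed (rule mult)
  then show "A \<lhd> G"
  proof (rule normal_invI)
    fix g t assume g: "g \<in> carrier G" and t: "t \<in> A"
    have tK: "t \<in> K" "t \<in> carrier G" using t by (auto simp: A_def)
    obtain \<tau> where \<tau>: "\<tau> \<in> auts F\<theta>" "\<forall>y\<in>L. \<phi> (conj t y) = \<tau> (\<phi> y)" using t by (auto simp: A_def)
    obtain \<sigma> k where \<sigma>: "\<sigma> \<in> auts F" "k \<in> K" "\<And>y. y \<in> L \<Longrightarrow> \<phi> (conj g y) = \<sigma> (\<phi> (conj k y))"
      using \<phi>_conj[OF g] by blast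
    have "\<phi> (conj (conj g t) y) = \<tau> (\<phi> y)" if y: "y \<in> L" for y
    proof -
      define z where "z = conj (inv g) y"
      have z: "z \<in> L" unfolding z_def using g y by (intro conj_L) auto
      have zt: "conj t z \<in> L" and zk: "conj k z \<in> L" using conj_L tK \<sigma>(2) z by auto
      have "conj (conj g t) y = conj g (conj t z)"
        using g tK y by (simp add: z_def conj_mult)
      also have "\<phi> \<dots> = \<sigma> (\<phi> (conj k (conj t z)))" by (rule \<sigma>(3)[OF zt])
      also have "\<phi> (conj k (conj t z)) = \<phi> (conj t (conj k z))"
        by (rule \<phi>_conj_commute[OF \<sigma>(2) tK(1) z])
      also have "\<phi> (conj t (conj k z)) = \<tau> (\<phi> (conj k z))" using \<tau>(2) zk by blast
      also have "\<sigma> (\<tau> (\<phi> (conj k z))) = \<tau> (\<sigma> (\<phi> (conj k z)))"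
        by (rule auts_commute[OF \<sigma>(1) auts_F\<theta>[OF \<tau>(1)] \<phi>_E[OF zk]])
      also have "\<sigma> (\<phi> (conj k z)) = \<phi> (conj g z)" by (rule \<sigma>(3)[OF z, symmetric])
      also have "conj g z = y" unfolding z_def using g y by (intro conj_inv) auto
      finally show ?thesis .
    qed
    then show "conj g t \<in> A" using K.inv_op_closed2[OF g tK(1)] \<tau>(1) by (auto simp: A_def)
  qed
  show "L \<subseteq> A" using LK \<phi>_conj_L id_auts[OF F\<theta>(3)] by (auto simp: A_def)
  show "A \<subseteq> K" by (auto simp: A_def)
qed

lemma auts_F\<theta>_emb:
  assumes "\<sigma> \<in> auts F\<theta>"
  shows "field_emb F\<phi> \<sigma>" "\<And>x. x \<in> L \<Longrightarrow> \<sigma> (\<theta> x) = \<theta> x"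
  using assms field_emb_subset[OF _ F\<phi>(3)] F\<theta>(4) LK by (auto simp: auts_def)

text \<open>An automorphism of E over F(\<theta>) acts on \<phi> as some k in K, which then lies in
  A. With A = L this action is trivial, so F(\<phi>) is fixed pointwise and is contained in
  F(\<theta>).\<close>

lemma value_fields_eq:
  assumes T: "T = L" and A: "A = L"
  shows "F\<phi> = F\<theta>"
proof
  show "F\<theta> \<subseteq> F\<phi>" by (rule induced(3)[OF T])
  show "F\<phi> \<subseteq> F\<theta>"
  proof
    fix x assume x: "x \<in> F\<phi>"
    show "x \<in> F\<theta>"
    proof (rule auts_fixed[OF F\<theta>(1-3)])
      show "x \<in> E" using x F\<phi>(3) by blast
      fix \<sigma> assume \<sigma>: "\<sigma> \<in> auts F\<theta>"
      obtain k where k: "k \<in> K" "\<And>y. y \<in> L \<Longrightarrow> \<sigma> (\<phi> y) = \<phi> (conj k y)"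
        using \<phi>_galois_conj[OF auts_F\<theta>_emb[OF \<sigma>] induced(2)[OF T]] by blast
      moreover from k(2) have "\<forall>y\<in>L. \<phi> (conj k y) = \<sigma> (\<phi> y)" by simp
      ultimately have "k \<in> A" using \<sigma> unfolding A_def by blast
      then have "\<sigma> (\<phi> y) = \<phi> y" if "y \<in> L" for y using k(2)[OF that] A \<phi>_conj_L that by simp
      moreover have "field_emb F\<phi> (\<lambda>x. x)" by (simp add: field_emb_def)
      moreover have "\<sigma> y = y" if "y \<in> F" for y using auts_F\<theta>[OF \<sigma>] that by (simp add: auts_def)
      ultimately show "\<sigma> x = x"
        using value_field_emb_eqI[OF auts_F\<theta>_emb(1)[OF \<sigma>], of "\<lambda>x. x" x] x by simp
    qed
  qed
qed

text \<open>An element g acts on \<phi> as some \<sigma> together with some k in K. Since k lies in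
  A, it acts as an automorphism \<tau> as well, and the composite does what g does.\<close>

lemma \<phi>_semi_invariant:
  assumes A: "A = K"
  shows "semi_invariant G L F \<phi>"
proof (rule semi_invariantI[OF L_normal \<phi>_spherical])
  fix g assume "g \<in> carrier G"
  then obtain \<sigma> k where \<sigma>: "\<sigma> \<in> auts F" "k \<in> K" "\<And>y. y \<in> L \<Longrightarrow> \<phi> (conj g y) = \<sigma> (\<phi> (conj k y))"
    using \<phi>_conj by blast
  from \<sigma>(2) have "k \<in> A" by (simp add: A)
  then obtain \<tau> where \<tau>: "\<tau> \<in> auts F\<theta>" "\<forall>y\<in>L. \<phi> (conj k y) = \<tau> (\<phi> y)"
    unfolding A_def by blast
  have "(\<lambda>x. \<sigma> (\<tau> x)) \<in> auts F" by (rule auts_comp[OF \<sigma>(1) auts_F\<theta>[OF \<tau>(1)]])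
  then show "\<exists>\<sigma>\<in>auts F. \<forall>y\<in>L. \<phi> (conj g y) = \<sigma> (\<phi> y)"
    by (rule bexI[rotated]) (use \<sigma>(3) \<tau>(2) in auto)
qed

lemma factor_iso_galois:
  assumes T: "T = L" and A: "A = K"
  shows "factor_group G K L \<cong> galois_group F\<phi> F\<theta>"
proof -
  let ?\<Gamma> = "galois_group F\<phi> F\<theta>" and ?Q = "factor_group G K L"
  have KG: "k \<in> carrier G" if "k \<in> K" for k using that by auto
  \<comment> \<open>The elements of K that act on \<phi> as \<alpha>. The map starts on the Galois
    side, where Clifford's theorem shows that this set is nonempty; it is a coset of the stabiliser
    T, that is, of L.\<close>
  define h where "h \<alpha> = {k \<in> K. \<forall>y\<in>L. \<phi> (conj k y) = \<alpha> (\<phi> y)}" for \<alpha>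
  have ex: "\<exists>k. k \<in> h \<alpha>" if \<alpha>: "\<alpha> \<in> carrier ?\<Gamma>" for \<alpha>
  proof -
    have "field_emb F\<phi> \<alpha>" "\<And>x. x \<in> L \<Longrightarrow> \<alpha> (\<theta> x) = \<theta> x"
      using \<alpha> F\<theta>(4) LK by (auto simp: galois_group_iff)
    then obtain k where "k \<in> K" "\<And>y. y \<in> L \<Longrightarrow> \<alpha> (\<phi> y) = \<phi> (conj k y)"
      using \<phi>_galois_conj[OF _ _ induced(2)[OF T]] by blast
    then have "k \<in> h \<alpha>" by (simp add: h_def)
    then show ?thesis by blast
  qed
  have coset: "h \<alpha> = L #> k" if k: "k \<in> h \<alpha>" for \<alpha> k
  proof
    have kK: "k \<in> K" "\<And>y. y \<in> L \<Longrightarrow> \<phi> (conj k y) = \<alpha> (\<phi> y)" using k by (auto simp: h_def)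
    note kG = KG[OF kK(1)]
    show "L #> k \<subseteq> h \<alpha>"
    proof
      fix x assume "x \<in> L #> k"
      then obtain l where l: "l \<in> L" "x = l \<otimes> k" by (auto simp: r_coset_def)
      have "\<phi> (conj x y) = \<alpha> (\<phi> y)" if y: "y \<in> L" for y
        using \<phi>_conj_L[OF l(1) conj_L[OF kG y]] conj_mult[of l k y] kK(2)[OF y] l y kG by simp
      then show "x \<in> h \<alpha>" using l kK(1) LK by (auto simp: h_def)
    qed
    show "h \<alpha> \<subseteq> L #> k"
    proof
      fix x assume "x \<in> h \<alpha>"
      then have x: "x \<in> K" "\<And>y. y \<in> L \<Longrightarrow> \<phi> (conj x y) = \<alpha> (\<phi> y)" by (auto simp: h_def)
      note xG = KG[OF x(1)]
      have "\<phi> (conj (x \<otimes> inv k) y) = \<phi> y" if y: "y \<in> L" for y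
      proof -
        have z: "conj (inv k) y \<in> L" using kG y by (intro conj_L) auto
        have "\<phi> (conj (x \<otimes> inv k) y) = \<phi> (conj x (conj (inv k) y))"
          using xG kG y by (subst conj_mult) auto
        also have "\<dots> = \<phi> (conj k (conj (inv k) y))" using x(2)[OF z] kK(2)[OF z] by simp
        also have "conj k (conj (inv k) y) = y" using kG y by (intro conj_inv) auto
        finally show ?thesis .
      qed
      then have "x \<otimes> inv k \<in> L" using x(1) kK(1) T by (auto simp: T_def)
      moreover have "x = (x \<otimes> inv k) \<otimes> k" using xG kG by (simp add: m_assoc)
      ultimately show "x \<in> L #> k" unfolding r_coset_def by blast
    qed
  qed
  have closed: "\<alpha> \<otimes>\<^bsub>?\<Gamma>\<^esub> \<beta> \<in> carrier ?\<Gamma>" if "\<alpha> \<in> carrier ?\<Gamma>" "\<beta> \<in> carrier ?\<Gamma>" for \<alpha> \<beta>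
    using that galois_group_compose[OF that induced(3)[OF T] csubfieldD(1)[OF F\<phi>(1)] F\<phi>(1)]
    by (simp add: galois_group_mult)
  have mult: "h (\<alpha> \<otimes>\<^bsub>?\<Gamma>\<^esub> \<beta>) = h \<alpha> \<otimes>\<^bsub>?Q\<^esub> h \<beta>" if \<alpha>: "\<alpha> \<in> carrier ?\<Gamma>" and \<beta>: "\<beta> \<in> carrier ?\<Gamma>" for \<alpha> \<beta>
  proof -
    obtain k l where k: "k \<in> h \<alpha>" and l: "l \<in> h \<beta>" using ex \<alpha> \<beta> by blast
    have K: "k \<in> K" "l \<in> K" using k l by (auto simp: h_def)
    have "\<phi> (conj (k \<otimes> l) y) = (\<alpha> \<otimes>\<^bsub>?\<Gamma>\<^esub> \<beta>) (\<phi> y)" if y: "y \<in> L" for y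
    proof -
      \<comment> \<open>Elements of K act on arguments and automorphisms on values, yet the order is
        preserved: peeling off k yields \<alpha> outermost, then l yields \<beta>.\<close>
      have "\<phi> (conj (k \<otimes> l) y) = \<phi> (conj k (conj l y))"
        using KG K y by (subst conj_mult) auto
      also have "\<dots> = \<alpha> (\<beta> (\<phi> y))" using k l conj_L[OF KG[OF K(2)] y] y by (simp add: h_def)
      finally show ?thesis using F\<phi>(4)[OF y] by (simp add: galois_group_mult[OF \<alpha> \<beta>] compose_def)
    qed
    then have "k \<otimes> l \<in> h (\<alpha> \<otimes>\<^bsub>?\<Gamma>\<^esub> \<beta>)" using K by (simp add: h_def)
    then have "h (\<alpha> \<otimes>\<^bsub>?\<Gamma>\<^esub> \<beta>) = L #> (k \<otimes> l)" by (rule coset)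
    then show ?thesis using factor_mult[OF K] coset[OF k] coset[OF l] by simp
  qed
  have "inj_on h (carrier ?\<Gamma>)"
  proof (rule inj_onI)
    fix \<alpha> \<beta> assume \<alpha>: "\<alpha> \<in> carrier ?\<Gamma>" and \<beta>: "\<beta> \<in> carrier ?\<Gamma>" and eq: "h \<alpha> = h \<beta>"
    obtain k where k: "k \<in> h \<alpha>" using ex[OF \<alpha>] by blast
    then have eqL: "\<alpha> (\<phi> y) = \<beta> (\<phi> y)" if "y \<in> L" for y
      using eq that by (metis (mono_tags, lifting) h_def mem_Collect_eq)
    have fixed: "\<alpha> x = x" "\<beta> x = x" if "x \<in> F" for x
      using \<alpha> \<beta> F\<theta>(2) that by (auto simp: galois_group_iff)
    have "\<alpha> z = \<beta> z" if z: "z \<in> F\<phi>" for z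
    proof (rule value_field_emb_eqI[OF _ _ _ _ z])
      show "field_emb F\<phi> \<alpha>" "field_emb F\<phi> \<beta>" using \<alpha> \<beta> by (simp_all add: galois_group_iff)
      show "\<alpha> x = \<beta> x" if "x \<in> F" for x using fixed[OF that] by simp
      show "\<alpha> (\<phi> y) = \<beta> (\<phi> y)" if "y \<in> L" for y by (rule eqL[OF that])
    qed
    then show "\<alpha> = \<beta>" using \<alpha> \<beta> by (intro extensionalityI[of _ F\<phi>]) (auto simp: galois_group_iff)
  qed
  moreover have "h ` carrier ?\<Gamma> = carrier ?Q"
  proof
    show "h ` carrier ?\<Gamma> \<subseteq> carrier ?Q"
    proof safe
      fix \<alpha> assume "\<alpha> \<in> carrier ?\<Gamma>"
      then obtain k where "k \<in> h \<alpha>" using ex by blast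
      then show "h \<alpha> \<in> carrier ?Q" using coset by (auto simp: carrier_factor h_def)
    qed
    show "carrier ?Q \<subseteq> h ` carrier ?\<Gamma>"
    proof
      fix q assume "q \<in> carrier ?Q"
      then obtain k where k: "k \<in> K" "q = L #> k" by (auto simp: carrier_factor)
      \<comment> \<open>Surjectivity is where A = K enters: every k acts on \<phi> as an
        automorphism over F(\<theta>).\<close>
      from k(1) have "k \<in> A" by (simp add: A)
      then obtain \<sigma> where \<sigma>: "\<sigma> \<in> auts F\<theta>" "\<forall>y\<in>L. \<phi> (conj k y) = \<sigma> (\<phi> y)"
        unfolding A_def by blast
      have "restrict \<sigma> F\<phi> \<in> carrier ?\<Gamma>"
        using \<sigma>(1) by (intro restrict_auts_galois[OF F\<phi>(1-3) auts_F\<theta>] induced(3)[OF T]) (auto simp: auts_def)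
      moreover have "k \<in> h (restrict \<sigma> F\<phi>)" using k \<sigma>(2) F\<phi>(4) by (simp add: h_def)
      ultimately show "q \<in> h ` carrier ?\<Gamma>" using coset k(2) by blast
    qed
  qed
  ultimately have bij: "bij_betw h (carrier ?\<Gamma>) (carrier ?Q)" by (simp add: bij_betw_def)
  \<comment> \<open>The required isomorphism runs from the factor group to the Galois group, so it
    is the inverse of h.\<close>
  let ?f = "inv_into (carrier ?\<Gamma>) h"
  have f: "?f q \<in> carrier ?\<Gamma>" "h (?f q) = q" if "q \<in> carrier ?Q" for q
    using bij that by (auto simp: bij_betw_def inv_into_into f_inv_into_f)
  have "?f (q \<otimes>\<^bsub>?Q\<^esub> r) = ?f q \<otimes>\<^bsub>?\<Gamma>\<^esub> ?f r" if q: "q \<in> carrier ?Q" and r: "r \<in> carrier ?Q" for q r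
  proof -
    have c: "?f q \<otimes>\<^bsub>?\<Gamma>\<^esub> ?f r \<in> carrier ?\<Gamma>" by (rule closed[OF f(1)[OF q] f(1)[OF r]])
    have "h (?f q \<otimes>\<^bsub>?\<Gamma>\<^esub> ?f r) = q \<otimes>\<^bsub>?Q\<^esub> r"
      unfolding mult[OF f(1)[OF q] f(1)[OF r]] f(2)[OF q] f(2)[OF r] by (rule refl)
    then show ?thesis using inv_into_f_f[OF bij_betw_imp_inj_on[OF bij] c] by simp
  qed
  then have "?f \<in> hom ?Q ?\<Gamma>" using f(1) by (auto simp: hom_def)
  then have "?f \<in> iso ?Q ?\<Gamma>" using bij_betw_inv_into[OF bij] by (simp add: iso_def)
  then show ?thesis by (auto simp: is_iso_def)
qed

end

theorem proposition14p2:
  fixes G :: "('a, 'b) monoid_scheme"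
    and K L :: "'a set"
    and F :: "complex set"
    and \<theta> :: "'a \<Rightarrow> complex"
  assumes "group G"
    and "finite (carrier G)"
    and "chief_factor G K L"
    and "comm_group (factor_group G K L)"
    and "subfield F complex_field"
    and "\<theta> \<in> Irr (G\<lparr>carrier := K\<rparr>)"
    and "semi_invariant G K F \<theta>"
  shows
    "(\<exists>\<phi> \<in> Irr (G\<lparr>carrier := L\<rparr>).
        \<theta> = induced_char G L K \<phi> \<and>
        (value_field F L \<phi> = value_field F K \<theta> \<or>
         factor_group G K L \<cong> galois_group (value_field F L \<phi>) (value_field F K \<theta>) \<and>
         semi_invariant G L F \<phi>)) \<or>
     restrict_char L \<theta> \<in> Irr (G\<lparr>carrier := L\<rparr>) \<or>
     (\<exists>\<phi> \<in> Irr (G\<lparr>carrier := L\<rparr>). \<exists>e :: nat.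
        restrict_char L \<theta> = (\<lambda>x. of_nat e * \<phi> x) \<and>
        e ^ 2 = Coset.order (factor_group G K L) \<and>
        value_field F K \<theta> = value_field F L \<phi>)"
proof -
  interpret group G by fact
  interpret semi_invariant_chief G F K L \<theta>
  proof (intro semi_invariant_chief.intro semi_invariant_chief_axioms.intro
      finite_group_field.intro finite_group_field_axioms.intro cyclotomic_extension.intro)
    show "csubfield F" using assms(5) by (rule subfield_imp_csubfield)
    show "0 < card (carrier G)" using assms(2) one_closed by (auto simp: card_gt_0_iff)
  qed fact+
  show ?thesis
  proof (cases "restrict_char L \<theta> \<in> Irr (G\<lparr>carrier := L\<rparr>)")
    case False
    then have v: "\<And>x. x \<in> K - L \<Longrightarrow> \<theta> x = 0" using restrict_irreducible_or_vanishes by blast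
    obtain cs where cs: "set cs \<subseteq> Irr (G\<lparr>carrier := L\<rparr>)" "\<And>x. x \<in> L \<Longrightarrow> \<theta> x = (\<Sum>\<chi>\<leftarrow>cs. \<chi> x)"
      using restrict_decompose[OF L_sub K_sub LK assms(6)] by blast
    \<comment> \<open>Since \<theta> vanishes off L, its norm over L is |K| and not 0, so some entry
      of \<open>cs\<close> pairs nontrivially with \<theta>; that entry serves as \<phi>.\<close>
    have "char_prod G L \<theta> \<theta> = char_prod G K \<theta> \<theta>"
      unfolding char_prod_def using LK finK v by (intro sum.mono_neutral_left) auto
    then have "char_prod G L \<theta> \<theta> \<noteq> 0"
      using sphericalD(4)[OF \<theta>_spherical] subgroup_card_neq_0[OF K_sub finK] by simp
    moreover have "char_prod G L \<theta> \<theta> = (\<Sum>x\<in>L. (\<Sum>\<chi>\<leftarrow>cs. \<chi> x) * \<theta> (inv\<^bsub>G\<^esub> x))"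
      unfolding char_prod_def using cs(2) by (intro sum.cong) auto
    ultimately have "(\<Sum>\<chi>\<leftarrow>cs. char_prod G L \<chi> \<theta>) \<noteq> 0" by (simp add: sum_list_char_prod)
    then obtain \<phi> where \<phi>: "\<phi> \<in> set cs" "char_prod G L \<phi> \<theta> \<noteq> 0" by (rule sum_list_neq_0E)
    interpret chief_constituent G F K L \<theta> \<phi>
    proof unfold_locales
      show "spherical G L \<phi>" using \<phi>(1) cs(1) Irr_subgroup_iff[OF L_sub finL] by blast
      show "char_prod G L \<theta> \<phi> \<noteq> 0" using \<phi>(2) char_prod_commute[OF L_sub] by metis
    qed (rule v)
    from T_cases show ?thesis
    proof
      assume T: "T = L"
      from A_cases show ?thesis
        using \<phi>_Irr induced(1)[OF T] value_fields_eq[OF T] factor_iso_galois[OF T] \<phi>_semi_invariant by metis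
    next
      assume "T = K"
      then show ?thesis using \<phi>_Irr fully_ramified by blast
    qed
  qed simp
qed

end
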